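(* Let $p,q\in(1,\infty)$, set $\frac1r:=\frac1q-\frac1p$ and $\frac\alpha d:=\frac1p-\frac1q$. Let $\mu$ and $\lambda$ be weights on $\mathbb{R}^d$ and set $\lambda':=\lambda^{-q'/q}$ and $\nu^{\frac1p+\frac1{q'}}:=\mu^{\frac1p}\lambda^{-\frac1q}$. Let $b\in L^1_{\mathrm{loc}}(\mathbb{R}^d)$, and assume that $\Pi_b:L^p(\mu)\to L^q(\lambda)$ is bounded and that $(\mu,\lambda')\in B_{p,q'}(\nu)$. Then, with a constant $C$ depending only on $p,q,d$: if $p\le q$, then $$\|b\|_{\mathrm{BMO}^\alpha_\nu}\le C\,[\mu,\lambda']_{B_{p,q'}(\nu)}\,\|\Pi_b\|_{L^p(\mu)\to L^q(\lambda)};$$ if $p>q$, then $$\|M^{\#}_\nu b\|_{L^r(\nu)}\le C\,[\mu,\lambda']_{B_{p,q'}(\nu)}\,[\mu]_{A_\infty(\nu)}^{1/p'}\,[\lambda']_{A_\infty(\nu)}^{1/q}\,\|\Pi_b\|_{L^p(\mu)\to L^q(\lambda)}.$$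
   Context: A dyadic lattice $\mathcal D=\bigcup_{k\in\mathbb Z}\mathcal D_k$ on $\mathbb{R}^d$ is fixed: $\mathcal D_k$ is a partition of $\mathbb{R}^d$ into (axis-parallel) cubes of side length $2^{-k}$ and $\mathcal D_{k+1}$ refines $\mathcal D_k$. For $Q\in\mathcal D$, $\widehat Q$ is the smallest $R\in\mathcal D$ with $Q\subsetneq R$. All suprema over cubes below (in the maximal function, BMO norm and weight characteristics) are over $Q\in\mathcal D$. $\langle f\rangle_Q:=\frac1{|Q|}\int_Qf\,dx$; $p'$ is the conjugate exponent. A weight is a locally integrable $w:\mathbb{R}^d\to(0,\infty)$; $w(E):=\int_Ew\,dx$; $\|f\|_{L^p(w)}:=(\int|f|^pw\,dx)^{1/p}$. The functions $\mu,\lambda',\nu$ are all understood to be weights (locally integrable). Moreover $$[\mu,\lambda']_{B_{p,q'}(\nu)}:=\sup_Q\Big(\frac{\mu(Q)}{\nu(Q)}\Big)^{1/p}\Big(\frac{\lambda'(Q)}{\nu(Q)}\Big)^{1/q'},\qquad [w]_{A_\infty(\nu)}:=\sup_Q\frac1{w(Q)}\int_Q\sup_{R\in\mathcal D,\,x\in R\subseteq Q}\frac{w(R)}{\nu(R)}\,d\nu(x),$$ and $(\mu,\lambda')\in B_{p,q'}(\nu)$ means the first quantity is finite. $\|b\|_{\mathrm{BMO}^\alpha_\nu}:=\sup_Q\frac1{\nu(Q)^{1+\alpha/d}}\int_Q|b-\langle b\rangle_Q|\,dx$ and $M^{\#}_\nu b:=\sup_Q\frac{\mathbf 1_Q}{\nu(Q)}\int_Q|b-\langle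 b\rangle_Q|\,dx$. Paraproduct: $D_Qb:=\sum_{R\in\mathcal D:\widehat R=Q}\langle b\rangle_R\mathbf 1_R-\langle b\rangle_Q\mathbf 1_Q$ and $\Pi_bf:=\sum_{Q\in\mathcal D}D_Qb\,\langle f\rangle_Q$ for $f\in L^\infty_c$ (bounded, compactly supported). It is part of the assumption that $\Pi_b$ is well defined, i.e. for each $f\in L^\infty_c$ this sum converges unconditionally in $L^1(K)$ for every compact $K$. Boundedness means $\|\Pi_bf\|_{L^q(\lambda)}\le N\|f\|_{L^p(\mu)}$ for all $f\in L^\infty_c$, and $\|\Pi_b\|_{L^p(\mu)\to L^q(\lambda)}$ is the least such $N$. *)

theory Defs
  imports "HOL-Analysis.Analysis" "HOL-Library.Disjoint_Sets"
begin

section \<open>Dyadic lattices\<close>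

text \<open>\<^const>\<open>is_interval\<close> makes \<open>Q\<close> a product of one-dimensional intervals; which of its faces
  belong to \<open>Q\<close> is left open, so half-open cubes of any orientation are allowed.\<close>

definition is_cube :: "real \<Rightarrow> 'a::euclidean_space set \<Rightarrow> bool" where
  "is_cube l Q \<longleftrightarrow>
     is_interval Q \<and> (\<exists>a. box a (a + l *\<^sub>R One) \<subseteq> Q \<and> Q \<subseteq> cbox a (a + l *\<^sub>R One))"

definition dyadic_lattice :: "'a::euclidean_space set set \<Rightarrow> bool" where
  "dyadic_lattice \<D> \<longleftrightarrow>
     (\<exists>\<D>\<^sub>g :: int \<Rightarrow> 'a set set. \<D> = (\<Union>k. \<D>\<^sub>g k) \<and>
        (\<forall>k. partition_on UNIV (\<D>\<^sub>g k) \<and> (\<forall>Q\<in>\<D>\<^sub>g k. is_cube (2 powi (- k)) Q) \<and>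
             refines UNIV (\<D>\<^sub>g (k + 1)) (\<D>\<^sub>g k)))"

text \<open>The least element is with respect to inclusion.\<close>

definition dyadic_parent :: "'a set set \<Rightarrow> 'a set \<Rightarrow> 'a set" where
  "dyadic_parent \<D> Q = (LEAST R. R \<in> \<D> \<and> Q \<subset> R)"


section \<open>Weights, averages and weighted norms\<close>

definition conj_exponent :: "real \<Rightarrow> real" where
  "conj_exponent p = p / (p - 1)"

definition locally_integrable :: "('a::euclidean_space \<Rightarrow> 's::euclidean_space) \<Rightarrow> bool" where
  "locally_integrable f \<longleftrightarrow> (\<forall>K. compact K \<longrightarrow> f absolutely_integrable_on K)"

definition weight :: "('a::euclidean_space \<Rightarrow> real) \<Rightarrow> bool" where
  "weight w \<longleftrightarrow> (\<forall>x. 0 < w x) \<and> locally_integrable w"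

definition weight_of :: "('a::euclidean_space \<Rightarrow> real) \<Rightarrow> 'a set \<Rightarrow> ennreal" where
  "weight_of w E = (\<integral>\<^sup>+x\<in>E. ennreal (w x) \<partial>lebesgue)"

definition average :: "('a::euclidean_space \<Rightarrow> 's::euclidean_space) \<Rightarrow> 'a set \<Rightarrow> 's" where
  "average f Q = (LINT x:Q|lebesgue. f x) /\<^sub>R measure lebesgue Q"

text \<open>Powers of extended non-negative numbers, used for exponents \<open>a > 0\<close> only.\<close>

definition epowr :: "ennreal \<Rightarrow> real \<Rightarrow> ennreal" (infixr \<open>epowr\<close> 80) where
  "x epowr a = (if x = \<infinity> then \<infinity> else ennreal (enn2real x powr a))"

text \<open>The argument is the modulus of the function whose norm is taken; it is extended-real valued
  because maximal functions may take the value \<open>\<infinity>\<close>.\<close>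

definition weighted_norm ::
  "real \<Rightarrow> ('a::euclidean_space \<Rightarrow> real) \<Rightarrow> ('a \<Rightarrow> ennreal) \<Rightarrow> ennreal" where
  "weighted_norm p w g = (\<integral>\<^sup>+x. g x epowr p * ennreal (w x) \<partial>lebesgue) epowr (1 / p)"

abbreviation Lp_norm ::
  "real \<Rightarrow> ('a::euclidean_space \<Rightarrow> real) \<Rightarrow> ('a \<Rightarrow> 's::real_normed_vector) \<Rightarrow> ennreal" where
  "Lp_norm p w f \<equiv> weighted_norm p w (\<lambda>x. ennreal (norm (f x)))"


section \<open>Weight characteristics\<close>

definition B_char ::
  "'a::euclidean_space set set \<Rightarrow> real \<Rightarrow> real \<Rightarrow> ('a \<Rightarrow> real) \<Rightarrow> ('a \<Rightarrow> real) \<Rightarrow> ('a \<Rightarrow> real) \<Rightarrow> ennreal"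
  where
  "B_char \<D> p s \<nu> \<mu> \<sigma> =
     (SUP Q\<in>\<D>. (weight_of \<mu> Q / weight_of \<nu> Q) epowr (1 / p) *
               (weight_of \<sigma> Q / weight_of \<nu> Q) epowr (1 / s))"

definition Ainf_char ::
  "'a::euclidean_space set set \<Rightarrow> ('a \<Rightarrow> real) \<Rightarrow> ('a \<Rightarrow> real) \<Rightarrow> ennreal" where
  "Ainf_char \<D> \<nu> w =
     (SUP Q\<in>\<D>. (\<integral>\<^sup>+x\<in>Q. (SUP R\<in>{R\<in>\<D>. x \<in> R \<and> R \<subseteq> Q}. weight_of w R / weight_of \<nu> R)
                        * ennreal (\<nu> x) \<partial>lebesgue) / weight_of w Q)"


section \<open>Oscillation: weighted BMO and the sharp maximal function\<close>

definition oscillation :: "('a::euclidean_space \<Rightarrow> 's::euclidean_space) \<Rightarrow> 'a set \<Rightarrow> ennreal" where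
  "oscillation b Q = (\<integral>\<^sup>+x\<in>Q. ennreal (norm (b x - average b Q)) \<partial>lebesgue)"

definition BMO_norm ::
  "'a::euclidean_space set set \<Rightarrow> real \<Rightarrow> ('a \<Rightarrow> real) \<Rightarrow> ('a \<Rightarrow> 's::euclidean_space) \<Rightarrow> ennreal" where
  "BMO_norm \<D> \<alpha> \<nu> b =
     (SUP Q\<in>\<D>. oscillation b Q / weight_of \<nu> Q epowr (1 + \<alpha> / real DIM('a)))"

definition sharp_maximal ::
  "'a::euclidean_space set set \<Rightarrow> ('a \<Rightarrow> real) \<Rightarrow> ('a \<Rightarrow> 's::euclidean_space) \<Rightarrow> 'a \<Rightarrow> ennreal" where
  "sharp_maximal \<D> \<nu> b x = (SUP Q\<in>\<D>. indicator Q x / weight_of \<nu> Q * oscillation b Q)"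


section \<open>Paraproducts\<close>

text \<open>The scalar type \<open>'s\<close> is \<^typ>\<open>real\<close> or \<^typ>\<open>complex\<close>; both are covered by the sort
  \<open>{real_normed_field, euclidean_space}\<close>.\<close>

definition Linf_c :: "('a::euclidean_space \<Rightarrow> 's::euclidean_space) set" where
  "Linf_c = {f \<in> borel_measurable lebesgue.
     bounded (range f) \<and> (\<exists>K. compact K \<and> (\<forall>x. x \<notin> K \<longrightarrow> f x = 0))}"

text \<open>In a dyadic lattice the sum is over the \<open>2 ^ d\<close> dyadic children of \<open>Q\<close>, hence finite.\<close>

definition dyadic_diff ::
  "'a::euclidean_space set set \<Rightarrow> ('a \<Rightarrow> 's::euclidean_space) \<Rightarrow> 'a set \<Rightarrow> 'a \<Rightarrow> 's" where
  "dyadic_diff \<D> b Q x =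
     (\<Sum>R\<in>{R\<in>\<D>. dyadic_parent \<D> R = Q}. indicator R x *\<^sub>R average b R)
       - indicator Q x *\<^sub>R average b Q"

text \<open>\<open>g\<close> is the sum of the series defining the paraproduct: the net of all finite partial sums
  converges to \<open>g\<close> in \<open>L\<^sup>1(K)\<close> for every compact \<open>K\<close> (unconditional convergence, as in
  \<^const>\<open>HAS_SUM\<close>).\<close>

definition is_paraproduct ::
  "'a::euclidean_space set set \<Rightarrow> ('a \<Rightarrow> 's) \<Rightarrow> ('a \<Rightarrow> 's)
     \<Rightarrow> ('a \<Rightarrow> 's::{real_normed_field,euclidean_space}) \<Rightarrow> bool" where
  "is_paraproduct \<D> b f g \<longleftrightarrow> locally_integrable g \<and>
     (\<forall>K. compact K \<longrightarrow>
        ((\<lambda>F. \<integral>\<^sup>+x\<in>K. ennreal (norm ((\<Sum>Q\<in>F. dyadic_diff \<D> b Q x * average f Q) - g x)) \<partial>lebesgue)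
           \<longlongrightarrow> 0) (finite_subsets_at_top \<D>))"

definition paraproduct_well_defined ::
  "'a::euclidean_space set set \<Rightarrow> ('a \<Rightarrow> 's::{real_normed_field,euclidean_space}) \<Rightarrow> bool" where
  "paraproduct_well_defined \<D> b \<longleftrightarrow> (\<forall>f\<in>Linf_c. \<exists>g. is_paraproduct \<D> b f g)"

text \<open>The sum is determined up to a null set only; any representative is chosen.\<close>

definition paraproduct ::
  "'a::euclidean_space set set \<Rightarrow> ('a \<Rightarrow> 's) \<Rightarrow> ('a \<Rightarrow> 's)
     \<Rightarrow> 'a \<Rightarrow> 's::{real_normed_field,euclidean_space}" where
  "paraproduct \<D> b f = (SOME g. is_paraproduct \<D> b f g)"

definition paraproduct_bound ::
  "'a::euclidean_space set set \<Rightarrow> ('a \<Rightarrow> 's::{real_normed_field,euclidean_space})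
     \<Rightarrow> real \<Rightarrow> ('a \<Rightarrow> real) \<Rightarrow> real \<Rightarrow> ('a \<Rightarrow> real) \<Rightarrow> ennreal \<Rightarrow> bool" where
  "paraproduct_bound \<D> b p \<mu> q \<Lambda> N \<longleftrightarrow>
     (\<forall>f\<in>Linf_c. Lp_norm q \<Lambda> (paraproduct \<D> b f) \<le> N * Lp_norm p \<mu> f)"

definition paraproduct_bounded ::
  "'a::euclidean_space set set \<Rightarrow> ('a \<Rightarrow> 's::{real_normed_field,euclidean_space})
     \<Rightarrow> real \<Rightarrow> ('a \<Rightarrow> real) \<Rightarrow> real \<Rightarrow> ('a \<Rightarrow> real) \<Rightarrow> bool" where
  "paraproduct_bounded \<D> b p \<mu> q \<Lambda> \<longleftrightarrow>
     paraproduct_well_defined \<D> b \<and> (\<exists>N<\<infinity>. paraproduct_bound \<D> b p \<mu> q \<Lambda> N)"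

definition paraproduct_norm ::
  "'a::euclidean_space set set \<Rightarrow> ('a \<Rightarrow> 's::{real_normed_field,euclidean_space})
     \<Rightarrow> real \<Rightarrow> ('a \<Rightarrow> real) \<Rightarrow> real \<Rightarrow> ('a \<Rightarrow> real) \<Rightarrow> ennreal" where
  "paraproduct_norm \<D> b p \<mu> q \<Lambda> = Inf {N. paraproduct_bound \<D> b p \<mu> q \<Lambda> N}"

end

theory Submission
  imports Defs
begin

text \<open>
  On a cube \<open>Q\<close> the paraproduct \<open>g\<close> of the indicator of \<open>Q\<close> differs from \<open>b\<close> by a constant, because the
  martingale differences of cubes containing \<open>Q\<close> strictly are constant on \<open>Q\<close>. Hence the oscillation of
  \<open>b\<close> on \<open>Q\<close> is the pairing of \<open>g\<close> with a mean-zero function \<open>h Q\<close> bounded by \<open>2\<close> and supported in \<open>Q\<close>,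
  and Hoelder's inequality gives the BMO bound.

  For \<open>q < p\<close>, put \<open>m Q = oscillation / \<nu>(Q)\<close>. Stopping cubes, along which \<open>m\<close> more than quadruples, form a
  family \<open>S\<close> that is automatically sparse with respect to \<open>\<nu>\<close>, and the sharp maximal function is controlled
  by \<open>V = (\<Sum>Q\<in>S. m Q powr r * \<nu>(Q))\<close>. With \<open>a Q = m Q powr (r/p) * (\<nu>(Q)/\<mu>(Q)) powr (1/p)\<close> and
  \<open>c Q = m Q powr (r/q') * (\<nu>(Q)/\<Lambda>'(Q)) powr (1/q')\<close> the sum \<open>V\<close> is at most the B-characteristic times
  \<open>\<Sum>Q\<in>S. a Q * c Q * oscillation\<close>. A choice of signs decouples this diagonal sum into one pairing of the
  paraproduct of \<open>\<Sum>Q. \<plusminus> a Q * 1\<^sub>Q\<close> with \<open>\<Sum>Q. \<plusminus> c Q * h Q\<close>. Sparseness turns the \<open>A\<^sub>\<infinity>\<close>-characteristics into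
  Carleson constants, and the Carleson embedding bounds the norms of both sums by powers of \<open>V\<close> that add
  up to \<open>1 - 1/r\<close>.
\<close>

subsection \<open>Powers in the extended reals and Hoelder's inequality\<close>

text \<open>The paraproduct is known only as an \<open>L^1\<close>-limit with an arbitrary
  representative, so its linearity in the input is available only after integration against a fixed
  bounded function. For \<open>q < p\<close> the coefficients \<open>a\<close> and \<open>c\<close>
  come from the equality case of Hoelder's inequality: they make both Carleson sums equal to
  \<open>V\<close>, and the exponents fit because \<open>1/p + 1/q' = 1 - 1/r\<close>. The outcome
  has the shape \<open>V \<le> K * V powr (1 - 1/r)\<close>, from which \<open>V\<close> can be
  bounded only if it is finite. This is why all combinatorics concerns finite families; no constant
  sees their size, and monotone convergence over the countable lattice restores the full supremum.
  The stopping factor 4 is a product of two factors 2: one is lost when an average is replaced by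
  another constant in an oscillation, and the other leaves half of the \<nu>-mass of each stopping
  cube uncovered by smaller ones.\<close>

lemma epowr_ennreal: "0 \<le> x \<Longrightarrow> ennreal x epowr a = ennreal (x powr a)"
  by (simp add: epowr_def)

lemma epowr_top [simp]: "top epowr a = top"
  by (simp add: epowr_def)

lemma epowr_mono:
  assumes "x \<le> y" "0 < a"
  shows "x epowr a \<le> y epowr a"
proof (cases y)
  case (real s)
  with assms(1) obtain t where "x = ennreal t" "0 \<le> t" "t \<le> s"
    by (cases x) (auto simp: top_unique)
  then show ?thesis
    using real assms(2) by (auto simp: epowr_ennreal intro!: ennreal_leI powr_mono2)
qed simp

lemma epowr_epowr:
  assumes "0 < a" "0 < b"
  shows "(x epowr a) epowr b = x epowr (a * b)"
  using assms by (cases x) (auto simp: epowr_ennreal powr_powr)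

lemma epowr_one [simp]: "x epowr 1 = x"
  by (cases x) (auto simp: epowr_ennreal)

text \<open>The power is an order isomorphism whose inverse has exponent \<open>1 / a\<close>, so it
  commutes with arbitrary suprema. This moves the exponent \<open>r\<close> inside the sharp maximal
  function.\<close>

lemma SUP_epowr:
  assumes a: "0 < a"
  shows "(SUP i\<in>I. f i) epowr a = (SUP i\<in>I. f i epowr a)"
proof (rule antisym)
  have inv: "(x epowr a) epowr (1 / a) = x" "(x epowr (1 / a)) epowr a = x" for x
    using a by (simp_all add: epowr_epowr)
  have "(SUP i\<in>I. f i) \<le> (SUP i\<in>I. f i epowr a) epowr (1 / a)"
  proof (rule SUP_least)
    fix i assume "i \<in> I"
    then have "(f i epowr a) epowr (1 / a) \<le> (SUP i\<in>I. f i epowr a) epowr (1 / a)"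
      using a by (intro epowr_mono SUP_upper) auto
    then show "f i \<le> (SUP i\<in>I. f i epowr a) epowr (1 / a)"
      by (simp add: inv)
  qed
  from epowr_mono[OF this a] show "(SUP i\<in>I. f i) epowr a \<le> (SUP i\<in>I. f i epowr a)"
    by (simp add: inv)
  show "(SUP i\<in>I. f i epowr a) \<le> (SUP i\<in>I. f i) epowr a"
    using a by (intro SUP_least epowr_mono SUP_upper) auto
qed

text \<open>Young's inequality is integrated for \<open>f / A powr (1 / p)\<close> and
  \<open>g / B powr (1 / q)\<close>. Real upper bounds \<open>A\<close> and \<open>B\<close> stand
  in for the integrals, which keeps infinite values out. A zero bound forbids the normalisation, but
  then one factor vanishes almost everywhere.\<close>

lemma nn_integral_Holder:
  fixes f g :: "'b \<Rightarrow> real"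
  assumes pq: "1 < p" "1 < q" "1 / p + 1 / q = 1"
    and [measurable]: "f \<in> borel_measurable M" "g \<in> borel_measurable M"
    and nn: "\<And>x. 0 \<le> f x" "\<And>x. 0 \<le> g x"
    and A: "(\<integral>\<^sup>+x. ennreal (f x powr p) \<partial>M) \<le> ennreal A" "0 \<le> A"
    and B: "(\<integral>\<^sup>+x. ennreal (g x powr q) \<partial>M) \<le> ennreal B" "0 \<le> B"
  shows "(\<integral>\<^sup>+x. ennreal (f x * g x) \<partial>M) \<le> ennreal (A powr (1 / p) * B powr (1 / q))"
proof -
  have vanish: "(\<integral>\<^sup>+x. ennreal (f x * g x) \<partial>M) = 0"
    if "AE x in M. ennreal (f x powr p) = 0 \<or> ennreal (g x powr q) = 0"
  proof -
    have "AE x in M. ennreal (f x * g x) = 0"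
      using that by eventually_elim (auto simp: ennreal_eq_0_iff)
    then show ?thesis by (simp add: nn_integral_0_iff_AE)
  qed
  consider "A = 0" | "B = 0" | "0 < A" "0 < B"
    using A(2) B(2) by linarith
  then show ?thesis
  proof cases
    case 1
    then have "(\<integral>\<^sup>+x. ennreal (f x powr p) \<partial>M) = 0"
      using A by simp
    then have "AE x in M. ennreal (f x powr p) = 0"
      by (subst (asm) nn_integral_0_iff_AE) auto
    then have "AE x in M. ennreal (f x powr p) = 0 \<or> ennreal (g x powr q) = 0"
      by eventually_elim auto
    from vanish[OF this] show ?thesis by simp
  next
    case 2
    then have "(\<integral>\<^sup>+x. ennreal (g x powr q) \<partial>M) = 0"
      using B by simp
    then have "AE x in M. ennreal (g x powr q) = 0"
      by (subst (asm) nn_integral_0_iff_AE) auto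
    then have "AE x in M. ennreal (f x powr p) = 0 \<or> ennreal (g x powr q) = 0"
      by eventually_elim auto
    from vanish[OF this] show ?thesis by simp
  next
    case 3
    define c where "c = A powr (1 / p) * B powr (1 / q)"
    have c: "0 < c" using 3 by (simp add: c_def)
    have bound: "f x * g x \<le> c / (A * p) * f x powr p + c / (B * q) * g x powr q" for x
    proof -
      have "(f x / A powr (1 / p)) * (g x / B powr (1 / q))
          \<le> (f x / A powr (1 / p)) powr p / p + (g x / B powr (1 / q)) powr q / q"
        using pq nn by (intro Youngs_inequality) auto
      also have "\<dots> = f x powr p / (A * p) + g x powr q / (B * q)"
        using pq nn 3 by (simp add: powr_divide powr_powr)
      finally have "c * ((f x / A powr (1 / p)) * (g x / B powr (1 / q)))
          \<le> c * (f x powr p / (A * p) + g x powr q / (B * q))"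
        using c by (intro mult_left_mono) auto
      moreover have "c * ((f x / A powr (1 / p)) * (g x / B powr (1 / q))) = f x * g x"
        using 3 by (simp add: c_def)
      ultimately show ?thesis by (simp add: algebra_simps)
    qed
    have "(\<integral>\<^sup>+x. ennreal (f x * g x) \<partial>M)
        \<le> (\<integral>\<^sup>+x. ennreal (c / (A * p)) * ennreal (f x powr p)
             + ennreal (c / (B * q)) * ennreal (g x powr q) \<partial>M)"
      using c 3 pq bound
      by (intro nn_integral_mono) (simp add: ennreal_leI flip: ennreal_mult' ennreal_plus)
    also have "\<dots> = ennreal (c / (A * p)) * (\<integral>\<^sup>+x. ennreal (f x powr p) \<partial>M)
             + ennreal (c / (B * q)) * (\<integral>\<^sup>+x. ennreal (g x powr q) \<partial>M)"
      by (simp add: nn_integral_add nn_integral_cmult)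
    also have "\<dots> \<le> ennreal (c / (A * p)) * ennreal A + ennreal (c / (B * q)) * ennreal B"
      using A B by (intro add_mono mult_left_mono) auto
    also have "\<dots> = ennreal (c / p + c / q)"
      using c 3 pq by (simp flip: ennreal_mult' ennreal_plus)
    also have "c / p + c / q = c"
      using pq(3) by (metis distrib_left mult.right_neutral times_divide_eq_right)
    finally show ?thesis by (simp add: c_def)
  qed
qed

text \<open>The case of counting measure. Signs are known on \<open>I\<close> only while the
  integral version asks for them everywhere, hence the absolute values in the proof.\<close>

lemma sum_Holder:
  fixes f g :: "'b \<Rightarrow> real"
  assumes pq: "1 < p" "1 < q" "1 / p + 1 / q = 1" and I: "finite I"
    and nn: "\<And>x. x \<in> I \<Longrightarrow> 0 \<le> f x" "\<And>x. x \<in> I \<Longrightarrow> 0 \<le> g x"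
  shows "(\<Sum>x\<in>I. f x * g x) \<le> (\<Sum>x\<in>I. f x powr p) powr (1 / p) * (\<Sum>x\<in>I. g x powr q) powr (1 / q)"
proof -
  have sum: "(\<integral>\<^sup>+x. ennreal (h x) \<partial>count_space I) = ennreal (\<Sum>x\<in>I. h x)"
    if "\<And>x. x \<in> I \<Longrightarrow> 0 \<le> h x" for h
    using I that by (simp add: nn_integral_count_space_finite)
  have "(\<integral>\<^sup>+x. ennreal (\<bar>f x\<bar> * \<bar>g x\<bar>) \<partial>count_space I)
      \<le> ennreal ((\<Sum>x\<in>I. \<bar>f x\<bar> powr p) powr (1 / p) * (\<Sum>x\<in>I. \<bar>g x\<bar> powr q) powr (1 / q))"
    by (rule nn_integral_Holder) (use pq in \<open>auto simp: sum sum_nonneg\<close>)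
  then show ?thesis
    using nn by (simp add: sum sum_nonneg)
qed


subsection \<open>Finite laminar families\<close>

text \<open>Builds a finite family from the top down: the element added last lies above none of the
  earlier ones, so it changes no sum over the supersets of an earlier member.\<close>

lemma finite_minimal_induct [consumes 1, case_names empty insert]:
  fixes C :: "'b::order set"
  assumes "finite C" and "P {}"
    and step: "\<And>M C. finite C \<Longrightarrow> M \<notin> C \<Longrightarrow> (\<And>R. R \<in> C \<Longrightarrow> \<not> R \<le> M) \<Longrightarrow> P C \<Longrightarrow> P (insert M C)"
  shows "P C"
  using assms(1)
proof (induction C rule: finite_psubset_induct)
  case (psubset C)
  show ?case
  proof (cases "C = {}")
    case False
    then obtain M where M: "M \<in> C" "\<forall>R\<in>C. R \<le> M \<longrightarrow> M = R"
      using finite_has_minimal[OF psubset(1)] by auto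
    have "P (insert M (C - {M}))"
      by (rule step) (use psubset M in auto)
    then show ?thesis using M by (simp add: insert_absorb)
  qed (use assms(2) in simp)
qed

text \<open>Along a chain the inner sum is the partial sum from the largest set down to
  \<open>R\<close>, and without \<open>a R\<close> it is the partial sum just before
  \<open>R\<close>. In the application \<phi> is a power.\<close>

lemma chain_telescope:
  fixes a :: "'b set \<Rightarrow> real"
  assumes "finite C" and "\<And>P Q. P \<in> C \<Longrightarrow> Q \<in> C \<Longrightarrow> P \<subseteq> Q \<or> Q \<subseteq> P"
  shows "(\<Sum>R\<in>C. \<phi> (\<Sum>P\<in>{P\<in>C. R \<subseteq> P}. a P) - \<phi> ((\<Sum>P\<in>{P\<in>C. R \<subseteq> P}. a P) - a R))
           = \<phi> (\<Sum>P\<in>C. a P) - (\<phi> 0 :: real)"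
  using assms
proof (induction C rule: finite_minimal_induct)
  case empty
  then show ?case by simp
next
  case (insert M C)
  have M: "{P \<in> insert M C. M \<subseteq> P} = insert M C"
  proof -
    have "M \<subseteq> P" if "P \<in> C" for P
      using insert.prems[of M P] insert.hyps(3)[OF that] that by auto
    then show ?thesis by auto
  qed
  have C: "{P \<in> insert M C. R \<subseteq> P} = {P \<in> C. R \<subseteq> P}" if "R \<in> C" for R
    using insert.hyps that by auto
  have "(\<Sum>R\<in>insert M C. \<phi> (\<Sum>P\<in>{P\<in>insert M C. R \<subseteq> P}. a P)
            - \<phi> ((\<Sum>P\<in>{P\<in>insert M C. R \<subseteq> P}. a P) - a R))
      = (\<phi> (\<Sum>P\<in>insert M C. a P) - \<phi> (\<Sum>P\<in>C. a P))
          + (\<Sum>R\<in>C. \<phi> (\<Sum>P\<in>{P\<in>C. R \<subseteq> P}. a P) - \<phi> ((\<Sum>P\<in>{P\<in>C. R \<subseteq> P}. a P) - a R))"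
  proof -
    have "(\<Sum>R\<in>C. \<phi> (\<Sum>P\<in>{P\<in>insert M C. R \<subseteq> P}. a P) - \<phi> ((\<Sum>P\<in>{P\<in>insert M C. R \<subseteq> P}. a P) - a R))
        = (\<Sum>R\<in>C. \<phi> (\<Sum>P\<in>{P\<in>C. R \<subseteq> P}. a P) - \<phi> ((\<Sum>P\<in>{P\<in>C. R \<subseteq> P}. a P) - a R))"
      by (intro sum.cong refl) (simp only: C)
    then show ?thesis
      unfolding sum.insert[OF insert.hyps(1,2)] M by simp
  qed
  also have "(\<Sum>R\<in>C. \<phi> (\<Sum>P\<in>{P\<in>C. R \<subseteq> P}. a P) - \<phi> ((\<Sum>P\<in>{P\<in>C. R \<subseteq> P}. a P) - a R))
      = \<phi> (\<Sum>P\<in>C. a P) - \<phi> 0"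
    using insert.prems by (intro insert.IH) auto
  finally show ?case by simp
qed

text \<open>Greedy selection from the top: a set is selected exactly when no selected superset
  dominates it up to the factor \<open>c\<close>. A selected set thus exceeds \<open>c\<close> times
  every selected strict superset, and a rejected one is covered by the superset that caused its
  rejection.\<close>

lemma stopping_family:
  fixes m :: "'b set \<Rightarrow> real"
  assumes "finite F" and "1 \<le> c" and "\<And>Q. Q \<in> F \<Longrightarrow> 0 \<le> m Q"
  obtains S where "S \<subseteq> F"
    and "\<And>Q R. Q \<in> S \<Longrightarrow> R \<in> S \<Longrightarrow> R \<subset> Q \<Longrightarrow> c * m Q < m R"
    and "\<And>Q. Q \<in> F \<Longrightarrow> \<exists>P\<in>S. Q \<subseteq> P \<and> m Q \<le> c * m P"
proof -
  have "\<exists>S\<subseteq>F. (\<forall>Q\<in>S. \<forall>R\<in>S. R \<subset> Q \<longrightarrow> c * m Q < m R) \<and> (\<forall>Q\<in>F. \<exists>P\<in>S. Q \<subseteq> P \<and> m Q \<le> c * m P)"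
    using assms(1,3)
  proof (induction F rule: finite_minimal_induct)
    case empty
    then show ?case by simp
  next
    case (insert M F)
    then obtain S where S: "S \<subseteq> F" "\<forall>Q\<in>S. \<forall>R\<in>S. R \<subset> Q \<longrightarrow> c * m Q < m R"
      "\<forall>Q\<in>F. \<exists>P\<in>S. Q \<subseteq> P \<and> m Q \<le> c * m P"
      by (metis insertCI)
    show ?case
    proof (cases "\<exists>P\<in>S. M \<subseteq> P \<and> m M \<le> c * m P")
      case True
      with S show ?thesis by (intro exI[of _ S]) auto
    next
      case False
      have "c * m Q < m R" if "Q \<in> insert M S" "R \<in> insert M S" "R \<subset> Q" for Q R
      proof -
        \<comment> \<open>No earlier set lies inside \<open>M\<close>, so in a nested pair
          \<open>M\<close> can only be the smaller set.\<close>
        have "Q \<noteq> M"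
          using that insert.hyps(3) S(1) by blast
        then show ?thesis
          using that False S(2) by (cases "R = M") force+
      qed
      moreover have "m M \<le> c * m M"
        using insert.prems[of M] assms(2) mult_right_mono[of 1 c "m M"] by simp
      then have "\<exists>P\<in>insert M S. Q \<subseteq> P \<and> m Q \<le> c * m P" if "Q \<in> insert M F" for Q
        using that S(3) by auto
      ultimately show ?thesis
        using S(1) by (intro exI[of _ "insert M S"] conjI ballI impI) auto
    qed
  qed
  then obtain S where "S \<subseteq> F" "\<forall>Q\<in>S. \<forall>R\<in>S. R \<subset> Q \<longrightarrow> c * m Q < m R"
      "\<forall>Q\<in>F. \<exists>P\<in>S. Q \<subseteq> P \<and> m Q \<le> c * m P"
    by auto
  then show thesis by (intro that) auto
qed

text \<open>Under independent random signs the off-diagonal terms have expectation zero, so some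
  choice does at least as well as the diagonal. The induction finds one greedily: the sign of a new
  index is that of its total interaction \<open>z\<close> with the earlier ones.\<close>

lemma sign_choice:
  fixes t :: "'b \<Rightarrow> 'b \<Rightarrow> real"
  assumes "finite S"
  obtains e :: "'b \<Rightarrow> real" where "\<And>Q. \<bar>e Q\<bar> = 1"
    and "(\<Sum>Q\<in>S. t Q Q) \<le> (\<Sum>Q\<in>S. \<Sum>R\<in>S. e Q * e R * t Q R)"
proof -
  have "\<exists>e. (\<forall>Q. \<bar>e Q\<bar> = 1) \<and> (\<Sum>Q\<in>S. t Q Q) \<le> (\<Sum>Q\<in>S. \<Sum>R\<in>S. e Q * e R * t Q R)"
    using assms
  proof (induction S rule: finite_induct)
    case empty
    show ?case by (intro exI[of _ "\<lambda>_. 1"]) simp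
  next
    case (insert P S)
    then obtain e where e: "\<forall>Q. \<bar>e Q\<bar> = 1"
      "(\<Sum>Q\<in>S. t Q Q) \<le> (\<Sum>Q\<in>S. \<Sum>R\<in>S. e Q * e R * t Q R)" by auto
    define z where "z = (\<Sum>R\<in>S. e R * (t P R + t R P))"
    define s :: real where "s = (if 0 \<le> z then 1 else -1)"
    define e' where "e' = e(P := s)"
    have e': "e' P = s" "\<And>Q. Q \<in> S \<Longrightarrow> e' Q = e Q"
      using insert.hyps by (auto simp: e'_def)
    have "(\<Sum>Q\<in>insert P S. \<Sum>R\<in>insert P S. e' Q * e' R * t Q R)
        = s * s * t P P + s * (\<Sum>R\<in>S. e R * t P R) + s * (\<Sum>Q\<in>S. e Q * t Q P)
            + (\<Sum>Q\<in>S. \<Sum>R\<in>S. e Q * e R * t Q R)"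
      using insert.hyps
      by (simp add: e' sum.distrib sum_distrib_left mult_ac cong: sum.cong)
    also have "\<dots> = t P P + s * z + (\<Sum>Q\<in>S. \<Sum>R\<in>S. e Q * e R * t Q R)"
      by (simp add: s_def z_def algebra_simps sum.distrib)
    also have "\<dots> \<ge> t P P + (\<Sum>Q\<in>S. t Q Q)"
      using e(2) by (auto simp: s_def)
    finally have "(\<Sum>Q\<in>insert P S. t Q Q) \<le> (\<Sum>Q\<in>insert P S. \<Sum>R\<in>insert P S. e' Q * e' R * t Q R)"
      using insert.hyps by simp
    moreover have "\<forall>Q. \<bar>e' Q\<bar> = 1"
      using e(1) by (auto simp: e'_def s_def)
    ultimately show ?case by blast
  qed
  then show thesis using that by blast
qed

section \<open>Carleson embedding for finite laminar families\<close>

definition laminar :: "'b set set \<Rightarrow> bool" where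
  "laminar S \<longleftrightarrow> (\<forall>Q\<in>S. \<forall>R\<in>S. Q \<subseteq> R \<or> R \<subseteq> Q \<or> Q \<inter> R = {})"

definition ancestor_sum :: "'b set set \<Rightarrow> ('b set \<Rightarrow> real) \<Rightarrow> 'b set \<Rightarrow> real" where
  "ancestor_sum S a R = (\<Sum>P\<in>{P\<in>S. R \<subseteq> P}. a P)"

text \<open>In a laminar family this is the increment of the \<open>p\<close>-th power of the step
  function \<open>\<Sum>P. a P * 1\<^sub>P\<close> on entering \<open>R\<close> from the smallest
  member strictly above it. The jumps write that power as a linear combination of
  indicators.\<close>

definition power_jump :: "'b set set \<Rightarrow> ('b set \<Rightarrow> real) \<Rightarrow> real \<Rightarrow> 'b set \<Rightarrow> real" where
  "power_jump S a p R = ancestor_sum S a R powr p - (ancestor_sum S a R - a R) powr p"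

lemma ancestor_sum_ge:
  assumes "finite S" "R \<in> S" "\<And>P. 0 \<le> a P"
  shows "a R \<le> ancestor_sum S a R"
  unfolding ancestor_sum_def
  by (rule member_le_sum) (use assms in auto)

lemma power_jump_nonneg:
  assumes "finite S" "R \<in> S" "\<And>P. 0 \<le> a P" "0 < p"
  shows "0 \<le> power_jump S a p R"
  using ancestor_sum_ge[of S R a] assms
  by (auto simp: power_jump_def intro!: powr_mono2)

text \<open>The tangent bound for the convex function \<open>t powr p\<close> at the larger point
  \<open>x\<close>. Young's inequality for \<open>x powr (p - 1) * y\<close> yields it without a
  derivative, \<open>y = 0\<close> included.\<close>

lemma powr_diff_le:
  fixes x y p :: real
  assumes "1 < p" "0 \<le> y" "y \<le> x"
  shows "x powr p - y powr p \<le> p * ((x - y) * x powr (p - 1))"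
proof (cases "x = 0")
  case False
  define s where "s = p / (p - 1)"
  have s: "1 < s" "1 / s + 1 / p = 1" "(p - 1) * s = p"
    using assms(1) by (auto simp: s_def field_simps)
  have "x powr (p - 1) * y \<le> (x powr (p - 1)) powr s / s + y powr p / p"
    by (rule Youngs_inequality) (use assms s in auto)
  also have "(x powr (p - 1)) powr s = x powr p"
    by (simp add: powr_powr s)
  finally have "p * (x powr (p - 1) * y) \<le> p * (x powr p / s + y powr p / p)"
    using assms(1) by (intro mult_left_mono) auto
  also have "\<dots> = (p - 1) * x powr p + y powr p"
    using assms(1) by (simp add: s_def field_simps)
  finally have "p * (x powr (p - 1) * y) \<le> (p - 1) * x powr p + y powr p" .
  moreover have "x powr p = x * x powr (p - 1)"
    using assms False by (simp add: powr_diff)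
  ultimately show ?thesis by (simp add: algebra_simps)
qed (use assms in auto)

text \<open>Members containing the nonempty set \<open>x\<close> meet each other, so laminarity
  makes them a chain. The set \<open>x\<close> is a singleton in the pointwise identity and a member
  of \<open>S\<close> in the Carleson embedding.\<close>

lemma sum_powr_telescope:
  fixes a :: "'b set \<Rightarrow> real"
  assumes S: "finite S" "laminar S" and x: "x \<noteq> {}" and p: "0 < p"
  shows "(\<Sum>R\<in>{R\<in>S. x \<subseteq> R}. power_jump S a p R) = ancestor_sum S a x powr p"
proof -
  let ?C = "{R\<in>S. x \<subseteq> R}"
  have sub: "{P \<in> S. R \<subseteq> P} = {P \<in> ?C. R \<subseteq> P}" if "R \<in> ?C" for R
    using that by auto
  have "(\<Sum>R\<in>?C. power_jump S a p R)
      = (\<Sum>R\<in>?C. (\<Sum>P\<in>{P\<in>?C. R \<subseteq> P}. a P) powr p - ((\<Sum>P\<in>{P\<in>?C. R \<subseteq> P}. a P) - a R) powr p)"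
    unfolding power_jump_def ancestor_sum_def
    by (intro sum.cong refl) (simp only: sub)
  also have "\<dots> = (\<Sum>P\<in>?C. a P) powr p - 0 powr p"
  proof (rule chain_telescope[where \<phi> = "\<lambda>t. t powr p"])
    show "P \<subseteq> Q \<or> Q \<subseteq> P" if "P \<in> ?C" "Q \<in> ?C" for P Q
    proof -
      have "P \<inter> Q \<noteq> {}" using that x by auto
      then show ?thesis using that S(2) unfolding laminar_def by blast
    qed
  qed (use S in auto)
  finally show ?thesis by (simp add: ancestor_sum_def)
qed

lemma sum_powr_pointwise:
  fixes a :: "'b set \<Rightarrow> real"
  assumes S: "finite S" "laminar S" and p: "0 < p"
  shows "(\<Sum>R\<in>S. a R * indicator R x) powr p = (\<Sum>R\<in>S. power_jump S a p R * indicator R x)"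
proof -
  have ind: "(\<Sum>R\<in>S. h R * indicator R x) = (\<Sum>R\<in>{R\<in>S. {x} \<subseteq> R}. h R)" for h :: "'b set \<Rightarrow> real"
    using S(1) by (intro sum.mono_neutral_cong_right) (auto simp: indicator_def)
  show ?thesis
    unfolding ind using sum_powr_telescope[OF S _ p, of "{x}" a] by (simp add: ancestor_sum_def)
qed

text \<open>Writing \<open>A Q\<close> for the sum over the ancestors, the powers \<open>A Q powr p\<close> telescope along chains
  into the jumps, so the Carleson condition bounds their \<open>w\<close>-sum by that of the jumps. Thus no
  maximal function is needed.\<close>

lemma Carleson_embedding:
  fixes a w :: "'b set \<Rightarrow> real"
  assumes S: "finite S" "laminar S" "{} \<notin> S" and p: "1 < p" "1 < s" "1 / p + 1 / s = 1"
    and a: "\<And>P. 0 \<le> a P" and w: "\<And>P. 0 \<le> w P"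
    and K: "0 \<le> K" "\<And>R. R \<in> S \<Longrightarrow> (\<Sum>Q\<in>{Q\<in>S. Q \<subseteq> R}. w Q) \<le> K * w R"
  shows "(\<Sum>R\<in>S. power_jump S a p R * w R) powr (1 / p)
           \<le> p * K powr (1 / s) * (\<Sum>R\<in>S. a R powr p * w R) powr (1 / p)"
proof -
  let ?A = "ancestor_sum S a" and ?d = "power_jump S a p"
  define I where "I = (\<Sum>R\<in>S. ?d R * w R)"
  define E where "E = (\<Sum>R\<in>S. a R powr p * w R)"
  have d: "0 \<le> ?d R" if "R \<in> S" for R
    using power_jump_nonneg[OF S(1) that a] p by auto
  have I: "0 \<le> I" unfolding I_def using d w by (intro sum_nonneg) auto
  have E: "0 \<le> E" unfolding E_def using w by (intro sum_nonneg) auto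
  have ps: "(p - 1) * s = p" "s = p / (p - 1)"
    using p by (auto simp: field_simps)
  have "(\<Sum>Q\<in>S. ?A Q powr p * w Q) = (\<Sum>Q\<in>S. \<Sum>R\<in>S. if Q \<subseteq> R then ?d R * w Q else 0)"
  proof (intro sum.cong refl)
    fix Q assume "Q \<in> S"
    then have "?A Q powr p = (\<Sum>R\<in>{R\<in>S. Q \<subseteq> R}. ?d R)"
      using S p by (intro sum_powr_telescope[symmetric]) auto
    then have "?A Q powr p * w Q = (\<Sum>R\<in>{R\<in>S. Q \<subseteq> R}. ?d R * w Q)"
      by (simp add: sum_distrib_right)
    then show "?A Q powr p * w Q = (\<Sum>R\<in>S. if Q \<subseteq> R then ?d R * w Q else 0)"
      by (simp only: sum.inter_filter[OF S(1)])
  qed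
  also have "\<dots> = (\<Sum>R\<in>S. \<Sum>Q\<in>S. if Q \<subseteq> R then ?d R * w Q else 0)"
    by (rule sum.swap)
  also have "\<dots> = (\<Sum>R\<in>S. ?d R * (\<Sum>Q\<in>{Q\<in>S. Q \<subseteq> R}. w Q))"
    by (simp only: sum_distrib_left sum.inter_filter[OF S(1)]) (intro sum.cong refl, simp)
  also have "\<dots> \<le> (\<Sum>R\<in>S. ?d R * (K * w R))"
    using d K by (intro sum_mono mult_left_mono) auto
  also have "\<dots> = K * I"
    by (simp add: I_def sum_distrib_left mult_ac)
  finally have AK: "(\<Sum>Q\<in>S. ?A Q powr p * w Q) \<le> K * I" .
  \<comment> \<open>The tangent bound is arranged for Hoelder's inequality by splitting
    \<open>w R\<close> into two powers. Since \<open>(p - 1) * s = p\<close>, the second factor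
    turns into the sum just bounded by \<open>K * I\<close>.\<close>
  have "I \<le> (\<Sum>R\<in>S. p * ((a R * w R powr (1 / p)) * (?A R powr (p - 1) * w R powr (1 / s))))"
    unfolding I_def
  proof (rule sum_mono)
    fix R assume R: "R \<in> S"
    have "?d R \<le> p * (a R * ?A R powr (p - 1))"
      using powr_diff_le[of p "?A R - a R" "?A R"] p ancestor_sum_ge[where a = a, OF S(1) R a] a
      by (simp add: power_jump_def)
    then have "?d R * w R \<le> p * (a R * ?A R powr (p - 1)) * w R"
      using w by (intro mult_right_mono)
    also have "\<dots> = p * (a R * ?A R powr (p - 1)) * (w R powr (1 / p) * w R powr (1 / s))"
      using p w by (simp flip: powr_add)
    finally show "?d R * w R \<le> p * ((a R * w R powr (1 / p)) * (?A R powr (p - 1) * w R powr (1 / s)))"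
      by (simp add: mult_ac)
  qed
  also have "\<dots> = p * (\<Sum>R\<in>S. (a R * w R powr (1 / p)) * (?A R powr (p - 1) * w R powr (1 / s)))"
    by (simp add: sum_distrib_left)
  also have "\<dots> \<le> p * ((\<Sum>R\<in>S. (a R * w R powr (1 / p)) powr p) powr (1 / p)
      * (\<Sum>R\<in>S. (?A R powr (p - 1) * w R powr (1 / s)) powr s) powr (1 / s))"
    using p S a by (intro mult_left_mono sum_Holder) auto
  also have "(\<Sum>R\<in>S. (a R * w R powr (1 / p)) powr p) = E"
    using p a w by (simp add: E_def powr_mult powr_powr)
  also have "(\<Sum>R\<in>S. (?A R powr (p - 1) * w R powr (1 / s)) powr s) = (\<Sum>R\<in>S. ?A R powr p * w R)"
    using p a w by (simp add: powr_mult powr_powr ps(1))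
  also have "p * (E powr (1 / p) * (\<Sum>R\<in>S. ?A R powr p * w R) powr (1 / s))
      \<le> p * (E powr (1 / p) * (K * I) powr (1 / s))"
    using p AK w by (intro mult_left_mono powr_mono2 sum_nonneg) auto
  finally have main: "I \<le> p * (E powr (1 / p) * (K powr (1 / s) * I powr (1 / s)))"
    using K I by (simp add: powr_mult)
  \<comment> \<open>Both sides now contain \<open>I\<close>. Being a finite sum it is a real number,
    so \<open>I powr (1 / s)\<close> can be cancelled.\<close>
  show ?thesis
  proof (cases "I = 0")
    case False
    then have "0 < I" using I by simp
    have "I = I powr (1 / p) * I powr (1 / s)"
      using p I by (simp flip: powr_add)
    with main have "I powr (1 / p) * I powr (1 / s) \<le> (p * K powr (1 / s) * E powr (1 / p)) * I powr (1 / s)"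
      by (simp add: mult_ac)
    then have "I powr (1 / p) \<le> p * K powr (1 / s) * E powr (1 / p)"
      using \<open>0 < I\<close> by (simp add: mult_le_cancel_right)
    then show ?thesis by (simp add: I_def E_def)
  qed (use p I_def in auto)
qed


subsection \<open>Dyadic grids\<close>

text \<open>A box and its closure differ by a null set, so the faces that \<open>is_cube\<close>
  leaves open do not influence the measure. Distances are estimated through the
  \<open>l^1\<close>-norm, whence the factor \<open>DIM('a)\<close>.\<close>

lemma cube_lebesgue:
  fixes Q :: "'a::euclidean_space set"
  assumes "is_cube l Q" "0 < l"
  shows "Q \<in> lmeasurable" "measure lebesgue Q = l ^ DIM('a)" "bounded Q"
    "\<And>x y. x \<in> Q \<Longrightarrow> y \<in> Q \<Longrightarrow> dist x y \<le> l * real DIM('a)"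
proof -
  obtain a where a: "box a (a + l *\<^sub>R One) \<subseteq> Q" "Q \<subseteq> cbox a (a + l *\<^sub>R One)"
    using assms(1) by (auto simp: is_cube_def)
  let ?B = "box a (a + l *\<^sub>R One)" and ?C = "cbox a (a + l *\<^sub>R One)"
  have null: "Q - ?B \<in> null_sets lebesgue"
  proof (rule null_sets_completion_subset)
    show "?C - ?B \<in> null_sets lebesgue"
      using null_sets_cbox_Diff_box by (rule null_sets_completionI)
  qed (use a in auto)
  have Q: "Q = ?B \<union> (Q - ?B)" using a by auto
  have B: "?B \<in> lmeasurable" by simp
  show "Q \<in> lmeasurable"
    by (subst Q) (intro fmeasurable.Un B fmeasurableI_null_sets null)
  have "measure lebesgue Q = measure lebesgue ?B"
    using measure_Un_null_set[OF fmeasurableD[OF B] null] Q by metis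
  also have "\<dots> = l ^ DIM('a)"
    using assms(2) by (simp add: algebra_simps)
  finally show "measure lebesgue Q = l ^ DIM('a)" .
  show "bounded Q" using a(2) bounded_cbox bounded_subset by blast
  fix x y assume "x \<in> Q" "y \<in> Q"
  then have xy: "x \<in> ?C" "y \<in> ?C" using a by auto
  have "norm (x - y) \<le> (\<Sum>i\<in>Basis. \<bar>(x - y) \<bullet> i\<bar>)"
    by (rule norm_le_l1)
  also have "\<dots> \<le> (\<Sum>i\<in>(Basis::'a set). l)"
    using xy by (intro sum_mono) (auto simp: mem_box algebra_simps abs_le_iff, smt+)
  finally show "dist x y \<le> l * real DIM('a)" by (simp add: dist_norm mult.commute)
qed

lemma sigma_finite_lebesgue: "sigma_finite_measure (lebesgue :: 'a::euclidean_space measure)"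
proof
  have "\<Union>(range (\<lambda>n. cball (0::'a) (real n))) = UNIV"
    using real_arch_simple by (auto simp: set_eq_iff)
  then show "\<exists>A::'a set set. countable A \<and> A \<subseteq> sets lebesgue \<and> \<Union>A = space lebesgue
      \<and> (\<forall>a\<in>A. emeasure lebesgue a \<noteq> \<infinity>)"
    by (intro exI[of _ "range (\<lambda>n. cball 0 (real n))"])
      (use fmeasurableD2[OF lmeasurable_cball] in auto)
qed

text \<open>In \<open>dyadic_lattice\<close> the generations are merely asserted to exist; the
  locale fixes one such choice, so that arguments can count generations.\<close>

locale dyadic_grid =
  fixes \<D> :: "'a::euclidean_space set set" and \<D>\<^sub>g :: "int \<Rightarrow> 'a set set"
  assumes \<D>_eq: "\<D> = (\<Union>k. \<D>\<^sub>g k)"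
    and partition: "partition_on UNIV (\<D>\<^sub>g k)"
    and cube: "Q \<in> \<D>\<^sub>g k \<Longrightarrow> is_cube (2 powi (- k)) Q"
    and refine: "refines UNIV (\<D>\<^sub>g (k + 1)) (\<D>\<^sub>g k)"
begin

lemma in_lattice: "Q \<in> \<D>\<^sub>g k \<Longrightarrow> Q \<in> \<D>"
  by (auto simp: \<D>_eq)

lemma generation: assumes "Q \<in> \<D>" obtains k where "Q \<in> \<D>\<^sub>g k"
  using assms by (auto simp: \<D>_eq)

lemma ex_cube: obtains Q where "Q \<in> \<D>\<^sub>g k" "x \<in> Q"
  using partition[of k] by (auto simp: partition_on_def)

lemma same_generation: "Q \<in> \<D>\<^sub>g k \<Longrightarrow> R \<in> \<D>\<^sub>g k \<Longrightarrow> Q \<inter> R \<noteq> {} \<Longrightarrow> Q = R"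
  using partition[of k] by (auto simp: partition_on_def disjoint_def)

lemma nonempty: "Q \<in> \<D> \<Longrightarrow> Q \<noteq> {}"
  using partition by (auto simp: partition_on_def \<D>_eq)

lemma lmeasurable_cube: "Q \<in> \<D> \<Longrightarrow> Q \<in> lmeasurable"
  by (elim generation) (rule cube_lebesgue(1)[OF cube], auto)

lemma sets_cube [measurable]: "Q \<in> \<D> \<Longrightarrow> Q \<in> sets lebesgue"
  using lmeasurable_cube by blast

lemma bounded_cube: "Q \<in> \<D> \<Longrightarrow> bounded Q"
  by (elim generation) (rule cube_lebesgue(3)[OF cube], auto)

lemma measure_cube: "Q \<in> \<D>\<^sub>g k \<Longrightarrow> measure lebesgue Q = (2 powi (- k)) ^ DIM('a)"
  by (rule cube_lebesgue(2)[OF cube]) auto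

lemma measure_pos: "Q \<in> \<D> \<Longrightarrow> 0 < measure lebesgue Q"
  by (elim generation) (simp add: measure_cube)

text \<open>Volume determines the generation. Inclusion orders volumes and therefore also generation
  numbers.\<close>

lemma measure_le_iff:
  assumes "Q \<in> \<D>\<^sub>g j" "R \<in> \<D>\<^sub>g k"
  shows "measure lebesgue Q \<le> measure lebesgue R \<longleftrightarrow> k \<le> j"
proof -
  have "(2::real) powi (- j) \<le> 2 powi (- k) \<longleftrightarrow> k \<le> j"
    using power_int_increasing[of "- j" "- k" "2::real"] power_int_strict_increasing[of "- k" "- j" "2::real"]
    by (cases "k \<le> j") auto
  then show ?thesis
    using assms by (simp add: measure_cube power_mono_iff)
qed

lemma generation_subset:
  assumes "k \<le> j" "Q \<in> \<D>\<^sub>g j"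
  obtains R where "R \<in> \<D>\<^sub>g k" "Q \<subseteq> R"
proof -
  have "\<forall>Q\<in>\<D>\<^sub>g j. \<exists>R\<in>\<D>\<^sub>g k. Q \<subseteq> R"
    using assms(1)
  proof (induction j rule: int_ge_induct)
    case (step i)
    then show ?case
      using refine[of i] unfolding refines_def by (meson order_trans)
  qed auto
  then show thesis using that assms(2) by blast
qed

lemma subset_if_meets:
  assumes "k \<le> j" "Q \<in> \<D>\<^sub>g j" "R \<in> \<D>\<^sub>g k" "Q \<inter> R \<noteq> {}"
  shows "Q \<subseteq> R"
proof -
  obtain P where "P \<in> \<D>\<^sub>g k" "Q \<subseteq> P"
    using generation_subset[OF assms(1,2)] .
  with same_generation[OF this(1) assms(3)] assms(4) show ?thesis by blast
qed

lemma subset_generation: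
  assumes "Q \<in> \<D>\<^sub>g j" "R \<in> \<D>\<^sub>g k" "Q \<subseteq> R"
  shows "k \<le> j"
  using measure_le_iff[OF assms(1,2)]
    measure_mono_fmeasurable[OF assms(3) sets_cube lmeasurable_cube] assms in_lattice by blast

lemma nested: "Q \<in> \<D> \<Longrightarrow> R \<in> \<D> \<Longrightarrow> Q \<subseteq> R \<or> R \<subseteq> Q \<or> Q \<inter> R = {}"
  by (elim generation) (metis subset_if_meets inf_commute linear)

lemma laminar_subset: "S \<subseteq> \<D> \<Longrightarrow> laminar S"
  unfolding laminar_def using nested by blast

text \<open>A cube strictly containing \<open>R\<close> belongs to a generation other than
  \<open>k + 1\<close>, hence to one at most \<open>k\<close>; as it meets \<open>P\<close>, it
  contains \<open>P\<close>. This replaces \<open>LEAST\<close> by generation numbers.\<close>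

lemma parent_eq:
  assumes R: "R \<in> \<D>\<^sub>g (k + 1)" and P: "P \<in> \<D>\<^sub>g k" and "R \<subseteq> P"
  shows "dyadic_parent \<D> R = P"
  unfolding dyadic_parent_def
proof (rule Least_equality)
  have "R \<noteq> P"
    using subset_generation[of P k R "k + 1"] R P by auto
  then show "P \<in> \<D> \<and> R \<subset> P"
    using assms in_lattice by auto
  fix Q assume Q: "Q \<in> \<D> \<and> R \<subset> Q"
  then obtain j where j: "Q \<in> \<D>\<^sub>g j" by (auto simp: \<D>_eq)
  have "j \<noteq> k + 1"
    using same_generation[OF R, of Q] j Q nonempty[OF in_lattice[OF R]] by auto
  moreover have "j \<le> k + 1"
    using subset_generation[OF R j] Q by auto
  ultimately have "j \<le> k" by simp
  moreover have "P \<inter> Q \<noteq> {}"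
    using Q assms(3) nonempty[OF in_lattice[OF R]] by auto
  ultimately show "P \<subseteq> Q"
    using subset_if_meets[OF _ P j] by blast
qed

lemma parent_cases:
  assumes "R \<in> \<D>" "dyadic_parent \<D> R = P"
  obtains k where "R \<in> \<D>\<^sub>g (k + 1)" "P \<in> \<D>\<^sub>g k" "R \<subseteq> P"
proof -
  obtain j where j: "R \<in> \<D>\<^sub>g j" using generation[OF assms(1)] .
  obtain P' where P': "P' \<in> \<D>\<^sub>g (j - 1)" "R \<subseteq> P'"
    using generation_subset[of "j - 1" j R] j by auto
  with parent_eq[of R "j - 1" P'] j assms(2) have "P' = P" by simp
  then show thesis using that[of "j - 1"] j P' by simp
qed

lemma children_eq:
  assumes "P \<in> \<D>\<^sub>g k"
  shows "{R\<in>\<D>. dyadic_parent \<D> R = P} = {R\<in>\<D>\<^sub>g (k + 1). R \<subseteq> P}"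
proof (intro set_eqI iffI)
  fix R assume "R \<in> {R\<in>\<D>. dyadic_parent \<D> R = P}"
  then obtain j where j: "R \<in> \<D>\<^sub>g (j + 1)" "P \<in> \<D>\<^sub>g j" "R \<subseteq> P"
    using parent_cases by blast
  moreover have "j = k"
    using subset_generation[OF j(2) assms] subset_generation[OF assms j(2)] by simp
  ultimately show "R \<in> {R\<in>\<D>\<^sub>g (k + 1). R \<subseteq> P}" by simp
next
  fix R assume "R \<in> {R\<in>\<D>\<^sub>g (k + 1). R \<subseteq> P}"
  then show "R \<in> {R\<in>\<D>. dyadic_parent \<D> R = P}"
    using parent_eq[of R k P] assms in_lattice by auto
qed

lemma finite_children:
  assumes P: "P \<in> \<D>"
  shows "finite {R\<in>\<D>. dyadic_parent \<D> R = P}"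
proof -
  obtain k where k: "P \<in> \<D>\<^sub>g k" using generation[OF P] .
  \<comment> \<open>The common volume of the cubes one generation below \<open>P\<close>.
    Disjointness bounds the number of them inside \<open>P\<close> by a quotient of volumes.\<close>
  define c where "c = (2 powi (- (k + 1)) :: real) ^ DIM('a)"
  have c: "0 < c" by (simp add: c_def)
  have "card F \<le> nat \<lfloor>measure lebesgue P / c\<rfloor>" if F: "F \<subseteq> {R\<in>\<D>\<^sub>g (k + 1). R \<subseteq> P}" "finite F" for F
  proof -
    have "real (card F) * c = (\<Sum>R\<in>F. measure lebesgue R)"
      using F(1) measure_cube[of _ "k + 1"] by (simp add: c_def subset_eq)
    also have "\<dots> = measure lebesgue (\<Union>F)"
    proof (rule measure_Union'[symmetric])
      show "pairwise disjnt F"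
        using F(1) same_generation unfolding pairwise_def disjnt_def by blast
      show "R \<in> lmeasurable" if "R \<in> F" for R
        using that F(1) in_lattice lmeasurable_cube by blast
    qed fact
    also have "\<dots> \<le> measure lebesgue P"
      using F in_lattice P
      by (intro measure_mono_fmeasurable lmeasurable_cube sets.finite_Union) auto
    finally have "real (card F) \<le> measure lebesgue P / c"
      using c by (simp add: field_simps)
    then show ?thesis by linarith
  qed
  then have "finite {R\<in>\<D>\<^sub>g (k + 1). R \<subseteq> P}"
    by (intro finite_if_finite_subsets_card_bdd[THEN conjunct1]) auto
  then show ?thesis by (simp add: children_eq[OF k])
qed

lemma child_through:
  assumes "P \<in> \<D>" "x \<in> P"
  obtains R where "R \<in> \<D>" "dyadic_parent \<D> R = P" "x \<in> R"
proof -
  obtain k where k: "P \<in> \<D>\<^sub>g k" using generation[OF assms(1)] .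
  obtain R where R: "R \<in> \<D>\<^sub>g (k + 1)" "x \<in> R" by (rule ex_cube)
  have "R \<subseteq> P"
    using subset_if_meets[of k "k + 1" R P] R k assms by auto
  then show thesis
    using that[of R] R parent_eq[OF R(1) k] in_lattice by blast
qed

lemma children_disjoint:
  assumes "R \<in> \<D>" "R' \<in> \<D>" "dyadic_parent \<D> R = P" "dyadic_parent \<D> R' = P" "R \<inter> R' \<noteq> {}"
    and P: "P \<in> \<D>"
  shows "R = R'"
proof -
  obtain k where k: "P \<in> \<D>\<^sub>g k" using generation[OF P] .
  have "R \<in> \<D>\<^sub>g (k + 1)" "R' \<in> \<D>\<^sub>g (k + 1)"
    using children_eq[OF k] assms by auto
  then show ?thesis using same_generation assms(5) by blast
qed

lemma child_psubset:
  assumes "R \<in> \<D>" "dyadic_parent \<D> R = P"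
  shows "P \<in> \<D>" "R \<subset> P"
proof -
  obtain k where k: "R \<in> \<D>\<^sub>g (k + 1)" "P \<in> \<D>\<^sub>g k" "R \<subseteq> P"
    using parent_cases[OF assms] .
  then show "P \<in> \<D>" using in_lattice by blast
  show "R \<subset> P" using subset_generation[of P k R "k + 1"] k by auto
qed

text \<open>A cube meeting \<open>R\<close> without lying in it would contain \<open>R\<close>
  strictly and lie strictly inside \<open>P\<close>; consecutive generations leave no room for
  it.\<close>

lemma below_child:
  assumes R: "R \<in> \<D>" "dyadic_parent \<D> R = P" and "Q \<in> \<D>" "Q \<subset> P"
  shows "Q \<subseteq> R \<or> Q \<inter> R = {}"
proof (rule ccontr)
  assume c: "\<not> (Q \<subseteq> R \<or> Q \<inter> R = {})"
  then have "R \<subset> Q" using nested[OF R(1) assms(3)] by blast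
  obtain k where k: "R \<in> \<D>\<^sub>g (k + 1)" "P \<in> \<D>\<^sub>g k" "R \<subseteq> P"
    using parent_cases[OF R] .
  obtain j where j: "Q \<in> \<D>\<^sub>g j" using generation[OF assms(3)] .
  have "j \<le> k + 1" using subset_generation[OF k(1) j] \<open>R \<subset> Q\<close> by auto
  moreover have "k \<le> j" using subset_generation[OF j k(2)] assms(4) by auto
  ultimately consider "j = k" | "j = k + 1" by linarith
  then show False
  proof cases
    case 1
    then show False
      using same_generation[of Q k P] j k(2) assms(4) nonempty[OF assms(3)] by blast
  next
    case 2
    then show False
      using same_generation[of Q "k + 1" R] j k(1) c by blast
  qed
qed

text \<open>Each cube inside \<open>Q\<close> is reached from \<open>Q\<close> by finitely many
  passages to a child that stay inside \<open>Q\<close>. The induction treats all cubes of one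
  generation at once.\<close>

lemma descendant_induct [consumes 3, case_names refl child]:
  assumes "Q \<in> \<D>" "R \<in> \<D>" "R \<subseteq> Q"
    and "P Q"
    and child: "\<And>R R'. R \<in> \<D> \<Longrightarrow> dyadic_parent \<D> R = R' \<Longrightarrow> R' \<subseteq> Q \<Longrightarrow> P R' \<Longrightarrow> P R"
  shows "P R"
proof -
  obtain k j where kj: "Q \<in> \<D>\<^sub>g k" "R \<in> \<D>\<^sub>g j"
    using assms(1,2) by (elim generation)
  then have "k \<le> j" using subset_generation assms(3) by blast
  then have "\<forall>R\<in>\<D>\<^sub>g j. R \<subseteq> Q \<longrightarrow> P R"
  proof (induction j rule: int_ge_induct)
    case base
    have "R = Q" if "R \<in> \<D>\<^sub>g k" "R \<subseteq> Q" for R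
      using same_generation[OF that(1) kj(1)] that nonempty in_lattice by blast
    then show ?case using assms(4) by blast
  next
    case (step i)
    show ?case
    proof (intro ballI impI)
      fix R assume R: "R \<in> \<D>\<^sub>g (i + 1)" "R \<subseteq> Q"
      obtain R' where R': "R' \<in> \<D>\<^sub>g i" "R \<subseteq> R'"
        using generation_subset[of i "i + 1" R] R by auto
      have "R' \<subseteq> Q"
        using subset_if_meets[OF step(1) R'(1) kj(1)] R R' nonempty[OF in_lattice[OF R(1)]] by blast
      then show "P R"
        using child[of R R'] step(2) R R' parent_eq[OF R(1) R'(1,2)] in_lattice by blast
    qed
  qed
  then show ?thesis using kj assms(3) by blast
qed

text \<open>The interiors of the cubes of one generation are disjoint, nonempty and open, hence
  countably many, and they determine their cubes.\<close>

lemma countable_lattice: "countable \<D>"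
proof -
  have "countable (\<D>\<^sub>g k)" for k
  proof -
    have ne: "interior Q \<noteq> {}" if Q: "Q \<in> \<D>\<^sub>g k" for Q
    proof -
      obtain a where a: "box a (a + (2 powi (- k)) *\<^sub>R One) \<subseteq> Q"
        using cube[OF Q] by (auto simp: is_cube_def)
      have "box a (a + (2 powi (- k)) *\<^sub>R One) \<subseteq> interior Q"
        using a open_box by (rule interior_maximal)
      moreover have "box a (a + (2 powi (- k)) *\<^sub>R One) \<noteq> {}"
        by (simp add: box_ne_empty algebra_simps)
      ultimately show ?thesis by blast
    qed
    have sub: "interior Q \<subseteq> Q" for Q :: "'a set" by (rule interior_subset)
    have eq: "Q = R" if "Q \<in> \<D>\<^sub>g k" "R \<in> \<D>\<^sub>g k" "interior Q \<inter> interior R \<noteq> {}" for Q R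
      using same_generation[OF that(1,2)] that(3) sub by blast
    have "countable (interior ` \<D>\<^sub>g k)"
      by (rule countable_disjoint_open_subsets) (use eq in \<open>auto simp: pairwise_def disjnt_def\<close>)
    moreover have "inj_on interior (\<D>\<^sub>g k)"
      using eq ne unfolding inj_on_def by (metis inf.idem)
    ultimately show ?thesis by (rule countable_image_inj_on)
  qed
  then show ?thesis by (simp add: \<D>_eq)
qed

lemma small_cube:
  assumes "open U" "x \<in> U"
  obtains Q where "Q \<in> \<D>" "x \<in> Q" "Q \<subseteq> U"
proof -
  obtain e where e: "0 < e" "ball x e \<subseteq> U"
    using assms by (meson openE)
  obtain n :: nat where n: "real DIM('a) / e < 2 ^ n"
    using real_arch_pow[of 2] by auto
  obtain Q where Q: "Q \<in> \<D>\<^sub>g (int n)" "x \<in> Q" by (rule ex_cube)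
  have "Q \<subseteq> ball x e"
  proof
    fix y assume "y \<in> Q"
    then have "dist x y \<le> 2 powi (- int n) * real DIM('a)"
      using cube_lebesgue(4)[OF cube[OF Q(1)]] Q(2) by simp
    also have "\<dots> < e"
      using n e(1) by (simp add: power_int_minus field_simps)
    finally show "y \<in> ball x e" by simp
  qed
  then show thesis using that[of Q] Q e(2) in_lattice by blast
qed

text \<open>Every open set is the countable union of the cubes it contains. The empty set is added
  to the generator because nestedness then makes it stable under intersection.\<close>

lemma borel_sigma_sets:
  assumes "A \<in> sets borel"
  shows "A \<in> sigma_sets UNIV (insert {} \<D>)"
proof -
  interpret sigma_algebra UNIV "sigma_sets UNIV (insert {} \<D>)"
    by (rule sigma_algebra_sigma_sets) auto
  have op: "U \<in> sigma_sets UNIV (insert {} \<D>)" if "open U" for U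
  proof -
    have "U = \<Union>{Q\<in>\<D>. Q \<subseteq> U}"
      using small_cube[OF that] by blast
    moreover have "\<Union>{Q\<in>\<D>. Q \<subseteq> U} \<in> sigma_sets UNIV (insert {} \<D>)"
      by (rule countable_Union) (use countable_lattice in \<open>auto intro: countable_subset sigma_sets.Basic\<close>)
    ultimately show ?thesis by simp
  qed
  have "A \<in> sigma_sets UNIV {S. open S}"
    using assms by (simp add: borel_def)
  then show ?thesis
    by (induction) (auto intro: op sigma_sets.intros)
qed

text \<open>This replaces the dyadic Lebesgue differentiation theorem.\<close>

lemma AE_zero_if_cube_integrals_zero:
  fixes h :: "'a \<Rightarrow> 'b::euclidean_space"
  assumes h: "integrable lebesgue h" and total: "(LINT x|lebesgue. h x) = 0"
    and zero: "\<And>R. R \<in> \<D> \<Longrightarrow> (LINT x:R|lebesgue. h x) = 0"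
  shows "AE x in lebesgue. h x = 0"
proof (rule sigma_finite_measure.density_zero[OF sigma_finite_lebesgue h])
  fix A :: "'a set" assume "A \<in> sets lebesgue"
  have int: "set_integrable lebesgue B h" if "B \<in> sets lebesgue" for B
    unfolding set_integrable_def using h that by (rule integrable_mult_indicator[rotated])
  \<comment> \<open>A Dynkin argument: integral zero passes from the cubes to disjoint countable
    unions, and the assumption \<open>total\<close> provides the complements.\<close>
  have borel: "(LINT x:B|lebesgue. h x) = 0" if "B \<in> sets borel" for B
  proof -
    have meas: "B \<in> sets lebesgue" if "B \<in> sigma_sets UNIV (insert {} \<D>)" for B
      using that by (induction) (auto intro: sets_cube Compl_in_sets_lebesgue[THEN iffD2] simp flip: Compl_eq_Diff_UNIV)
    have sub: "insert {} \<D> \<subseteq> Pow UNIV" by simp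
    have stable: "Int_stable (insert {} \<D>)"
      unfolding Int_stable_def using nested by (metis inf.absorb1 inf.absorb2 inf_bot_left inf_bot_right insertCI insertE)
    from stable sub borel_sigma_sets[OF that] show ?thesis
    proof (induction rule: sigma_sets_induct_disjoint)
      case (basic A)
      then show ?case using zero by (auto simp: set_lebesgue_integral_def)
    next
      case empty
      then show ?case by (simp add: set_lebesgue_integral_def)
    next
      case (compl A)
      have "(LINT x:(A \<union> (UNIV - A))|lebesgue. h x) = (LINT x:A|lebesgue. h x) + (LINT x:(UNIV - A)|lebesgue. h x)"
        using meas compl(1) by (intro set_integral_Un int) auto
      then show ?case using compl total by (simp add: set_lebesgue_integral_def)
    next
      case (union A)
      have "(LINT x:(\<Union>i. A i)|lebesgue. h x) = (\<Sum>i. LINT x:A i|lebesgue. h x)"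
      proof (rule lebesgue_integral_countable_add)
        have A: "A i \<in> sigma_sets UNIV (insert {} \<D>)" for i
          using union(2) by auto
        show "A i \<in> sets lebesgue" for i
          by (rule meas[OF A])
        show "set_integrable lebesgue (\<Union>i. A i) h"
          by (intro int meas sigma_sets.Union A)
      qed (use union(1) in \<open>auto simp: disjoint_family_on_def\<close>)
      then show ?case using union by simp
    qed
  qed
  obtain B N N' where B: "A = B \<union> N" "N \<subseteq> N'" "N' \<in> null_sets lborel" "B \<in> sets lborel"
    using \<open>A \<in> sets lebesgue\<close> by (auto elim: sets_completionE)
  have "(LINT x:A|lebesgue. h x) = (LINT x:B|lebesgue. h x)"
  proof (rule set_integral_cong_set)
    have "AE x in lebesgue. x \<notin> N'"
      using null_sets_completionI[OF B(3)] by (rule AE_not_in)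
    then show "AE x in lebesgue. (x \<in> B) = (x \<in> A)"
      by eventually_elim (use B in auto)
  qed (use B h \<open>A \<in> sets lebesgue\<close> in \<open>auto simp: set_borel_measurable_def
      intro!: borel_measurable_scaleR borel_measurable_indicator\<close>)
  with borel B(4) show "(LINT x:A|lebesgue. h x) = 0" by simp
qed

end

lemma dyadic_latticeE:
  assumes "dyadic_lattice \<D>"
  obtains \<D>\<^sub>g where "dyadic_grid \<D> \<D>\<^sub>g"
  using assms unfolding dyadic_lattice_def dyadic_grid_def by blast


subsection \<open>Paraproducts tested on cubes\<close>

text \<open>The function is the pointwise limit of its truncations to growing balls.\<close>

lemma locally_integrable_measurable:
  assumes "locally_integrable f"
  shows "f \<in> borel_measurable lebesgue"
proof (rule borel_measurable_LIMSEQ_metric)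
  fix n :: nat
  have "f absolutely_integrable_on cball 0 (real n)"
    using assms by (simp add: locally_integrable_def)
  then show "(\<lambda>x. indicator (cball 0 (real n)) x *\<^sub>R f x) \<in> borel_measurable lebesgue"
    unfolding set_integrable_def by (rule borel_measurable_integrable)
next
  fix x :: 'a
  obtain m :: nat where m: "norm x \<le> real m" using real_arch_simple by blast
  have "\<forall>\<^sub>F n in sequentially. indicator (cball 0 (real n)) x *\<^sub>R f x = f x"
    using eventually_ge_at_top[of m] by eventually_elim (use m in auto)
  then show "(\<lambda>n. indicator (cball 0 (real n)) x *\<^sub>R f x) \<longlonglongrightarrow> f x"
    by (rule tendsto_eventually)
qed

lemma locally_integrable_set:
  assumes "locally_integrable f" "S \<in> sets lebesgue" "bounded S"
  shows "set_integrable lebesgue S f"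
proof -
  obtain r where r: "S \<subseteq> cball 0 r"
    using assms(3) by (auto simp: bounded_iff subset_eq)
  have "f absolutely_integrable_on cball 0 r"
    using assms(1) by (simp add: locally_integrable_def)
  then show ?thesis
    using assms(2) r by (rule set_integrable_subset)
qed

lemma locally_integrable_diff:
  "locally_integrable f \<Longrightarrow> locally_integrable g \<Longrightarrow> locally_integrable (\<lambda>x. f x - g x)"
  by (auto simp: locally_integrable_def intro: set_integral_diff(1))

lemma locally_integrable_sum:
  assumes "\<And>i. i \<in> I \<Longrightarrow> locally_integrable (f i)"
  shows "locally_integrable (\<lambda>x. \<Sum>i\<in>I. f i x)"
  using assms
  by (auto simp: locally_integrable_def set_integrable_def scaleR_sum_right)

lemma locally_integrable_mult_left:
  fixes f :: "'a::euclidean_space \<Rightarrow> 's::{real_normed_field,euclidean_space}"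
  assumes "locally_integrable f"
  shows "locally_integrable (\<lambda>x. f x * c)"
  using assms by (auto simp: locally_integrable_def set_integrable_def simp flip: mult_scaleR_left)

lemma integrable_indicator_scaleR:
  fixes c :: "'b::euclidean_space"
  assumes "S \<in> lmeasurable"
  shows "integrable lebesgue (\<lambda>x. indicator S x *\<^sub>R c)"
    "(LINT x|lebesgue. indicator S x *\<^sub>R c) = measure lebesgue S *\<^sub>R c"
proof -
  have S: "integrable lebesgue (indicat_real S)"
    using assms by (intro integrable_real_indicator) (auto simp: fmeasurable_def)
  then show "integrable lebesgue (\<lambda>x. indicator S x *\<^sub>R c)"
    by (rule integrable_scaleR_left)
  show "(LINT x|lebesgue. indicator S x *\<^sub>R c) = measure lebesgue S *\<^sub>R c"
    using S by (subst integral_scaleR_left) auto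
qed

lemma locally_integrable_indicator:
  assumes "S \<in> sets lebesgue"
  shows "locally_integrable (\<lambda>x. indicator S x *\<^sub>R c)"
  unfolding locally_integrable_def set_integrable_def
proof (intro allI impI)
  fix K :: "'a set" assume "compact K"
  then have "K \<inter> S \<in> lmeasurable"
    using assms by (intro fmeasurable_Int_fmeasurable lmeasurable_compact)
  then have "integrable lebesgue (\<lambda>x. indicator (K \<inter> S) x *\<^sub>R c)"
    by (auto intro!: integrable_real_indicator simp: fmeasurable_def)
  then show "integrable lebesgue (\<lambda>x. indicat_real K x *\<^sub>R indicat_real S x *\<^sub>R c)"
    by (simp add: indicator_inter_arith)
qed

lemma integrable_inner_bounded:
  fixes g h :: "'a::euclidean_space \<Rightarrow> 's::euclidean_space"
  assumes g: "locally_integrable g" and h: "h \<in> borel_measurable lebesgue" "\<And>x. norm (h x) \<le> B"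
    and S: "S \<in> sets lebesgue" "bounded S" "\<And>x. x \<notin> S \<Longrightarrow> h x = 0"
  shows "integrable lebesgue (\<lambda>x. g x \<bullet> h x)"
proof (rule Bochner_Integration.integrable_bound)
  show "integrable lebesgue (\<lambda>x. B *\<^sub>R (indicator S x *\<^sub>R g x))"
    using locally_integrable_set[OF g S(1,2)] unfolding set_integrable_def
    by (rule integrable_scaleR_right)
  show "(\<lambda>x. g x \<bullet> h x) \<in> borel_measurable lebesgue"
    using locally_integrable_measurable[OF g] h(1) by (rule borel_measurable_inner)
  show "AE x in lebesgue. norm (g x \<bullet> h x) \<le> norm (B *\<^sub>R (indicator S x *\<^sub>R g x))"
  proof (rule AE_I2)
    fix x
    have "\<bar>g x \<bullet> h x\<bar> \<le> norm (g x) * norm (h x)" by (rule Cauchy_Schwarz_ineq2)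
    also have "\<dots> \<le> norm (g x) * \<bar>B\<bar>"
      using h(2)[of x] by (intro mult_left_mono) auto
    finally show "norm (g x \<bullet> h x) \<le> norm (B *\<^sub>R (indicator S x *\<^sub>R g x))"
      using S(3)[of x] by (cases "x \<in> S") (auto simp: mult.commute)
  qed
qed

lemma average_sum:
  assumes "\<And>i. i \<in> I \<Longrightarrow> set_integrable lebesgue Q (f i)"
  shows "average (\<lambda>x. \<Sum>i\<in>I. f i x) Q = (\<Sum>i\<in>I. average (f i) Q)"
  using assms unfolding average_def set_lebesgue_integral_def set_integrable_def
  by (simp add: scaleR_sum_right)

lemma average_mult_left:
  fixes f :: "'a::euclidean_space \<Rightarrow> 's::{real_normed_field,euclidean_space}"
  shows "average (\<lambda>x. f x * c) Q = average f Q * c"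
  unfolding average_def set_lebesgue_integral_def
  by (simp flip: mult_scaleR_left)

lemma average_scaleR:
  "average (\<lambda>x. c *\<^sub>R f x) Q = c *\<^sub>R average f Q"
  unfolding average_def by (simp add: mult.commute)

lemma average_diff:
  assumes "set_integrable lebesgue Q f" "set_integrable lebesgue Q g"
  shows "average (\<lambda>x. f x - g x) Q = average f Q - average g Q"
  using assms unfolding average_def by (simp add: scaleR_diff_right)

text \<open>Testing the convergence against bounded functions makes the paraproduct, which is chosen by
  \<^const>\<open>Eps\<close>, linear in a weak sense.\<close>

lemma paraproduct_pairing:
  fixes b f g h :: "'a::euclidean_space \<Rightarrow> 's::{real_normed_field,euclidean_space}"
  assumes g: "is_paraproduct \<D> b f g" and \<D>: "\<D> \<subseteq> sets lebesgue"
    and h: "h \<in> borel_measurable lebesgue" "\<And>x. norm (h x) \<le> B"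
    and S: "S \<in> sets lebesgue" "bounded S" "\<And>x. x \<notin> S \<Longrightarrow> h x = 0"
  shows "((\<lambda>F. LINT x|lebesgue. (\<Sum>Q\<in>F. dyadic_diff \<D> b Q x * average f Q) \<bullet> h x)
           \<longlongrightarrow> (LINT x|lebesgue. g x \<bullet> h x)) (finite_subsets_at_top \<D>)"
proof -
  obtain r where r: "S \<subseteq> cball 0 r"
    using S(2) by (auto simp: bounded_iff subset_eq)
  let ?K = "cball (0::'a) r"
  let ?s = "\<lambda>F x. \<Sum>Q\<in>F. dyadic_diff \<D> b Q x * average f Q"
  let ?N = "\<lambda>F. \<integral>\<^sup>+x\<in>?K. ennreal (norm (?s F x - g x)) \<partial>lebesgue"
  have B: "0 \<le> B" using h(2)[of 0] norm_ge_zero order_trans by blast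
  have lg: "locally_integrable g" using g by (simp add: is_paraproduct_def)
  have ls: "locally_integrable (?s F)" if "F \<subseteq> \<D>" for F
    unfolding dyadic_diff_def using that \<D>
    by (intro locally_integrable_sum locally_integrable_mult_left locally_integrable_diff
        locally_integrable_indicator) auto
  \<comment> \<open>The support of \<open>h\<close> lies in the ball \<open>?K\<close>, so the
    pairings differ by at most \<open>B\<close> times the \<open>L^1\<close> error on
    \<open>?K\<close>.\<close>
  have bound: "ennreal (dist (LINT x|lebesgue. ?s F x \<bullet> h x) (LINT x|lebesgue. g x \<bullet> h x)) \<le> ennreal B * ?N F"
    if F: "F \<subseteq> \<D>" for F
  proof -
    have int: "integrable lebesgue (\<lambda>x. ?s F x \<bullet> h x)" "integrable lebesgue (\<lambda>x. g x \<bullet> h x)"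
      using integrable_inner_bounded[OF ls[OF F] h S] integrable_inner_bounded[OF lg h S] by auto
    then have "dist (LINT x|lebesgue. ?s F x \<bullet> h x) (LINT x|lebesgue. g x \<bullet> h x)
        = norm (LINT x|lebesgue. ?s F x \<bullet> h x - g x \<bullet> h x)"
      by (simp add: dist_norm)
    also have "ennreal \<dots> \<le> (\<integral>\<^sup>+x. ennreal (norm (?s F x \<bullet> h x - g x \<bullet> h x)) \<partial>lebesgue)"
      using int by (intro integral_norm_bound_ennreal) auto
    also have "\<dots> \<le> (\<integral>\<^sup>+x. ennreal B * (ennreal (norm (?s F x - g x)) * indicator ?K x) \<partial>lebesgue)"
    proof (rule nn_integral_mono)
      fix x
      have "\<bar>(?s F x - g x) \<bullet> h x\<bar> \<le> norm (?s F x - g x) * norm (h x)" by (rule Cauchy_Schwarz_ineq2)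
      also have "\<dots> \<le> norm (?s F x - g x) * B"
        using h(2)[of x] by (intro mult_left_mono) auto
      finally have "\<bar>?s F x \<bullet> h x - g x \<bullet> h x\<bar> \<le> B * norm (?s F x - g x)"
        by (simp add: inner_diff_left mult.commute)
      then show "ennreal (norm (?s F x \<bullet> h x - g x \<bullet> h x))
          \<le> ennreal B * (ennreal (norm (?s F x - g x)) * indicator ?K x)"
        using S(3)[of x] r B
        by (cases "x \<in> S") (auto simp: indicator_def subset_eq ennreal_leI simp flip: ennreal_mult')
    qed
    also have "\<dots> = ennreal B * ?N F"
    proof (rule nn_integral_cmult)
      have "(\<lambda>x. norm (?s F x - g x)) \<in> borel_measurable lebesgue"
        using locally_integrable_measurable[OF locally_integrable_diff[OF ls[OF F] lg]]
        by (rule measurable_compose[OF _ borel_measurable_norm])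
      moreover have "?K \<in> sets lebesgue" by simp
      ultimately show "(\<lambda>x. ennreal (norm (?s F x - g x)) * indicator ?K x) \<in> borel_measurable lebesgue"
        by (intro borel_measurable_times_ennreal borel_measurable_indicator measurable_compose[OF _ measurable_ennreal])
    qed
    finally show ?thesis .
  qed
  have "(?N \<longlongrightarrow> 0) (finite_subsets_at_top \<D>)"
    using g unfolding is_paraproduct_def by auto
  then have lim: "((\<lambda>F. ennreal B * ?N F) \<longlongrightarrow> 0) (finite_subsets_at_top \<D>)"
    using ennreal_tendsto_cmult[of "ennreal B" ?N 0] by simp
  have "((\<lambda>F. ennreal (dist (LINT x|lebesgue. ?s F x \<bullet> h x) (LINT x|lebesgue. g x \<bullet> h x))) \<longlongrightarrow> 0)
      (finite_subsets_at_top \<D>)"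
  proof (rule tendsto_sandwich[OF _ _ tendsto_const lim])
    show "\<forall>\<^sub>F F in finite_subsets_at_top \<D>.
        ennreal (dist (LINT x|lebesgue. ?s F x \<bullet> h x) (LINT x|lebesgue. g x \<bullet> h x)) \<le> ennreal B * ?N F"
      by (rule eventually_finite_subsets_at_top_weakI) (rule bound)
  qed auto
  then show ?thesis
    by (subst tendsto_dist_iff) (rule tendsto_ennrealD, auto)
qed

section \<open>Cube averages of the paraproduct and functions that test the oscillation\<close>

context dyadic_grid
begin

lemma average_const_on:
  assumes "R \<in> \<D>" "\<And>x. x \<in> R \<Longrightarrow> f x = c"
  shows "average f R = c"
proof -
  have "(LINT x:R|lebesgue. f x) = (LINT x:R|lebesgue. c)"
    using assms sets_cube by (intro set_lebesgue_integral_cong) auto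
  also have "\<dots> = measure lebesgue R *\<^sub>R c"
    using lmeasurable_cube[OF assms(1)]
    by (intro set_integral_const) (auto simp: fmeasurable_def)
  finally show ?thesis
    using measure_pos[OF assms(1)] by (simp add: average_def)
qed

lemma dyadic_diff_child:
  assumes "R \<in> \<D>" "dyadic_parent \<D> R = P" "x \<in> R"
  shows "dyadic_diff \<D> b P x = average b R - average b P"
proof -
  have P: "P \<in> \<D>" "R \<subseteq> P" using child_psubset[OF assms(1,2)] by auto
  have "(\<Sum>R'\<in>{R'\<in>\<D>. dyadic_parent \<D> R' = P}. indicator R' x *\<^sub>R average b R')
      = (\<Sum>R'\<in>{R'\<in>\<D>. dyadic_parent \<D> R' = P}. if R' = R then average b R else 0)"
    using children_disjoint[OF assms(1) _ assms(2)] assms(3) P(1)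
    by (intro sum.cong refl) (auto simp: indicator_def)
  also have "\<dots> = average b R"
    using finite_children[OF P(1)] assms by (simp add: sum.delta)
  finally show ?thesis
    using assms(3) P by (auto simp: dyadic_diff_def)
qed

lemma dyadic_diff_outside:
  assumes "x \<notin> P"
  shows "dyadic_diff \<D> b P x = 0"
proof -
  have "x \<notin> R" if "R \<in> \<D>" "dyadic_parent \<D> R = P" for R
    using child_psubset[OF that] assms by auto
  then show ?thesis
    using assms by (auto simp: dyadic_diff_def intro!: sum.neutral)
qed

lemma locally_integrable_dyadic_diff: "locally_integrable (dyadic_diff \<D> b P)" if "P \<in> \<D>"
  unfolding dyadic_diff_def using that sets_cube
  by (intro locally_integrable_sum locally_integrable_diff locally_integrable_indicator) auto

text \<open>The children partition \<open>P\<close>, so replacing \<open>b\<close> by its averages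
  over them preserves the integral over \<open>P\<close>. The difference thus has mean zero on
  \<open>P\<close>, and it vanishes outside.\<close>

lemma average_dyadic_diff_above:
  assumes b: "locally_integrable b" and "P \<in> \<D>" "P \<subseteq> R"
  shows "average (dyadic_diff \<D> b P) R = 0"
proof -
  let ?C = "{R\<in>\<D>. dyadic_parent \<D> R = P}"
  have fin: "finite ?C" by (rule finite_children[OF assms(2)])
  have int: "integrable lebesgue (\<lambda>x. indicator Q x *\<^sub>R c)" if "Q \<in> \<D>" for Q and c :: 'b
    using lmeasurable_cube[OF that] by (auto simp: fmeasurable_def)
  have intb: "integrable lebesgue (\<lambda>x. indicator Q x *\<^sub>R b x)" if "Q \<in> \<D>" for Q
    using locally_integrable_set[OF b sets_cube[OF that] bounded_cube[OF that]]
    by (simp add: set_integrable_def)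
  have c: "(LINT x|lebesgue. indicator Q x *\<^sub>R average b Q) = (LINT x|lebesgue. indicator Q x *\<^sub>R b x)"
    if "Q \<in> \<D>" for Q
  proof -
    have "(LINT x|lebesgue. indicator Q x *\<^sub>R average b Q) = measure lebesgue Q *\<^sub>R average b Q"
      by (rule integrable_indicator_scaleR(2)[OF lmeasurable_cube[OF that]])
    then show ?thesis
      using measure_pos[OF that] by (simp add: average_def set_lebesgue_integral_def)
  qed
  have part: "indicator P x *\<^sub>R b x = (\<Sum>Q\<in>?C. indicator Q x *\<^sub>R b x)" for x
  proof (cases "x \<in> P")
    case True
    then obtain R where R: "R \<in> \<D>" "dyadic_parent \<D> R = P" "x \<in> R"
      using child_through assms(2) by blast
    have "(\<Sum>Q\<in>?C. indicator Q x *\<^sub>R b x) = (\<Sum>Q\<in>?C. if Q = R then b x else 0)"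
      using children_disjoint[OF R(1) _ R(2)] R(3) assms(2)
      by (intro sum.cong refl) (auto simp: indicator_def)
    then show ?thesis using True R fin by simp
  next
    case False
    have "x \<notin> R" if "R \<in> ?C" for R
      using child_psubset that False by blast
    then show ?thesis using False by (auto intro!: sum.neutral[symmetric])
  qed
  have "(LINT x:R|lebesgue. dyadic_diff \<D> b P x) = (LINT x|lebesgue. dyadic_diff \<D> b P x)"
    unfolding set_lebesgue_integral_def
    using dyadic_diff_outside assms(3)
    by (intro Bochner_Integration.integral_cong refl) (auto simp: indicator_def)
  also have "\<dots> = (\<Sum>Q\<in>?C. LINT x|lebesgue. indicator Q x *\<^sub>R average b Q)
      - (LINT x|lebesgue. indicator P x *\<^sub>R average b P)"
    unfolding dyadic_diff_def
  proof (subst Bochner_Integration.integral_diff)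
    show "integrable lebesgue (\<lambda>x. \<Sum>Q\<in>?C. indicator Q x *\<^sub>R average b Q)"
      by (intro Bochner_Integration.integrable_sum int) auto
  qed (use int assms(2) in \<open>auto intro!: arg_cong2[where f = minus] Bochner_Integration.integral_sum\<close>)
  also have "\<dots> = (\<Sum>Q\<in>?C. LINT x|lebesgue. indicator Q x *\<^sub>R b x) - (LINT x|lebesgue. indicator P x *\<^sub>R b x)"
    using c assms(2) by simp
  also have "\<dots> = 0"
    using intb by (simp add: part)
  finally show ?thesis by (simp add: average_def)
qed

text \<open>Passing from \<open>P\<close> to its child \<open>R\<close> is felt only by the
  difference of \<open>P\<close> itself. The difference of a disjoint cube vanishes on both, that of
  a larger cube is constant on \<open>P\<close>, and that of a smaller cube has mean zero on
  \<open>P\<close> and either mean zero or the value zero on \<open>R\<close>.\<close>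

lemma average_dyadic_diff_other:
  assumes b: "locally_integrable b" and R: "R \<in> \<D>" "dyadic_parent \<D> R = P" and Q: "Q \<in> \<D>" "Q \<noteq> P"
  shows "average (dyadic_diff \<D> b Q) R = average (dyadic_diff \<D> b Q) P"
proof -
  have P: "P \<in> \<D>" "R \<subset> P" using child_psubset[OF R] by auto
  consider "P \<inter> Q = {}" | "P \<subset> Q" | "Q \<subset> P"
    using nested[OF P(1) Q(1)] Q(2) by blast
  then show ?thesis
  proof cases
    case 1
    have "average (dyadic_diff \<D> b Q) T = 0" if "T \<in> \<D>" "T \<subseteq> P" for T
      using that(2) 1 by (intro average_const_on that(1) dyadic_diff_outside) auto
    then show ?thesis using R P by auto
  next
    case 2
    obtain x where x: "x \<in> P" using nonempty[OF P(1)] by auto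
    then obtain C where C: "C \<in> \<D>" "dyadic_parent \<D> C = Q" "x \<in> C"
      using child_through[OF Q(1)] 2 by blast
    have "P \<subseteq> C" using below_child[OF C(1,2) P(1) 2] x C by blast
    then have "average (dyadic_diff \<D> b Q) T = average b C - average b Q" if "T \<in> \<D>" "T \<subseteq> P" for T
      using that by (intro average_const_on dyadic_diff_child[OF C(1,2)]) auto
    then show ?thesis using R P by auto
  next
    case 3
    have "average (dyadic_diff \<D> b Q) P = 0"
      using 3 by (intro average_dyadic_diff_above b Q) auto
    moreover have "average (dyadic_diff \<D> b Q) R = 0"
      using below_child[OF R Q(1) 3]
    proof
      assume "Q \<subseteq> R" then show ?thesis by (intro average_dyadic_diff_above b Q)
    next
      assume "Q \<inter> R = {}"
      then show ?thesis by (intro average_const_on R dyadic_diff_outside) auto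
    qed
    ultimately show ?thesis by simp
  qed
qed

lemma average_inner:
  assumes "set_integrable lebesgue R g"
  shows "average g R \<bullet> e = (LINT x|lebesgue. g x \<bullet> (indicator R x *\<^sub>R e)) / measure lebesgue R"
proof -
  have "(LINT x:R|lebesgue. g x) \<bullet> e = (LINT x|lebesgue. (indicator R x *\<^sub>R g x) \<bullet> e)"
    using assms unfolding set_lebesgue_integral_def set_integrable_def
    by (rule integral_inner_left[symmetric])
  then show ?thesis by (simp add: average_def divide_inverse)
qed

text \<open>Averaging over \<open>R\<close> is testing against
  \<open>indicator R x *\<^sub>R e\<close>, which is bounded and supported in \<open>R\<close>.
  Letting \<open>e\<close> vary recovers the vector-valued average from real pairings.\<close>

lemma average_paraproduct_tendsto:
  fixes b f g :: "'a \<Rightarrow> 's::{real_normed_field,euclidean_space}"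
  assumes g: "is_paraproduct \<D> b f g" and R: "R \<in> \<D>"
  shows "((\<lambda>F. \<Sum>Q\<in>F. average (dyadic_diff \<D> b Q) R * average f Q) \<longlongrightarrow> average g R) (finite_subsets_at_top \<D>)"
proof -
  let ?s = "\<lambda>F x. \<Sum>Q\<in>F. dyadic_diff \<D> b Q x * average f Q"
  have lg: "set_integrable lebesgue R g"
    using g R by (intro locally_integrable_set sets_cube bounded_cube) (auto simp: is_paraproduct_def)
  have lQ: "set_integrable lebesgue R (\<lambda>x. dyadic_diff \<D> b Q x * average f Q)" if "Q \<in> \<D>" for Q
    using that R by (intro locally_integrable_set sets_cube bounded_cube locally_integrable_mult_left
        locally_integrable_dyadic_diff)
  have ls: "set_integrable lebesgue R (?s F)" if "F \<subseteq> \<D>" for F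
    using that R by (intro locally_integrable_set sets_cube bounded_cube locally_integrable_sum
        locally_integrable_mult_left locally_integrable_dyadic_diff) auto
  have "((\<lambda>F. average (?s F) R \<bullet> e) \<longlongrightarrow> average g R \<bullet> e) (finite_subsets_at_top \<D>)" for e
  proof -
    have "((\<lambda>F. (LINT x|lebesgue. ?s F x \<bullet> (indicator R x *\<^sub>R e)) / measure lebesgue R)
        \<longlongrightarrow> (LINT x|lebesgue. g x \<bullet> (indicator R x *\<^sub>R e)) / measure lebesgue R) (finite_subsets_at_top \<D>)"
      using R measure_pos[OF R] bounded_cube[OF R] sets_cube
      by (intro tendsto_divide tendsto_const paraproduct_pairing[OF g, where S = R and B = "norm e"])
        (auto simp: indicator_def)
    then show ?thesis
      unfolding average_inner[OF lg]
    proof (rule Lim_transform_eventually)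
      show "\<forall>\<^sub>F F in finite_subsets_at_top \<D>. (LINT x|lebesgue. ?s F x \<bullet> (indicator R x *\<^sub>R e)) / measure lebesgue R
          = average (?s F) R \<bullet> e"
        by (rule eventually_finite_subsets_at_top_weakI) (simp add: average_inner[OF ls])
    qed
  qed
  then have "((\<lambda>F. average (?s F) R) \<longlongrightarrow> average g R) (finite_subsets_at_top \<D>)"
    by (rule tendsto_componentwise_iff[THEN iffD2, rule_format])
  then show ?thesis
  proof (rule Lim_transform_eventually)
    show "\<forall>\<^sub>F F in finite_subsets_at_top \<D>.
        average (?s F) R = (\<Sum>Q\<in>F. average (dyadic_diff \<D> b Q) R * average f Q)"
    proof (rule eventually_finite_subsets_at_top_weakI)
      fix F assume F: "F \<subseteq> \<D>"
      have "average (?s F) R = (\<Sum>Q\<in>F. average (\<lambda>x. dyadic_diff \<D> b Q x * average f Q) R)"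
        using F lQ by (intro average_sum) auto
      then show "average (?s F) R = (\<Sum>Q\<in>F. average (dyadic_diff \<D> b Q) R * average f Q)"
        by (simp add: average_mult_left)
    qed
  qed
qed

text \<open>In the difference of the two limits all terms except that of \<open>P\<close> cancel,
  and the indicator of \<open>Q\<close> has average one on \<open>P\<close>.\<close>

lemma average_paraproduct_step:
  fixes b g :: "'a \<Rightarrow> 's::{real_normed_field,euclidean_space}"
  assumes g: "is_paraproduct \<D> b (\<lambda>x. of_real (indicator Q x)) g" and b: "locally_integrable b"
    and R: "R \<in> \<D>" "dyadic_parent \<D> R = P" "P \<subseteq> Q"
  shows "average g R - average g P = average b R - average b P"
proof -
  let ?f = "\<lambda>x. of_real (indicator Q x) :: 's"
  have P: "P \<in> \<D>" using child_psubset[OF R(1,2)] by auto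
  have f: "average ?f P = 1"
    using R(3) by (intro average_const_on P) auto
  have "((\<lambda>F. (\<Sum>T\<in>F. average (dyadic_diff \<D> b T) R * average ?f T)
        - (\<Sum>T\<in>F. average (dyadic_diff \<D> b T) P * average ?f T)) \<longlongrightarrow> average g R - average g P)
      (finite_subsets_at_top \<D>)"
    using P R g by (intro tendsto_diff average_paraproduct_tendsto)
  moreover have "\<forall>\<^sub>F F in finite_subsets_at_top \<D>. (\<Sum>T\<in>F. average (dyadic_diff \<D> b T) R * average ?f T)
        - (\<Sum>T\<in>F. average (dyadic_diff \<D> b T) P * average ?f T) = average b R - average b P"
    unfolding eventually_finite_subsets_at_top
  proof (intro exI[of _ "{P}"] conjI allI impI)
    \<comment> \<open>Once \<open>F\<close> contains \<open>P\<close> the difference no longer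
      depends on \<open>F\<close>, so the limit can be read off without an estimate.\<close>
    fix F assume F: "finite F \<and> {P} \<subseteq> F \<and> F \<subseteq> \<D>"
    have "(\<Sum>T\<in>F. average (dyadic_diff \<D> b T) R * average ?f T)
        - (\<Sum>T\<in>F. average (dyadic_diff \<D> b T) P * average ?f T)
      = (\<Sum>T\<in>F. (average (dyadic_diff \<D> b T) R - average (dyadic_diff \<D> b T) P) * average ?f T)"
      by (simp add: sum_subtractf algebra_simps)
    also have "\<dots> = (\<Sum>T\<in>F. if T = P then average (dyadic_diff \<D> b P) R - average (dyadic_diff \<D> b P) P else 0)"
      using F average_dyadic_diff_other[OF b R(1,2)] by (intro sum.cong refl) (auto simp: f)
    also have "\<dots> = average (dyadic_diff \<D> b P) R - average (dyadic_diff \<D> b P) P"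
      using F by simp
    also have "average (dyadic_diff \<D> b P) P = 0"
      by (intro average_dyadic_diff_above b P order_refl)
    also have "average (dyadic_diff \<D> b P) R = average b R - average b P"
      by (intro average_const_on R dyadic_diff_child)
    finally show "(\<Sum>T\<in>F. average (dyadic_diff \<D> b T) R * average ?f T)
        - (\<Sum>T\<in>F. average (dyadic_diff \<D> b T) P * average ?f T) = average b R - average b P"
      by simp
  qed (use P in auto)
  ultimately have "((\<lambda>F. average b R - average b P) \<longlongrightarrow> average g R - average g P) (finite_subsets_at_top \<D>)"
    by (rule Lim_transform_eventually)
  then show ?thesis
    by (rule tendsto_unique[rotated]) (auto simp: finite_subsets_at_top_neq_bot)
qed

text \<open>The average of \<open>g - b\<close> passes unchanged from a cube to its children, hence
  is the same for all cubes inside \<open>Q\<close>; such a function is constant almost everywhere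
  on \<open>Q\<close>. The cubes strictly above \<open>Q\<close> enter only through the value of
  this constant, which is never estimated.\<close>

lemma paraproduct_indicator:
  fixes b g :: "'a \<Rightarrow> 's::{real_normed_field,euclidean_space}"
  assumes g: "is_paraproduct \<D> b (\<lambda>x. of_real (indicator Q x)) g" and b: "locally_integrable b"
    and Q: "Q \<in> \<D>"
  shows "AE x in lebesgue. x \<in> Q \<longrightarrow> g x - b x = average g Q - average b Q"
proof -
  define c where "c = average g Q - average b Q"
  have lg: "locally_integrable g" using g by (simp add: is_paraproduct_def)
  let ?h = "\<lambda>x. indicator Q x *\<^sub>R (g x - b x - c)"
  have int: "set_integrable lebesgue R g" "set_integrable lebesgue R b" "set_integrable lebesgue R (\<lambda>x. c)"
    if "R \<in> \<D>" for R
    using locally_integrable_set[OF lg] locally_integrable_set[OF b] that sets_cube bounded_cube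
      lmeasurable_cube[OF that]
    by (auto simp: set_integrable_def fmeasurable_def)
  have zero: "(LINT x:R|lebesgue. g x - b x - c) = 0" if "R \<in> \<D>" "R \<subseteq> Q" for R
  proof -
    have "average g R - average b R = c"
      using Q that
    proof (induction rule: descendant_induct)
      case refl
      then show ?case by (simp add: c_def)
    next
      case (child R R')
      then show ?case using average_paraproduct_step[OF g b child(1-3)] by (simp add: algebra_simps)
    qed
    moreover have "average (\<lambda>x. g x - b x - c) R = average g R - average b R - average (\<lambda>x. c) R"
      using int[OF that(1)] by (simp add: average_diff)
    moreover have "average (\<lambda>x. c) R = c"
      using that(1) by (intro average_const_on) auto
    ultimately have "average (\<lambda>x. g x - b x - c) R = 0" by simp
    then show ?thesis
      using measure_pos[OF that(1)] by (simp add: average_def)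
  qed
  have "AE x in lebesgue. ?h x = 0"
  proof (rule AE_zero_if_cube_integrals_zero)
    show "integrable lebesgue ?h"
      using int[OF Q] by (auto simp: set_integrable_def[symmetric] intro!: set_integral_diff(1))
    show "(LINT x|lebesgue. ?h x) = 0"
      using zero[OF Q] by (simp add: set_lebesgue_integral_def)
    fix R assume R: "R \<in> \<D>"
    have ind: "(LINT x:R|lebesgue. ?h x) = (LINT x:(R \<inter> Q)|lebesgue. g x - b x - c)"
      by (simp add: set_lebesgue_integral_def indicator_inter_arith)
    consider "R \<subseteq> Q" | "Q \<subseteq> R" | "R \<inter> Q = {}" using nested[OF R Q] by blast
    then show "(LINT x:R|lebesgue. ?h x) = 0"
      unfolding ind using zero[OF R] zero[OF Q]
      by cases (auto simp: Int_absorb1 Int_absorb2 set_lebesgue_integral_def)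
  qed
  then show ?thesis
    unfolding c_def[symmetric] by eventually_elim (auto simp: indicator_def)
qed

text \<open>The function \<open>h\<close> is the direction of \<open>b - average b Q\<close>, minus
  its mean, cut off to \<open>Q\<close>. Mean zero makes it blind to the constant between
  \<open>g\<close> and \<open>b\<close>. Subtracting the mean leaves the pairing with
  \<open>b - average b Q\<close> unchanged but doubles the bound on the norm. The real inner product
  covers complex scalars too, and \<open>h\<close> is found before \<open>g\<close> is
  given.\<close>

lemma oscillation_test:
  fixes b :: "'a \<Rightarrow> 's::{real_normed_field,euclidean_space}"
  assumes b: "locally_integrable b" and Q: "Q \<in> \<D>"
  obtains h :: "'a \<Rightarrow> 's" where "h \<in> borel_measurable lebesgue" "\<And>x. norm (h x) \<le> 2"
    "\<And>x. x \<notin> Q \<Longrightarrow> h x = 0"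
    "\<And>g. is_paraproduct \<D> b (\<lambda>x. of_real (indicator Q x)) g \<Longrightarrow>
        oscillation b Q = ennreal (LINT x|lebesgue. g x \<bullet> h x)"
proof -
  define c where "c = average b Q"
  \<comment> \<open>Where \<open>b x = c\<close>, the inverse of zero is zero, so
    \<open>s x = 0\<close> and the bound by one persists.\<close>
  define s where "s x = (b x - c) /\<^sub>R norm (b x - c)" for x
  define h where "h x = indicator Q x *\<^sub>R (s x - average s Q)" for x
  have [measurable]: "b \<in> borel_measurable lebesgue" "Q \<in> sets lebesgue"
    using locally_integrable_measurable[OF b] sets_cube[OF Q] by auto
  have sm [measurable]: "s \<in> borel_measurable lebesgue"
    unfolding s_def by measurable
  have s1: "norm (s x) \<le> 1" for x
    by (cases "b x = c") (auto simp: s_def)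
  have ints: "integrable lebesgue (\<lambda>x. indicator Q x *\<^sub>R s x)"
    and intc: "integrable lebesgue (\<lambda>x. indicator Q x *\<^sub>R (d::'s))" for d
  proof -
    show "integrable lebesgue (\<lambda>x. indicator Q x *\<^sub>R (d::'s))" for d
      using lmeasurable_cube[OF Q] by (auto simp: fmeasurable_def)
    then have "integrable lebesgue (\<lambda>x. indicator Q x *\<^sub>R (1::'s))" .
    then show "integrable lebesgue (\<lambda>x. indicator Q x *\<^sub>R s x)"
    proof (rule Bochner_Integration.integrable_bound)
      show "AE x in lebesgue. norm (indicator Q x *\<^sub>R s x) \<le> norm (indicator Q x *\<^sub>R (1::'s))"
        using s1 by (auto simp: indicator_def)
    qed measurable
  qed
  have as: "norm (average s Q) \<le> 1"
  proof -
    have "norm (LINT x|lebesgue. indicator Q x *\<^sub>R s x) \<le> (LINT x|lebesgue. norm (indicator Q x *\<^sub>R s x))"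
      by (rule integral_norm_bound)
    also have "\<dots> \<le> (LINT x|lebesgue. indicator Q x)"
    proof (intro integral_mono integrable_norm ints)
      show "integrable lebesgue (\<lambda>x. indicator Q x :: real)"
        using lmeasurable_cube[OF Q] by (intro integrable_real_indicator) (auto simp: fmeasurable_def)
    qed (use s1 in \<open>auto simp: indicator_def\<close>)
    also have "\<dots> = measure lebesgue Q" by simp
    finally show ?thesis
      using measure_pos[OF Q] by (simp add: average_def set_lebesgue_integral_def field_simps)
  qed
  have hm: "h \<in> borel_measurable lebesgue"
    unfolding h_def by measurable
  have h2: "norm (h x) \<le> 2" for x
    using norm_triangle_ineq4[of "s x" "average s Q"] s1[of x] as by (auto simp: h_def indicator_def)
  have hout: "h x = 0" if "x \<notin> Q" for x using that by (simp add: h_def)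
  have sup: "Q \<in> sets lebesgue" "bounded Q" using bounded_cube[OF Q] by auto
  have h0: "(LINT x|lebesgue. h x) = 0"
  proof -
    have "(LINT x|lebesgue. h x) = (LINT x|lebesgue. indicator Q x *\<^sub>R s x) - measure lebesgue Q *\<^sub>R average s Q"
      unfolding h_def using ints intc lmeasurable_cube[OF Q]
      by (simp add: scaleR_diff_right fmeasurable_def)
    then show ?thesis
      using measure_pos[OF Q] by (simp add: average_def set_lebesgue_integral_def)
  qed
  have inth: "integrable lebesgue h"
    unfolding h_def using ints intc by (simp add: scaleR_diff_right)
  have const: "(LINT x|lebesgue. d \<bullet> h x) = 0" for d :: 's
    using inth h0 by simp
  have lc: "locally_integrable (\<lambda>x::'a. d)" for d :: 's
    using locally_integrable_indicator[of "UNIV :: 'a set" d] by simp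
  have bc: "locally_integrable (\<lambda>x. b x - c)"
    by (intro locally_integrable_diff b lc)
  have ibc: "integrable lebesgue (\<lambda>x. indicator Q x *\<^sub>R (b x - c))"
    using locally_integrable_set[OF bc sup] by (simp add: set_integrable_def)
  have "oscillation b Q = (\<integral>\<^sup>+x. ennreal (norm (indicator Q x *\<^sub>R (b x - c))) \<partial>lebesgue)"
    unfolding oscillation_def c_def[symmetric]
    by (intro nn_integral_cong) (auto simp: indicator_def)
  also have "\<dots> = ennreal (LINT x|lebesgue. norm (indicator Q x *\<^sub>R (b x - c)))"
    using ibc by (intro nn_integral_eq_integral integrable_norm) auto
  finally have osc: "oscillation b Q = ennreal (LINT x|lebesgue. norm (indicator Q x *\<^sub>R (b x - c)))" .
  have "(LINT x|lebesgue. norm (indicator Q x *\<^sub>R (b x - c)))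
      = (LINT x|lebesgue. (b x - c) \<bullet> h x + (indicator Q x *\<^sub>R (b x - c)) \<bullet> average s Q)"
  proof (intro Bochner_Integration.integral_cong refl)
    fix x
    have "(b x - c) \<bullet> s x = norm (b x - c)"
      by (cases "b x = c") (auto simp: s_def power2_norm_eq_inner[symmetric] power2_eq_square)
    then show "norm (indicator Q x *\<^sub>R (b x - c))
        = (b x - c) \<bullet> h x + (indicator Q x *\<^sub>R (b x - c)) \<bullet> average s Q"
      by (auto simp: h_def indicator_def inner_diff_right)
  qed
  also have "\<dots> = (LINT x|lebesgue. (b x - c) \<bullet> h x) + (LINT x|lebesgue. indicator Q x *\<^sub>R (b x - c)) \<bullet> average s Q"
  proof -
    have "integrable lebesgue (\<lambda>x. (b x - c) \<bullet> h x)"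
      by (rule integrable_inner_bounded[OF bc hm h2 sup hout])
    moreover have "integrable lebesgue (\<lambda>x. (indicator Q x *\<^sub>R (b x - c)) \<bullet> average s Q)"
      using ibc by (rule integrable_inner_left)
    moreover have "(LINT x|lebesgue. (indicator Q x *\<^sub>R (b x - c)) \<bullet> average s Q)
        = (LINT x|lebesgue. indicator Q x *\<^sub>R (b x - c)) \<bullet> average s Q"
      using ibc by (rule integral_inner_left)
    ultimately show ?thesis
      by (simp only: Bochner_Integration.integral_add)
  qed
  also have "(LINT x|lebesgue. indicator Q x *\<^sub>R (b x - c)) = 0"
  proof -
    have "(LINT x|lebesgue. indicator Q x *\<^sub>R (b x - c))
        = (LINT x|lebesgue. indicator Q x *\<^sub>R b x) - measure lebesgue Q *\<^sub>R c"
      using locally_integrable_set[OF b sup] intc[of c] lmeasurable_cube[OF Q]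
      by (simp add: scaleR_diff_right fmeasurable_def set_integrable_def)
    then show ?thesis
      using measure_pos[OF Q] by (simp add: c_def average_def set_lebesgue_integral_def)
  qed
  finally have osc': "oscillation b Q = ennreal (LINT x|lebesgue. (b x - c) \<bullet> h x)"
    by (simp add: osc)
  have "oscillation b Q = ennreal (LINT x|lebesgue. g x \<bullet> h x)"
    if g: "is_paraproduct \<D> b (\<lambda>x. of_real (indicator Q x)) g" for g
  proof -
    have [measurable]: "g \<in> borel_measurable lebesgue"
      using g locally_integrable_measurable by (auto simp: is_paraproduct_def)
    have "(LINT x|lebesgue. g x \<bullet> h x) = (LINT x|lebesgue. (b x - c) \<bullet> h x + average g Q \<bullet> h x)"
    proof (rule integral_cong_AE)
      show "AE x in lebesgue. g x \<bullet> h x = (b x - c) \<bullet> h x + average g Q \<bullet> h x"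
        using paraproduct_indicator[OF g b Q]
      proof eventually_elim
        case (elim x)
        have "g x = b x - c + average g Q" if "x \<in> Q"
          using elim that by (simp add: c_def algebra_simps)
        then show ?case using hout[of x] by (cases "x \<in> Q") (auto simp: inner_add_left)
      qed
    qed (use hm in measurable)
    also have "\<dots> = (LINT x|lebesgue. (b x - c) \<bullet> h x)"
      using integrable_inner_bounded[OF bc hm h2 sup hout]
        integrable_inner_bounded[OF lc hm h2 sup hout] const
      by simp
    finally show ?thesis using osc' by simp
  qed
  with hm h2 hout show thesis using that by blast
qed

end


subsection \<open>Weights and sparse families\<close>

text \<open>Real companion of \<open>weight_of\<close>; for weights the two agree on bounded
  measurable sets. It gives access to \<open>powr\<close> and to field arithmetic.\<close>

definition mass :: "('a::euclidean_space \<Rightarrow> real) \<Rightarrow> 'a set \<Rightarrow> real" where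
  "mass w Q = (LINT x:Q|lebesgue. w x)"

lemma weight_measurable: "weight w \<Longrightarrow> w \<in> borel_measurable lebesgue"
  by (simp add: weight_def locally_integrable_measurable)

lemma weight_pos: "weight w \<Longrightarrow> 0 < w x"
  by (simp add: weight_def)

lemma weight_nonneg: "weight w \<Longrightarrow> 0 \<le> w x"
  by (simp add: weight_def less_imp_le)

lemma weight_of_mass:
  assumes "weight w" "Q \<in> sets lebesgue" "bounded Q"
  shows "weight_of w Q = ennreal (mass w Q)"
proof -
  have int: "integrable lebesgue (\<lambda>x. indicator Q x *\<^sub>R w x)"
    using locally_integrable_set[of w Q] assms by (simp add: weight_def set_integrable_def)
  have "weight_of w Q = (\<integral>\<^sup>+x. ennreal (indicator Q x *\<^sub>R w x) \<partial>lebesgue)"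
    unfolding weight_of_def by (intro nn_integral_cong) (auto simp: indicator_def)
  also have "\<dots> = ennreal (mass w Q)"
    unfolding mass_def set_lebesgue_integral_def
    using int weight_nonneg[OF assms(1)] by (intro nn_integral_eq_integral) auto
  finally show ?thesis .
qed

lemma mass_nonneg: "weight w \<Longrightarrow> 0 \<le> mass w Q"
  unfolding mass_def set_lebesgue_integral_def
  by (intro Bochner_Integration.integral_nonneg) (auto simp: weight_nonneg)

definition osc :: "('a::euclidean_space \<Rightarrow> 's::euclidean_space) \<Rightarrow> 'a set \<Rightarrow> real" where
  "osc b Q = (LINT x:Q|lebesgue. norm (b x - average b Q))"

lemma osc_nonneg: "0 \<le> osc b Q"
  unfolding osc_def set_lebesgue_integral_def by (intro Bochner_Integration.integral_nonneg) auto

lemma ennreal_divide_le_imp: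
  fixes a :: ennreal
  assumes "a / ennreal c \<le> K" "0 < c"
  shows "a \<le> K * ennreal c"
proof -
  have "a = a / ennreal c * ennreal c"
    using assms(2) by (simp add: ennreal_divide_times ennreal_times_divide[symmetric] ennreal_mult_divide_eq)
  also have "\<dots> \<le> K * ennreal c"
    using assms(1) by (rule mult_right_mono) simp
  finally show ?thesis .
qed

text \<open>Along an enumeration of \<open>I\<close> the finite suprema increase to the full one, so
  monotone convergence applies. An empty \<open>I\<close> has no enumeration and is treated
  apart.\<close>

lemma nn_integral_SUP_le:
  fixes u :: "'i \<Rightarrow> 'b \<Rightarrow> ennreal"
  assumes "countable I" "\<And>i. i \<in> I \<Longrightarrow> u i \<in> borel_measurable M"
    and le: "\<And>F. finite F \<Longrightarrow> F \<subseteq> I \<Longrightarrow> (\<integral>\<^sup>+x. (SUP i\<in>F. u i x) \<partial>M) \<le> Y"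
  shows "(\<integral>\<^sup>+x. (SUP i\<in>I. u i x) \<partial>M) \<le> Y"
proof (cases "I = {}")
  case True
  then show ?thesis using le[of "{}"] by simp
next
  case False
  let ?c = "from_nat_into I"
  have I: "range ?c = I" using False assms(1) by (rule range_from_nat_into)
  have "(SUP i\<in>I. u i x) = (SUP n. SUP i\<in>?c ` {..n}. u i x)" for x
  proof (rule antisym)
    show "(SUP i\<in>I. u i x) \<le> (SUP n. SUP i\<in>?c ` {..n}. u i x)"
    proof (rule SUP_least)
      fix i assume "i \<in> I"
      then obtain n where "i = ?c n" using I by auto
      then have "u i x \<le> (SUP i\<in>?c ` {..n}. u i x)" by (intro SUP_upper) auto
      also have "\<dots> \<le> (SUP n. SUP i\<in>?c ` {..n}. u i x)" by (intro SUP_upper) auto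
      finally show "u i x \<le> (SUP n. SUP i\<in>?c ` {..n}. u i x)" .
    qed
    show "(SUP n. SUP i\<in>?c ` {..n}. u i x) \<le> (SUP i\<in>I. u i x)"
      using I by (intro SUP_least SUP_upper) auto
  qed
  then have "(\<integral>\<^sup>+x. (SUP i\<in>I. u i x) \<partial>M) = (\<integral>\<^sup>+x. (SUP n. SUP i\<in>?c ` {..n}. u i x) \<partial>M)"
    by simp
  also have "\<dots> = (SUP n. \<integral>\<^sup>+x. (SUP i\<in>?c ` {..n}. u i x) \<partial>M)"
  proof (rule nn_integral_monotone_convergence_SUP)
    show "incseq (\<lambda>n x. SUP i\<in>?c ` {..n}. u i x)"
      by (auto simp: incseq_def le_fun_def intro!: SUP_subset_mono image_mono)
    show "(\<lambda>x. SUP i\<in>?c ` {..n}. u i x) \<in> borel_measurable M" for n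
      using assms(2) I by (intro borel_measurable_SUP) auto
  qed
  also have "\<dots> \<le> Y"
    using I by (intro SUP_least le) auto
  finally show ?thesis .
qed

section \<open>Sparse stopping families and their Carleson constants\<close>

context dyadic_grid
begin

lemma weight_of_cube: "weight w \<Longrightarrow> Q \<in> \<D> \<Longrightarrow> weight_of w Q = ennreal (mass w Q)"
  by (intro weight_of_mass sets_cube bounded_cube)

lemma mass_pos:
  assumes w: "weight w" and Q: "Q \<in> \<D>"
  shows "0 < mass w Q"
proof (rule ccontr)
  have [measurable]: "w \<in> borel_measurable lebesgue" "Q \<in> sets lebesgue"
    using weight_measurable[OF w] sets_cube[OF Q] by auto
  assume "\<not> 0 < mass w Q"
  then have "weight_of w Q = 0"
    using weight_of_cube[OF w Q] by (simp add: ennreal_neg)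
  then have "AE x in lebesgue. ennreal (w x) * indicator Q x = 0"
    unfolding weight_of_def by (subst (asm) nn_integral_0_iff_AE) auto
  then have "AE x in lebesgue. x \<notin> Q"
  proof eventually_elim
    case (elim x)
    then show ?case
      using weight_pos[OF w, of x] by (cases "x \<in> Q") (auto simp: ennreal_eq_0_iff)
  qed
  then have "emeasure lebesgue Q = 0"
    using sets_cube[OF Q] by (simp add: AE_iff_null_sets[symmetric] null_setsD1)
  then show False
    using measure_pos[OF Q] by (simp add: measure_def)
qed

lemma lattice_nonempty: "\<D> \<noteq> {}"
  using ex_cube[of 0] in_lattice by blast

text \<open>The choice \<open>R = Q\<close> is admissible in the inner supremum. Its purpose is to
  keep each characteristic from annihilating an infinite value of the other in a product.\<close>

lemma Ainf_char_ge_1: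
  assumes w: "weight w" and \<nu>: "weight \<nu>"
  shows "1 \<le> Ainf_char \<D> \<nu> w"
proof -
  obtain Q where Q: "Q \<in> \<D>" using lattice_nonempty by auto
  have [measurable]: "\<nu> \<in> borel_measurable lebesgue" "Q \<in> sets lebesgue"
    using weight_measurable[OF \<nu>] sets_cube[OF Q] by auto
  let ?s = "\<lambda>x. SUP R\<in>{R\<in>\<D>. x \<in> R \<and> R \<subseteq> Q}. weight_of w R / weight_of \<nu> R"
  have pos: "0 < mass w Q" "0 < mass \<nu> Q"
    using mass_pos w \<nu> Q by auto
  have "weight_of w Q = weight_of w Q / weight_of \<nu> Q * weight_of \<nu> Q"
    using pos w \<nu> Q by (simp add: weight_of_cube divide_ennreal flip: ennreal_mult')
  also have "\<dots> = (\<integral>\<^sup>+x. weight_of w Q / weight_of \<nu> Q * (ennreal (\<nu> x) * indicator Q x) \<partial>lebesgue)"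
    unfolding weight_of_def[of \<nu>] by (rule nn_integral_cmult[symmetric]) measurable
  also have "\<dots> \<le> (\<integral>\<^sup>+x. ?s x * ennreal (\<nu> x) * indicator Q x \<partial>lebesgue)"
    using Q by (intro nn_integral_mono) (auto simp: indicator_def intro!: mult_right_mono SUP_upper)
  finally have "weight_of w Q / weight_of w Q
      \<le> (\<integral>\<^sup>+x. ?s x * ennreal (\<nu> x) * indicator Q x \<partial>lebesgue) / weight_of w Q"
    by (rule divide_right_mono_ennreal)
  also have "\<dots> \<le> Ainf_char \<D> \<nu> w"
    unfolding Ainf_char_def using Q by (intro SUP_upper)
  finally show ?thesis
    using pos w Q by (simp add: weight_of_cube)
qed

text \<open>The jumps linearise the power pointwise, so integration against \<open>w\<close>
  replaces each indicator by a mass, with equality.\<close>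

lemma nn_integral_sum_powr:
  assumes w: "weight w" and S: "finite S" "S \<subseteq> \<D>" and a: "\<And>P. 0 \<le> a P" and p: "0 < p"
  shows "(\<integral>\<^sup>+x. ennreal ((\<Sum>R\<in>S. a R * indicator R x) powr p * w x) \<partial>lebesgue)
    = ennreal (\<Sum>R\<in>S. power_jump S a p R * mass w R)"
proof -
  have [measurable]: "w \<in> borel_measurable lebesgue" "\<And>R. R \<in> S \<Longrightarrow> R \<in> sets lebesgue"
    using weight_measurable[OF w] sets_cube S by auto
  have d: "0 \<le> power_jump S a p R" if "R \<in> S" for R
    using power_jump_nonneg[where a = a, OF S(1) that a p] .
  have "(\<integral>\<^sup>+x. ennreal ((\<Sum>R\<in>S. a R * indicator R x) powr p * w x) \<partial>lebesgue)
      = (\<integral>\<^sup>+x. (\<Sum>R\<in>S. ennreal (power_jump S a p R) * (ennreal (w x) * indicator R x)) \<partial>lebesgue)"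
  proof (intro nn_integral_cong)
    fix x
    have "(\<Sum>R\<in>S. a R * indicator R x) powr p * w x = (\<Sum>R\<in>S. power_jump S a p R * (w x * indicator R x))"
      using sum_powr_pointwise[OF S(1) laminar_subset[OF S(2)] p, of a x]
      by (simp add: sum_distrib_left sum_distrib_right mult_ac)
    also have "ennreal \<dots> = (\<Sum>R\<in>S. ennreal (power_jump S a p R * (w x * indicator R x)))"
      using d weight_nonneg[OF w] by (intro sum_ennreal[symmetric]) auto
    also have "\<dots> = (\<Sum>R\<in>S. ennreal (power_jump S a p R) * (ennreal (w x) * indicator R x))"
      using d by (intro sum.cong refl) (auto simp: indicator_def ennreal_mult')
    finally show "ennreal ((\<Sum>R\<in>S. a R * indicator R x) powr p * w x)
        = (\<Sum>R\<in>S. ennreal (power_jump S a p R) * (ennreal (w x) * indicator R x))" .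
  qed
  also have "\<dots> = (\<Sum>R\<in>S. ennreal (power_jump S a p R) * weight_of w R)"
    by (subst nn_integral_sum) (auto simp: nn_integral_cmult weight_of_def)
  also have "\<dots> = (\<Sum>R\<in>S. ennreal (power_jump S a p R * mass w R))"
    using S(2) w d by (intro sum.cong refl) (auto simp: weight_of_cube ennreal_mult')
  also have "\<dots> = ennreal (\<Sum>R\<in>S. power_jump S a p R * mass w R)"
    using d mass_nonneg[OF w] by (intro sum_ennreal) auto
  finally show ?thesis .
qed

lemma
  assumes b: "locally_integrable b" and Q: "Q \<in> \<D>"
  shows integrable_osc: "set_integrable lebesgue Q (\<lambda>x. norm (b x - c))"
    and oscillation_osc: "oscillation b Q = ennreal (osc b Q)"
proof -
  have lc: "locally_integrable (\<lambda>x::'a. d)" for d :: 'b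
    using locally_integrable_indicator[of "UNIV :: 'a set" d] by simp
  show int: "set_integrable lebesgue Q (\<lambda>x. norm (b x - c))" for c
    using locally_integrable_set[OF locally_integrable_diff[OF b lc] sets_cube[OF Q] bounded_cube[OF Q]]
    by (rule set_integrable_norm)
  have "oscillation b Q = (\<integral>\<^sup>+x. ennreal (indicator Q x *\<^sub>R norm (b x - average b Q)) \<partial>lebesgue)"
    unfolding oscillation_def by (intro nn_integral_cong) (auto simp: indicator_def)
  also have "\<dots> = ennreal (osc b Q)"
    unfolding osc_def set_lebesgue_integral_def
    using int[unfolded set_integrable_def] by (intro nn_integral_eq_integral) auto
  finally show "oscillation b Q = ennreal (osc b Q)" .
qed

text \<open>The average is an optimal constant up to a factor 2, because
  \<open>norm (average b Q - c)\<close> is at most the mean of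
  \<open>norm (b x - c)\<close>.\<close>

lemma osc_le:
  assumes b: "locally_integrable b" and Q: "Q \<in> \<D>"
  shows "osc b Q \<le> 2 * (LINT x:Q|lebesgue. norm (b x - c))"
proof -
  note int = integrable_osc[OF b Q]
  have lm: "set_integrable lebesgue Q (\<lambda>x. d)" for d :: real
    using integrable_indicator_scaleR(1)[OF lmeasurable_cube[OF Q], of d] by (simp add: set_integrable_def)
  have const: "(LINT x:Q|lebesgue. d) = measure lebesgue Q * d" for d :: real
    using integrable_indicator_scaleR(2)[OF lmeasurable_cube[OF Q], of d] by (simp add: set_lebesgue_integral_def)
  have lb: "set_integrable lebesgue Q b" "set_integrable lebesgue Q (\<lambda>x. c)"
    using locally_integrable_set[OF b sets_cube[OF Q] bounded_cube[OF Q]]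
      integrable_indicator_scaleR(1)[OF lmeasurable_cube[OF Q], of c] by (auto simp: set_integrable_def)
  have "average b Q - c = average (\<lambda>x. b x - c) Q"
    using lb average_const_on[OF Q, of "\<lambda>_. c"] by (simp add: average_diff)
  also have "norm \<dots> \<le> (LINT x:Q|lebesgue. norm (b x - c)) / measure lebesgue Q"
  proof -
    have "norm (LINT x:Q|lebesgue. b x - c) \<le> (LINT x:Q|lebesgue. norm (b x - c))"
      unfolding set_lebesgue_integral_def
      using integral_norm_bound[of lebesgue "\<lambda>x. indicator Q x *\<^sub>R (b x - c)"] by simp
    then show ?thesis
      using measure_pos[OF Q] by (simp add: average_def divide_inverse mult.commute)
  qed
  finally have *: "measure lebesgue Q * norm (average b Q - c) \<le> (LINT x:Q|lebesgue. norm (b x - c))"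
    using measure_pos[OF Q] by (simp add: field_simps)
  have "osc b Q \<le> (LINT x:Q|lebesgue. norm (b x - c) + norm (average b Q - c))"
    unfolding osc_def
  proof (intro set_integral_mono int set_integral_add(1) lm)
    fix x
    have "b x - average b Q = (b x - c) - (average b Q - c)" by simp
    then show "norm (b x - average b Q) \<le> norm (b x - c) + norm (average b Q - c)"
      by (metis norm_triangle_ineq4)
  qed
  also have "\<dots> = (LINT x:Q|lebesgue. norm (b x - c)) + measure lebesgue Q * norm (average b Q - c)"
    using int lm by (simp add: set_integral_add(2) const)
  finally show ?thesis using * by simp
qed

text \<open>For a maximal smaller member \<open>R\<close>, growth bounds
  \<open>4 * (osc b Q / mass \<nu> Q) * mass \<nu> R\<close> by \<open>osc b R\<close>, which is at
  most twice the integral of \<open>norm (b x - average b Q)\<close> over \<open>R\<close>. These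
  cubes are disjoint, so summation gives at most \<open>2 * osc b Q\<close>. Hence they cover at
  most half of the \<nu>-mass of \<open>Q\<close>.\<close>

lemma sparse:
  assumes b: "locally_integrable b" and \<nu>: "weight \<nu>" and S: "finite S" "S \<subseteq> \<D>"
    and pos: "\<And>Q. Q \<in> S \<Longrightarrow> 0 < osc b Q"
    and growth: "\<And>Q R. Q \<in> S \<Longrightarrow> R \<in> S \<Longrightarrow> R \<subset> Q \<Longrightarrow> 4 * (osc b Q / mass \<nu> Q) < osc b R / mass \<nu> R"
    and Q: "Q \<in> S"
  shows "mass \<nu> Q \<le> 2 * mass \<nu> (Q - \<Union>{R\<in>S. R \<subset> Q})"
proof -
  define G where "G = {R\<in>S. R \<subset> Q}"
  \<comment> \<open>Keeping only the maximal members gives disjoint cubes with the same union as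
    \<open>G\<close>.\<close>
  define M where "M = {R\<in>G. \<forall>P\<in>G. R \<subseteq> P \<longrightarrow> P = R}"
  have fin: "finite G" "finite M" using S by (auto simp: G_def M_def)
  have MD: "R \<in> \<D>" "R \<in> S" "R \<subset> Q" if "R \<in> M" for R using that S by (auto simp: M_def G_def)
  have QD: "Q \<in> \<D>" using Q S by auto
  have "\<Union>G = \<Union>M"
  proof
    show "\<Union>G \<subseteq> \<Union>M"
    proof
      fix x assume "x \<in> \<Union>G"
      then obtain R where R: "R \<in> G" "x \<in> R" by auto
      obtain P where P: "P \<in> G" "R \<subseteq> P" "\<forall>T\<in>G. P \<subseteq> T \<longrightarrow> P = T"
        using finite_has_maximal2[OF fin(1) R(1)] by auto
      then have "P \<in> M" by (auto simp: M_def)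
      with P R show "x \<in> \<Union>M" by auto
    qed
  qed (auto simp: M_def)
  have disj: "R \<inter> R' = {}" if "R \<in> M" "R' \<in> M" "R \<noteq> R'" for R R'
    using nested[OF MD(1)[OF that(1)] MD(1)[OF that(2)]] that by (auto simp: M_def)
  have ind: "indicator (\<Union>M) x = (\<Sum>R\<in>M. indicator R x :: real)" for x
    using fin(2) disj by (intro indicator_UN_disjoint[of M "\<lambda>R. R", simplified] ) (auto simp: disjoint_family_on_def)
  have sum_int: "(LINT x:\<Union>M|lebesgue. f x) = (\<Sum>R\<in>M. LINT x:R|lebesgue. f x)"
    if "\<And>R. R \<in> \<D> \<Longrightarrow> set_integrable lebesgue R f" for f :: "'a \<Rightarrow> real"
    unfolding set_lebesgue_integral_def ind
    using that MD(1) by (simp add: sum_distrib_right set_integrable_def)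
  have int\<nu>: "set_integrable lebesgue R \<nu>" if "R \<in> sets lebesgue" "bounded R" for R
    using \<nu> that by (intro locally_integrable_set) (auto simp: weight_def)
  have UM: "\<Union>M \<in> sets lebesgue" "\<Union>M \<subseteq> Q"
    using MD sets_cube fin by (auto intro!: sets.finite_Union)
  note intb = integrable_osc[OF b, where c = "average b Q"]
  have m: "0 < mass \<nu> R" if "R \<in> \<D>" for R using mass_pos[OF \<nu> that] .
  have "4 * osc b Q / mass \<nu> Q * mass \<nu> (\<Union>M) = (\<Sum>R\<in>M. 4 * osc b Q / mass \<nu> Q * mass \<nu> R)"
    unfolding mass_def[of \<nu> "\<Union>M"] using sum_int[of \<nu>] int\<nu> sets_cube bounded_cube
    by (simp add: mass_def sum_distrib_left)
  also have "\<dots> \<le> (\<Sum>R\<in>M. osc b R)"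
  proof (rule sum_mono)
    fix R assume R: "R \<in> M"
    have "4 * (osc b Q / mass \<nu> Q) * mass \<nu> R \<le> osc b R / mass \<nu> R * mass \<nu> R"
      using growth[OF Q MD(2,3)[OF R]] m[OF MD(1)[OF R]] by (intro mult_right_mono) auto
    then show "4 * osc b Q / mass \<nu> Q * mass \<nu> R \<le> osc b R"
      using m[OF MD(1)[OF R]] by simp
  qed
  also have "\<dots> \<le> (\<Sum>R\<in>M. 2 * (LINT x:R|lebesgue. norm (b x - average b Q)))"
    using MD by (intro sum_mono osc_le b)
  also have "\<dots> = 2 * (LINT x:\<Union>M|lebesgue. norm (b x - average b Q))"
    using sum_int[OF intb] by (simp add: sum_distrib_left)
  also have "(LINT x:\<Union>M|lebesgue. norm (b x - average b Q)) \<le> osc b Q"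
    unfolding osc_def set_lebesgue_integral_def
  proof (rule integral_mono)
    show "integrable lebesgue (\<lambda>x. indicator (\<Union>M) x *\<^sub>R norm (b x - average b Q))"
      using set_integrable_subset[OF intb[OF QD] UM] by (simp add: set_integrable_def)
    show "integrable lebesgue (\<lambda>x. indicator Q x *\<^sub>R norm (b x - average b Q))"
      using intb[OF QD] by (simp add: set_integrable_def)
    show "indicator (\<Union>M) x *\<^sub>R norm (b x - average b Q) \<le> indicator Q x *\<^sub>R norm (b x - average b Q)" for x
      using UM(2) by (intro scaleR_right_mono) (auto simp: indicator_def)
  qed
  finally have "4 * osc b Q / mass \<nu> Q * mass \<nu> (\<Union>M) \<le> 2 * osc b Q" by simp
  then have half: "2 * mass \<nu> (\<Union>M) \<le> mass \<nu> Q"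
    using pos[OF Q] m[OF QD] by (simp add: field_simps)
  have "mass \<nu> Q = mass \<nu> (\<Union>M) + mass \<nu> (Q - \<Union>M)"
  proof -
    have "bounded (\<Union>M)" "bounded (Q - \<Union>M)"
      using bounded_cube[OF QD] UM(2) by (auto intro: bounded_subset)
    then have "(LINT x:(\<Union>M \<union> (Q - \<Union>M))|lebesgue. \<nu> x) = mass \<nu> (\<Union>M) + mass \<nu> (Q - \<Union>M)"
      unfolding mass_def using UM sets_cube[OF QD] by (intro set_integral_Un int\<nu>) auto
    moreover have "\<Union>M \<union> (Q - \<Union>M) = Q" using UM(2) by auto
    ultimately show ?thesis by (simp add: mass_def)
  qed
  then show ?thesis
    using half \<open>\<Union>G = \<Union>M\<close> by (simp add: G_def)
qed

text \<open>Sparseness bounds \<open>w(Q)\<close> by twice \<open>w(Q)/\<nu>(Q)\<close> times the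
  \<nu>-mass of the part of \<open>Q\<close> outside all smaller members. These parts are disjoint,
  and on each of them the ratio competes in the supremum inside the characteristic. So the sum is at
  most twice one integral over \<open>R\<close>.\<close>

lemma Carleson_from_Ainf:
  assumes w: "weight w" and \<nu>: "weight \<nu>" and S: "finite S" "S \<subseteq> \<D>"
    and sparse: "\<And>Q. Q \<in> S \<Longrightarrow> mass \<nu> Q \<le> 2 * mass \<nu> (Q - \<Union>{R\<in>S. R \<subset> Q})"
    and A: "Ainf_char \<D> \<nu> w \<le> ennreal A" "0 \<le> A" and R: "R \<in> S"
  shows "(\<Sum>Q\<in>{Q\<in>S. Q \<subseteq> R}. mass w Q) \<le> 2 * A * mass w R"
proof -
  define E where "E Q = Q - \<Union>{R\<in>S. R \<subset> Q}" for Q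
  define k where "k Q = 2 * (mass w Q / mass \<nu> Q)" for Q
  have E: "E Q \<in> sets lebesgue" "bounded (E Q)" "E Q \<subseteq> Q" if "Q \<in> S" for Q
    using that S sets_cube bounded_cube
    by (auto simp: E_def intro!: sets.Diff sets.finite_Union bounded_diff)
  have RD: "R \<in> \<D>" using R S by auto
  have k: "0 \<le> k Q" for Q using mass_nonneg[OF w] mass_nonneg[OF \<nu>] by (simp add: k_def)
  have [measurable]: "\<nu> \<in> borel_measurable lebesgue" "\<And>Q. Q \<in> S \<Longrightarrow> E Q \<in> sets lebesgue"
    using weight_measurable[OF \<nu>] E by auto
  let ?s = "\<lambda>x. SUP P\<in>{P\<in>\<D>. x \<in> P \<and> P \<subseteq> R}. weight_of w P / weight_of \<nu> P"
  have "ennreal (\<Sum>Q\<in>{Q\<in>S. Q \<subseteq> R}. mass w Q) \<le> ennreal (\<Sum>Q\<in>{Q\<in>S. Q \<subseteq> R}. k Q * mass \<nu> (E Q))"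
  proof (intro ennreal_leI sum_mono)
    fix Q assume "Q \<in> {Q\<in>S. Q \<subseteq> R}"
    then have Q: "Q \<in> S" by simp
    have "mass w Q = mass w Q / mass \<nu> Q * mass \<nu> Q"
      using mass_pos[OF \<nu>, of Q] Q S by auto
    also have "\<dots> \<le> mass w Q / mass \<nu> Q * (2 * mass \<nu> (E Q))"
      using sparse[OF Q] mass_nonneg[OF w] mass_nonneg[OF \<nu>]
      by (intro mult_left_mono divide_nonneg_nonneg) (auto simp: E_def)
    finally show "mass w Q \<le> k Q * mass \<nu> (E Q)" by (simp add: k_def mult_ac)
  qed
  also have "\<dots> = (\<Sum>Q\<in>{Q\<in>S. Q \<subseteq> R}. ennreal (k Q) * weight_of \<nu> (E Q))"
    using k mass_nonneg[OF \<nu>] E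
    by (subst sum_ennreal[symmetric]) (auto simp: weight_of_mass[OF \<nu>] ennreal_mult' intro!: sum.cong)
  also have "\<dots> = (\<integral>\<^sup>+x. (\<Sum>Q\<in>{Q\<in>S. Q \<subseteq> R}. ennreal (k Q) * (ennreal (\<nu> x) * indicator (E Q) x)) \<partial>lebesgue)"
    by (subst nn_integral_sum) (auto simp: nn_integral_cmult weight_of_def)
  also have "\<dots> \<le> (\<integral>\<^sup>+x. 2 * (?s x * ennreal (\<nu> x) * indicator R x) \<partial>lebesgue)"
  proof (rule nn_integral_mono)
    fix x
    show "(\<Sum>Q\<in>{Q\<in>S. Q \<subseteq> R}. ennreal (k Q) * (ennreal (\<nu> x) * indicator (E Q) x))
        \<le> 2 * (?s x * ennreal (\<nu> x) * indicator R x)"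
    proof (cases "\<exists>Q\<in>{Q\<in>S. Q \<subseteq> R}. x \<in> E Q")
      case True
      then obtain Q where Q: "Q \<in> S" "Q \<subseteq> R" "x \<in> E Q" by auto
      have xQ: "x \<in> Q" and QD: "Q \<in> \<D>"
        using E(3)[OF Q(1)] Q S by auto
      \<comment> \<open>Two members containing \<open>x\<close> are nested, and the part belonging
        to the larger excludes the smaller.\<close>
      have unique: "Q' = Q" if "Q' \<in> S" "x \<in> E Q'" for Q'
      proof -
        have "Q' \<inter> Q \<noteq> {}" using that Q E by blast
        then have "Q' \<subseteq> Q \<or> Q \<subseteq> Q'" using nested that Q S by blast
        then show ?thesis using that Q by (auto simp: E_def)
      qed
      have "(\<Sum>Q'\<in>{Q\<in>S. Q \<subseteq> R}. ennreal (k Q') * (ennreal (\<nu> x) * indicator (E Q') x))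
          = (\<Sum>Q'\<in>{Q\<in>S. Q \<subseteq> R}. if Q' = Q then ennreal (k Q) * ennreal (\<nu> x) else 0)"
      proof (intro sum.cong refl)
        fix Q' assume "Q' \<in> {Q\<in>S. Q \<subseteq> R}"
        then show "ennreal (k Q') * (ennreal (\<nu> x) * indicator (E Q') x)
            = (if Q' = Q then ennreal (k Q) * ennreal (\<nu> x) else 0)"
          using unique[of Q'] Q(3) by (cases "Q' = Q") (auto simp: indicator_def)
      qed
      also have "\<dots> = ennreal (k Q) * ennreal (\<nu> x)"
        using S Q by simp
      also have "ennreal (k Q) = 2 * (weight_of w Q / weight_of \<nu> Q)"
      proof -
        have "weight_of w Q / weight_of \<nu> Q = ennreal (mass w Q / mass \<nu> Q)"
          using mass_pos[OF \<nu> QD] mass_nonneg[OF w] by (simp add: weight_of_cube w \<nu> QD divide_ennreal)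
        moreover have "ennreal (k Q) = ennreal 2 * ennreal (mass w Q / mass \<nu> Q)"
          unfolding k_def by (rule ennreal_mult') simp
        ultimately show ?thesis by simp
      qed
      also have "2 * (weight_of w Q / weight_of \<nu> Q) * ennreal (\<nu> x) \<le> 2 * ?s x * ennreal (\<nu> x)"
        using Q xQ QD by (intro mult_right_mono mult_left_mono SUP_upper) auto
      also have "\<dots> = 2 * (?s x * ennreal (\<nu> x) * indicator R x)"
        using Q(2) xQ by (simp add: mult.assoc subset_eq)
      finally show ?thesis .
    next
      case False
      then have "(\<Sum>Q\<in>{Q\<in>S. Q \<subseteq> R}. ennreal (k Q) * (ennreal (\<nu> x) * indicator (E Q) x)) = 0"
        by (intro sum.neutral) (auto simp: indicator_def)
      then show ?thesis by simp
    qed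
  qed
  also have "\<dots> \<le> 2 * (ennreal A * ennreal (mass w R))"
  proof -
    let ?I = "\<integral>\<^sup>+x. ?s x * ennreal (\<nu> x) * indicator R x \<partial>lebesgue"
    have "?I / weight_of w R \<le> Ainf_char \<D> \<nu> w"
      unfolding Ainf_char_def using RD by (intro SUP_upper)
    with A(1) have "?I / ennreal (mass w R) \<le> ennreal A"
      using w RD by (simp add: weight_of_cube)
    then have "?I \<le> ennreal A * ennreal (mass w R)"
      using mass_pos[OF w RD] by (rule ennreal_divide_le_imp)
    moreover have "(\<lambda>x. ?s x * ennreal (\<nu> x) * indicator R x) \<in> borel_measurable lebesgue"
    proof -
      \<comment> \<open>The index set depends on \<open>x\<close>; indicators make it a supremum
        over one countable family of measurable functions.\<close>
      have eq: "?s x = (SUP P\<in>{P\<in>\<D>. P \<subseteq> R}. weight_of w P / weight_of \<nu> P * indicator P x)" for x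
      proof (rule antisym)
        show "?s x \<le> (SUP P\<in>{P\<in>\<D>. P \<subseteq> R}. weight_of w P / weight_of \<nu> P * indicator P x)"
          by (rule SUP_mono) (auto simp: indicator_def)
        show "(SUP P\<in>{P\<in>\<D>. P \<subseteq> R}. weight_of w P / weight_of \<nu> P * indicator P x) \<le> ?s x"
          by (rule SUP_least) (auto simp: indicator_def intro: SUP_upper)
      qed
      have "?s \<in> borel_measurable lebesgue"
        unfolding eq using countable_lattice sets_cube
        by (intro borel_measurable_SUP borel_measurable_times_ennreal borel_measurable_indicator)
          (auto intro: countable_subset)
      then show ?thesis using sets_cube[OF RD] by measurable
    qed
    ultimately show ?thesis
      by (simp add: nn_integral_cmult mult_left_mono)
  qed
  also have "\<dots> = ennreal (2 * A * mass w R)"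
    using A(2) by (simp add: ennreal_mult' mult.assoc)
  finally show ?thesis
    using A(2) mass_nonneg[OF w] by (simp add: ennreal_le_iff)
qed

end


subsection \<open>Consequences of boundedness\<close>

text \<open>The real \<open>N\<close> will be the operator norm. The bound asks for a finite norm of
  \<open>f\<close> since the least constant may be zero: zero times infinity is zero, so for
  infinite norms the inequality need not survive the infimum over admissible constants.\<close>

locale bounded_paraproduct = dyadic_grid \<D> \<D>\<^sub>g
  for \<D> :: "'a::euclidean_space set set" and \<D>\<^sub>g :: "int \<Rightarrow> 'a set set" +
  fixes p q p' q' :: real and \<mu> \<Lambda> \<Lambda>' :: "'a \<Rightarrow> real"
    and b :: "'a \<Rightarrow> 's::{real_normed_field,euclidean_space}" and N :: real
  assumes exponents: "1 < p" "1 < q" "1 < p'" "1 < q'" "1 / p + 1 / p' = 1" "1 / q + 1 / q' = 1"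
    and weights: "weight \<mu>" "weight \<Lambda>" "weight \<Lambda>'"
    and dual_weight: "\<Lambda>' x = \<Lambda> x powr (- q' / q)"
    and b: "locally_integrable b"
    and well_defined: "paraproduct_well_defined \<D> b"
    and N: "0 \<le> N"
    and bound: "f \<in> Linf_c \<Longrightarrow> Lp_norm p \<mu> f < \<infinity>
        \<Longrightarrow> Lp_norm q \<Lambda> (paraproduct \<D> b f) \<le> ennreal N * Lp_norm p \<mu> f"
begin

lemma is_paraproduct: "f \<in> Linf_c \<Longrightarrow> is_paraproduct \<D> b f (paraproduct \<D> b f)"
  using well_defined unfolding paraproduct_well_defined_def paraproduct_def by (metis someI_ex)

definition pairing :: "('a \<Rightarrow> 's) \<Rightarrow> ('a \<Rightarrow> 's) \<Rightarrow> real" where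
  "pairing f h = (LINT x|lebesgue. paraproduct \<D> b f x \<bullet> h x)"

text \<open>Hoelder's inequality after inserting \<open>\<Lambda> powr (1 / q)\<close> and its
  reciprocal: the \<open>q'\<close>-th power of the reciprocal is the dual weight.\<close>

lemma pairing_le:
  assumes f: "f \<in> Linf_c" and h: "h \<in> borel_measurable lebesgue" "\<And>x. norm (h x) \<le> B"
    and S: "S \<in> sets lebesgue" "bounded S" "\<And>x. x \<notin> S \<Longrightarrow> h x = 0"
    and I: "(\<integral>\<^sup>+x. ennreal (norm (f x) powr p * \<mu> x) \<partial>lebesgue) \<le> ennreal I" "0 \<le> I"
    and J: "(\<integral>\<^sup>+x. ennreal (norm (h x) powr q' * \<Lambda>' x) \<partial>lebesgue) \<le> ennreal J" "0 \<le> J"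
  shows "pairing f h \<le> N * I powr (1 / p) * J powr (1 / q')"
proof -
  let ?g = "paraproduct \<D> b f"
  let ?X = "N * I powr (1 / p)"
  have lg: "locally_integrable ?g"
    using is_paraproduct[OF f] by (simp add: is_paraproduct_def)
  have [measurable]: "?g \<in> borel_measurable lebesgue" "\<Lambda> \<in> borel_measurable lebesgue"
      "h \<in> borel_measurable lebesgue"
    using locally_integrable_measurable[OF lg] weight_measurable weights h by auto
  have pos: "0 < \<Lambda> x" for x using weights weight_pos by blast
  have norm_eq: "weighted_norm s w (\<lambda>x. ennreal (norm (u x)))
      = (\<integral>\<^sup>+x. ennreal (norm (u x) powr s * w x) \<partial>lebesgue) epowr (1 / s)"
    for s w and u :: "'a \<Rightarrow> 's"
    by (simp add: weighted_norm_def epowr_ennreal ennreal_mult')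
  have "Lp_norm p \<mu> f \<le> ennreal (I powr (1 / p))"
    using epowr_mono[OF I(1), of "1 / p"] exponents I(2) by (simp add: norm_eq epowr_ennreal)
  moreover from this have "Lp_norm p \<mu> f < \<infinity>"
    using le_less_trans by fastforce
  ultimately have "Lp_norm q \<Lambda> ?g \<le> ennreal N * ennreal (I powr (1 / p))"
    using bound[OF f] by (meson mult_left_mono order_trans zero_le)
  then have "Lp_norm q \<Lambda> ?g \<le> ennreal ?X"
    using N by (simp add: ennreal_mult')
  then have "(\<integral>\<^sup>+x. ennreal (norm (?g x) powr q * \<Lambda> x) \<partial>lebesgue) epowr (1 / q) \<le> ennreal ?X"
    by (simp add: norm_eq)
  then have "((\<integral>\<^sup>+x. ennreal (norm (?g x) powr q * \<Lambda> x) \<partial>lebesgue) epowr (1 / q)) epowr q \<le> ennreal ?X epowr q"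
    using exponents by (intro epowr_mono) auto
  then have G: "(\<integral>\<^sup>+x. ennreal (norm (?g x) powr q * \<Lambda> x) \<partial>lebesgue) \<le> ennreal (?X powr q)"
    using exponents N by (simp add: epowr_epowr epowr_ennreal)
  let ?u = "\<lambda>x. norm (?g x) * \<Lambda> x powr (1 / q)" and ?v = "\<lambda>x. norm (h x) * \<Lambda> x powr (- 1 / q)"
  have "(\<integral>\<^sup>+x. ennreal (?u x * ?v x) \<partial>lebesgue) \<le> ennreal ((?X powr q) powr (1 / q) * J powr (1 / q'))"
  proof (rule nn_integral_Holder)
    have "?u x powr q = norm (?g x) powr q * \<Lambda> x" for x
      using exponents pos[of x] by (simp add: powr_mult powr_powr)
    then show "(\<integral>\<^sup>+x. ennreal (?u x powr q) \<partial>lebesgue) \<le> ennreal (?X powr q)"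
      using G by simp
    have "?v x powr q' = norm (h x) powr q' * \<Lambda>' x" for x
      using exponents pos[of x] dual_weight[of x] by (simp add: powr_mult powr_powr)
    then show "(\<integral>\<^sup>+x. ennreal (?v x powr q') \<partial>lebesgue) \<le> ennreal J"
      using J by simp
  qed (use exponents J in auto)
  also have "(?X powr q) powr (1 / q) = ?X"
    using exponents N by (simp add: powr_powr)
  finally have H: "(\<integral>\<^sup>+x. ennreal (?u x * ?v x) \<partial>lebesgue) \<le> ennreal (?X * J powr (1 / q'))" .
  have int: "integrable lebesgue (\<lambda>x. ?g x \<bullet> h x)"
    by (rule integrable_inner_bounded[OF lg h S])
  have "ennreal (norm (pairing f h)) \<le> (\<integral>\<^sup>+x. ennreal (norm (?g x \<bullet> h x)) \<partial>lebesgue)"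
    unfolding pairing_def using int by (rule integral_norm_bound_ennreal)
  also have "\<dots> \<le> (\<integral>\<^sup>+x. ennreal (?u x * ?v x) \<partial>lebesgue)"
  proof (intro nn_integral_mono ennreal_leI)
    fix x
    have "norm (?g x \<bullet> h x) \<le> norm (?g x) * norm (h x)" by (simp add: Cauchy_Schwarz_ineq2)
    also have "\<dots> = ?u x * ?v x"
      using pos[of x] by (simp add: powr_minus field_simps)
    finally show "norm (?g x \<bullet> h x) \<le> ?u x * ?v x" .
  qed
  also note H
  finally have "\<bar>pairing f h\<bar> \<le> ?X * J powr (1 / q')"
    using N by (simp add: ennreal_le_iff)
  then show ?thesis by simp
qed

lemma indicator_combination_Linf_c:
  assumes "finite S" "S \<subseteq> \<D>"
  shows "(\<lambda>x. \<Sum>P\<in>S. c P *\<^sub>R of_real (indicator P x)) \<in> (Linf_c :: ('a \<Rightarrow> 's) set)"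
proof -
  let ?f = "\<lambda>x. \<Sum>P\<in>S. c P *\<^sub>R of_real (indicator P x) :: 's"
  have [measurable]: "\<And>P. P \<in> S \<Longrightarrow> P \<in> sets lebesgue" using assms sets_cube by auto
  have "?f \<in> borel_measurable lebesgue" by measurable
  moreover have "bounded (range ?f)"
    unfolding bounded_iff
  proof (intro exI ballI)
    fix y assume "y \<in> range ?f"
    then obtain x where "y = ?f x" by auto
    also have "norm (?f x) \<le> (\<Sum>P\<in>S. \<bar>c P\<bar>)"
      by (rule sum_norm_le) (auto simp: indicator_def)
    finally show "norm y \<le> (\<Sum>P\<in>S. \<bar>c P\<bar>)" .
  qed
  moreover have "compact (closure (\<Union>S))"
    using assms bounded_cube by (auto simp: compact_closure)
  moreover have "?f x = 0" if "x \<notin> closure (\<Union>S)" for x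
  proof -
    have "x \<notin> P" if "P \<in> S" for P
      using that \<open>x \<notin> closure (\<Union>S)\<close> closure_subset[of "\<Union>S"] by blast
    then show ?thesis by (intro sum.neutral) auto
  qed
  ultimately show ?thesis unfolding Linf_c_def by blast
qed

lemma indicator_Linf_c: "Q \<in> \<D> \<Longrightarrow> (\<lambda>x. of_real (indicator Q x)) \<in> (Linf_c :: ('a \<Rightarrow> 's) set)"
  using indicator_combination_Linf_c[of "{Q}" "\<lambda>_. 1"] by simp

text \<open>Chosen representatives need not be linear in the input. The finite partial sums are,
  through the averages, and each pairing is the limit of theirs.\<close>

lemma pairing_combination:
  assumes S: "finite S" "S \<subseteq> \<D>" and h: "h \<in> borel_measurable lebesgue" "\<And>x. norm (h x) \<le> B"
    and T: "T \<in> sets lebesgue" "bounded T" "\<And>x. x \<notin> T \<Longrightarrow> h x = 0"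
  shows "pairing (\<lambda>x. \<Sum>P\<in>S. c P *\<^sub>R of_real (indicator P x)) h
    = (\<Sum>P\<in>S. c P * pairing (\<lambda>x. of_real (indicator P x)) h)"
proof -
  let ?i = "\<lambda>P x. of_real (indicator P x) :: 's"
  let ?f = "\<lambda>x. \<Sum>P\<in>S. c P *\<^sub>R ?i P x"
  let ?s = "\<lambda>f F x. \<Sum>Q\<in>F. dyadic_diff \<D> b Q x * average f Q"
  let ?t = "\<lambda>f F. LINT x|lebesgue. ?s f F x \<bullet> h x"
  have sub: "\<D> \<subseteq> sets lebesgue" using sets_cube by auto
  have lim: "(?t f \<longlongrightarrow> pairing f h) (finite_subsets_at_top \<D>)" if "f \<in> Linf_c" for f
    unfolding pairing_def using paraproduct_pairing[OF is_paraproduct[OF that] sub h T] .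
  have eq: "?t ?f F = (\<Sum>P\<in>S. c P * ?t (?i P) F)" if F: "F \<subseteq> \<D>" for F
  proof -
    have avg: "average ?f Q = (\<Sum>P\<in>S. c P *\<^sub>R average (?i P) Q)" if "Q \<in> \<D>" for Q
    proof -
      have "average ?f Q = (\<Sum>P\<in>S. average (\<lambda>x. c P *\<^sub>R ?i P x) Q)"
      proof (rule average_sum)
        fix P assume "P \<in> S"
        then have "locally_integrable (\<lambda>x. indicator P x *\<^sub>R (c P *\<^sub>R (1 :: 's)))"
          using S sub by (intro locally_integrable_indicator) auto
        then have "locally_integrable (\<lambda>x. c P *\<^sub>R ?i P x)"
          by (simp add: of_real_def mult.commute)
        then show "set_integrable lebesgue Q (\<lambda>x. c P *\<^sub>R ?i P x)"
          using that by (intro locally_integrable_set sets_cube bounded_cube)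
      qed
      then show ?thesis by (simp add: average_scaleR)
    qed
    have "?s ?f F x \<bullet> h x = (\<Sum>P\<in>S. c P * (?s (?i P) F x \<bullet> h x))" for x
    proof -
      have "?s ?f F x = (\<Sum>Q\<in>F. \<Sum>P\<in>S. c P *\<^sub>R (dyadic_diff \<D> b Q x * average (?i P) Q))"
        using F by (intro sum.cong refl) (auto simp: avg subset_eq sum_distrib_left)
      also have "\<dots> = (\<Sum>P\<in>S. c P *\<^sub>R ?s (?i P) F x)"
        by (subst sum.swap) (simp add: scaleR_sum_right)
      finally show ?thesis by (simp add: inner_sum_left)
    qed
    then have "?t ?f F = (LINT x|lebesgue. (\<Sum>P\<in>S. c P * (?s (?i P) F x \<bullet> h x)))" by simp
    also have "\<dots> = (\<Sum>P\<in>S. LINT x|lebesgue. c P * (?s (?i P) F x \<bullet> h x))"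
    proof (intro Bochner_Integration.integral_sum integrable_mult_right)
      fix P
      have "locally_integrable (?s (?i P) F)"
        using F locally_integrable_dyadic_diff
        by (intro locally_integrable_sum locally_integrable_mult_left) auto
      then show "integrable lebesgue (\<lambda>x. ?s (?i P) F x \<bullet> h x)"
        by (rule integrable_inner_bounded[OF _ h T])
    qed
    finally show ?thesis by simp
  qed
  have "((\<lambda>F. \<Sum>P\<in>S. c P * ?t (?i P) F) \<longlongrightarrow> (\<Sum>P\<in>S. c P * pairing (?i P) h)) (finite_subsets_at_top \<D>)"
    using S indicator_Linf_c by (intro tendsto_sum tendsto_mult_left lim) auto
  moreover have "((\<lambda>F. \<Sum>P\<in>S. c P * ?t (?i P) F) \<longlongrightarrow> pairing ?f h) (finite_subsets_at_top \<D>)"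
    using lim[OF indicator_combination_Linf_c[OF S]]
  proof (rule Lim_transform_eventually)
    show "\<forall>\<^sub>F F in finite_subsets_at_top \<D>. ?t ?f F = (\<Sum>P\<in>S. c P * ?t (?i P) F)"
      by (rule eventually_finite_subsets_at_top_weakI) (rule eq)
  qed
  ultimately show ?thesis
    using tendsto_unique[OF finite_subsets_at_top_neq_bot] by blast
qed

text \<open>Chosen once for each cube, so that the functions can be combined over a family.\<close>

definition test :: "'a set \<Rightarrow> 'a \<Rightarrow> 's" where
  "test Q = (SOME h. h \<in> borel_measurable lebesgue \<and> (\<forall>x. norm (h x) \<le> 2) \<and> (\<forall>x. x \<notin> Q \<longrightarrow> h x = 0)
     \<and> pairing (\<lambda>x. of_real (indicator Q x)) h = osc b Q)"

text \<open>The pairing identity from \<open>oscillation_test\<close> lives in the extended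
  nonnegative reals, where a negative pairing also becomes zero. For vanishing oscillation the zero
  function is therefore used instead.\<close>

lemma test:
  assumes Q: "Q \<in> \<D>"
  shows "test Q \<in> borel_measurable lebesgue" "norm (test Q x) \<le> 2" "x \<notin> Q \<Longrightarrow> test Q x = 0"
    "norm (test Q x) \<le> 2 * indicator Q x"
    "pairing (\<lambda>x. of_real (indicator Q x)) (test Q) = osc b Q"
proof -
  obtain h :: "'a \<Rightarrow> 's" where h: "h \<in> borel_measurable lebesgue" "\<And>x. norm (h x) \<le> 2"
    "\<And>x. x \<notin> Q \<Longrightarrow> h x = 0"
    "\<And>g. is_paraproduct \<D> b (\<lambda>x. of_real (indicator Q x)) g \<Longrightarrow>
        oscillation b Q = ennreal (LINT x|lebesgue. g x \<bullet> h x)"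
    using oscillation_test[OF b Q] by blast
  have e: "ennreal (osc b Q) = ennreal (pairing (\<lambda>x. of_real (indicator Q x)) h)"
    unfolding pairing_def oscillation_osc[OF b Q, symmetric]
    by (intro h(4) is_paraproduct indicator_Linf_c Q)
  define P where "P h \<longleftrightarrow> h \<in> borel_measurable lebesgue \<and> (\<forall>x. norm (h x) \<le> 2) \<and> (\<forall>x. x \<notin> Q \<longrightarrow> h x = 0)
     \<and> pairing (\<lambda>x. of_real (indicator Q x)) h = osc b Q" for h :: "'a \<Rightarrow> 's"
  have "\<exists>h. P h"
  proof (cases "osc b Q = 0")
    case True
    then show ?thesis unfolding P_def by (intro exI[of _ "\<lambda>_. 0"]) (auto simp: pairing_def)
  next
    case False
    then have "pairing (\<lambda>x. of_real (indicator Q x)) h = osc b Q"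
      using e osc_nonneg[of b Q]
      by (cases "0 \<le> pairing (\<lambda>x. of_real (indicator Q x)) h") (auto simp: ennreal_neg)
    then show ?thesis unfolding P_def using h by blast
  qed
  then have "P (test Q)" unfolding test_def P_def by (rule someI_ex)
  then show "test Q \<in> borel_measurable lebesgue" "norm (test Q x) \<le> 2" "x \<notin> Q \<Longrightarrow> test Q x = 0"
    "norm (test Q x) \<le> 2 * indicator Q x"
    "pairing (\<lambda>x. of_real (indicator Q x)) (test Q) = osc b Q"
    unfolding P_def by (auto simp: indicator_def)
qed

text \<open>The paraproduct of the indicator is paired with \<open>test Q\<close>, whose bound is
  the factor 2. This single-cube estimate yields the BMO bound and shows that \<open>N = 0\<close>
  kills every oscillation.\<close>

lemma osc_bound:
  assumes Q: "Q \<in> \<D>"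
  shows "osc b Q \<le> 2 * N * mass \<mu> Q powr (1 / p) * mass \<Lambda>' Q powr (1 / q')"
proof -
  have mass: "(\<integral>\<^sup>+x. ennreal (indicator Q x * w x) \<partial>lebesgue) = ennreal (mass w Q)" if "weight w" for w
    unfolding weight_of_cube[OF that Q, symmetric] weight_of_def
    by (intro nn_integral_cong) (auto simp: indicator_def)
  have "pairing (\<lambda>x. of_real (indicator Q x)) (test Q)
      \<le> N * mass \<mu> Q powr (1 / p) * (2 powr q' * mass \<Lambda>' Q) powr (1 / q')"
  proof (rule pairing_le[OF indicator_Linf_c[OF Q] test(1,2)[OF Q] sets_cube[OF Q] bounded_cube[OF Q] test(3)[OF Q]])
    show "(\<integral>\<^sup>+x. ennreal (norm (of_real (indicator Q x) :: 's) powr p * \<mu> x) \<partial>lebesgue) \<le> ennreal (mass \<mu> Q)"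
      unfolding mass[OF weights(1), symmetric] using exponents
      by (intro nn_integral_mono) (auto simp: indicator_def)
    have "(\<integral>\<^sup>+x. ennreal (norm (test Q x) powr q' * \<Lambda>' x) \<partial>lebesgue)
        \<le> (\<integral>\<^sup>+x. ennreal (2 powr q') * ennreal (indicator Q x * \<Lambda>' x) \<partial>lebesgue)"
    proof (intro nn_integral_mono)
      fix x
      have "norm (test Q x) powr q' * \<Lambda>' x \<le> 2 powr q' * (indicator Q x * \<Lambda>' x)"
        using test(2,3)[OF Q, of x] exponents weight_nonneg[OF weights(3), of x]
        by (cases "x \<in> Q") (auto intro!: mult_right_mono powr_mono2)
      then show "ennreal (norm (test Q x) powr q' * \<Lambda>' x) \<le> ennreal (2 powr q') * ennreal (indicator Q x * \<Lambda>' x)"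
        by (simp add: ennreal_leI flip: ennreal_mult')
    qed
    also have "\<dots> = ennreal (2 powr q') * ennreal (mass \<Lambda>' Q)"
    proof -
      have [measurable]: "\<Lambda>' \<in> borel_measurable lebesgue" "Q \<in> sets lebesgue"
        using weight_measurable[OF weights(3)] sets_cube[OF Q] by auto
      show ?thesis unfolding mass[OF weights(3), symmetric] by (rule nn_integral_cmult) measurable
    qed
    finally show "(\<integral>\<^sup>+x. ennreal (norm (test Q x) powr q' * \<Lambda>' x) \<partial>lebesgue) \<le> ennreal (2 powr q' * mass \<Lambda>' Q)"
      by (simp add: ennreal_mult')
  qed (use mass_nonneg[OF weights(1)] mass_nonneg[OF weights(3)] in auto)
  also have "(2 powr q' * mass \<Lambda>' Q) powr (1 / q') = 2 * mass \<Lambda>' Q powr (1 / q')"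
    using exponents mass_nonneg[OF weights(3)] by (simp add: powr_mult powr_powr)
  finally show ?thesis
    by (simp add: test(5)[OF Q] mult_ac)
qed

text \<open>The diagonal pairings are the oscillations, and the signs let a single pairing dominate
  their sum. In the norms the signs cost nothing: the two combinations are dominated by
  \<open>\<Sum>R. a R * 1\<^sub>R\<close> and twice \<open>\<Sum>R. c R * 1\<^sub>R\<close>, whose
  norms are sums of jumps.\<close>

lemma osc_combination_bound:
  assumes S: "finite S" "S \<subseteq> \<D>" and a: "\<And>P. 0 \<le> a P" and c: "\<And>P. 0 \<le> c P"
  shows "(\<Sum>Q\<in>S. a Q * c Q * osc b Q)
    \<le> 2 * N * (\<Sum>R\<in>S. power_jump S a p R * mass \<mu> R) powr (1 / p)
        * (\<Sum>R\<in>S. power_jump S c q' R * mass \<Lambda>' R) powr (1 / q')"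
proof -
  let ?i = "\<lambda>P x. of_real (indicator P x) :: 's"
  let ?I = "\<Sum>R\<in>S. power_jump S a p R * mass \<mu> R" and ?J = "\<Sum>R\<in>S. power_jump S c q' R * mass \<Lambda>' R"
  have S': "Q \<in> \<D>" if "Q \<in> S" for Q using that S by auto
  obtain e :: "'a set \<Rightarrow> real" where e: "\<And>Q. \<bar>e Q\<bar> = 1"
    and le: "(\<Sum>Q\<in>S. a Q * c Q * pairing (?i Q) (test Q))
      \<le> (\<Sum>Q\<in>S. \<Sum>R\<in>S. e Q * e R * (a Q * c R * pairing (?i Q) (test R)))"
    using sign_choice[OF S(1), of "\<lambda>Q R. a Q * c R * pairing (?i Q) (test R)"] by blast
  define f where "f x = (\<Sum>P\<in>S. (e P * a P) *\<^sub>R ?i P x)" for x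
  define h where "h x = (\<Sum>R\<in>S. (e R * c R) *\<^sub>R test R x)" for x
  let ?A = "\<lambda>x. \<Sum>R\<in>S. a R * indicator R x" and ?C = "\<lambda>x. \<Sum>R\<in>S. c R * indicator R x"
  have fL: "f \<in> Linf_c" unfolding f_def using S by (rule indicator_combination_Linf_c)
  have hm: "h \<in> borel_measurable lebesgue"
    unfolding h_def using test(1) S' by (intro borel_measurable_sum borel_measurable_scaleR) auto
  have hb: "norm (h x) \<le> (\<Sum>R\<in>S. c R * 2)" for x
    unfolding h_def using test(2) S' e c by (intro sum_norm_le) (auto simp: abs_mult intro!: mult_left_mono)
  have hs: "h x = 0" if "x \<notin> \<Union>S" for x
    unfolding h_def using test(3) S' that by (intro sum.neutral) auto
  have US: "\<Union>S \<in> sets lebesgue" "bounded (\<Union>S)"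
    using S' S(1) sets_cube bounded_cube by (auto intro!: sets.finite_Union)
  have "(\<Sum>Q\<in>S. a Q * c Q * osc b Q) = (\<Sum>Q\<in>S. a Q * c Q * pairing (?i Q) (test Q))"
    using test(5) S' by (intro sum.cong refl) auto
  also note le
  also have "(\<Sum>Q\<in>S. \<Sum>R\<in>S. e Q * e R * (a Q * c R * pairing (?i Q) (test R))) = pairing f h"
  proof -
    have "pairing g h = (\<Sum>R\<in>S. e R * c R * pairing g (test R))" if g: "g \<in> Linf_c" for g
    proof -
      have lg: "locally_integrable (paraproduct \<D> b g)"
        using is_paraproduct[OF g] by (simp add: is_paraproduct_def)
      have "integrable lebesgue (\<lambda>x. paraproduct \<D> b g x \<bullet> test R x)" if "R \<in> S" for R
        using S'[OF that] test(3)
        by (intro integrable_inner_bounded[OF lg, of _ 2 R] test sets_cube bounded_cube)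
      then show ?thesis
        unfolding pairing_def h_def by (simp add: inner_sum_right)
    qed
    then have "pairing f h = (\<Sum>R\<in>S. e R * c R * pairing f (test R))"
      using fL by simp
    also have "\<dots> = (\<Sum>R\<in>S. \<Sum>Q\<in>S. e Q * e R * (a Q * c R * pairing (?i Q) (test R)))"
    proof (intro sum.cong refl)
      fix R assume "R \<in> S"
      note R = S'[OF this]
      have "pairing f (test R) = (\<Sum>Q\<in>S. e Q * a Q * pairing (?i Q) (test R))"
        unfolding f_def
        by (rule pairing_combination[OF S test(1,2)[OF R] sets_cube[OF R] bounded_cube[OF R] test(3)[OF R]])
      then show "e R * c R * pairing f (test R) = (\<Sum>Q\<in>S. e Q * e R * (a Q * c R * pairing (?i Q) (test R)))"
        by (simp add: sum_distrib_left mult_ac)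
    qed
    finally show ?thesis by (subst sum.swap) simp
  qed
  also have "\<dots> \<le> N * ?I powr (1 / p) * (2 powr q' * ?J) powr (1 / q')"
  proof (rule pairing_le[OF fL hm hb US hs])
    have "norm (f x) \<le> ?A x" for x
      unfolding f_def using e a by (intro sum_norm_le) (auto simp: indicator_def abs_mult)
    then have "norm (f x) powr p * \<mu> x \<le> ?A x powr p * \<mu> x" for x
      using exponents weight_nonneg[OF weights(1)] by (intro mult_right_mono powr_mono2) auto
    then show "(\<integral>\<^sup>+x. ennreal (norm (f x) powr p * \<mu> x) \<partial>lebesgue) \<le> ennreal ?I"
      using exponents
      by (subst nn_integral_sum_powr[where a = a, OF weights(1) S a, symmetric])
        (auto intro!: nn_integral_mono ennreal_leI)
    have "norm (h x) \<le> 2 * ?C x" for x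
      unfolding h_def sum_distrib_left using e c test(4) S'
      by (intro sum_norm_le) (auto simp: abs_mult mult.left_commute intro!: mult_left_mono)
    then have "norm (h x) powr q' * \<Lambda>' x \<le> (2 * ?C x) powr q' * \<Lambda>' x" for x
      using exponents weight_nonneg[OF weights(3)] by (intro mult_right_mono powr_mono2) auto
    also have "(2 * ?C x) powr q' * \<Lambda>' x = 2 powr q' * (?C x powr q' * \<Lambda>' x)" for x
      using c by (simp add: powr_mult sum_nonneg)
    finally have hC: "norm (h x) powr q' * \<Lambda>' x \<le> 2 powr q' * (?C x powr q' * \<Lambda>' x)" for x .
    have "(\<integral>\<^sup>+x. ennreal (norm (h x) powr q' * \<Lambda>' x) \<partial>lebesgue)
        \<le> (\<integral>\<^sup>+x. ennreal (2 powr q') * ennreal (?C x powr q' * \<Lambda>' x) \<partial>lebesgue)"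
      using hC by (intro nn_integral_mono) (simp add: ennreal_leI flip: ennreal_mult')
    also have "\<dots> = ennreal (2 powr q') * (\<integral>\<^sup>+x. ennreal (?C x powr q' * \<Lambda>' x) \<partial>lebesgue)"
    proof -
      have [measurable]: "\<Lambda>' \<in> borel_measurable lebesgue" "\<And>Q. Q \<in> S \<Longrightarrow> Q \<in> sets lebesgue"
        using weight_measurable[OF weights(3)] sets_cube S' by auto
      show ?thesis by (rule nn_integral_cmult) measurable
    qed
    also have "\<dots> = ennreal (2 powr q' * ?J)"
      using exponents by (subst nn_integral_sum_powr[where a = c, OF weights(3) S c]) (auto simp: ennreal_mult')
    finally show "(\<integral>\<^sup>+x. ennreal (norm (h x) powr q' * \<Lambda>' x) \<partial>lebesgue) \<le> ennreal (2 powr q' * ?J)" .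
    show "0 \<le> ?I"
      using exponents power_jump_nonneg[where a = a, OF S(1) _ a] mass_nonneg[OF weights(1)]
      by (intro sum_nonneg mult_nonneg_nonneg) auto
    show "0 \<le> 2 powr q' * ?J"
      using exponents power_jump_nonneg[where a = c, OF S(1) _ c] mass_nonneg[OF weights(3)]
      by (intro sum_nonneg mult_nonneg_nonneg) auto
  qed
  also have "(2 powr q' * ?J) powr (1 / q') = 2 * ?J powr (1 / q')"
  proof -
    have "0 \<le> ?J"
      using exponents power_jump_nonneg[where a = c, OF S(1) _ c] mass_nonneg[OF weights(3)]
      by (intro sum_nonneg mult_nonneg_nonneg) auto
    then show ?thesis using exponents by (simp add: powr_mult powr_powr)
  qed
  finally show ?thesis by (simp add: mult_ac)
qed

end


section \<open>The sharp maximal function in the case \<open>q < p\<close>\<close>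

context bounded_paraproduct
begin

lemma difference_exponent_pos:
  assumes "1 / r = 1 / q - 1 / p" "q < p"
  shows "0 < r"
proof -
  have "0 < 1 / r"
    unfolding assms(1) using assms(2) exponents by (simp add: field_simps)
  then show ?thesis by simp
qed

text \<open>By the choice of the coefficients, \<open>a Q powr p * mass \<mu> Q\<close> and
  \<open>c Q powr q' * mass \<Lambda>' Q\<close> both equal
  \<open>m Q powr r * mass \<nu> Q\<close>, so both Carleson embeddings return powers of
  \<open>V\<close>. The mass ratios left in \<open>a Q * c Q\<close> form the reciprocal of the
  factor bounded by \<open>B\<close>.\<close>

lemma level_sum_bound:
  fixes \<nu> :: "'a \<Rightarrow> real" and r A\<^sub>1 A\<^sub>2 B :: real
  defines "m \<equiv> \<lambda>Q. osc b Q / mass \<nu> Q"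
  assumes \<nu>: "weight \<nu>" and r: "1 / r = 1 / q - 1 / p" "q < p"
    and S: "finite S" "S \<subseteq> \<D>" "\<And>Q. Q \<in> S \<Longrightarrow> 0 < osc b Q"
    and growth: "\<And>Q R. Q \<in> S \<Longrightarrow> R \<in> S \<Longrightarrow> R \<subset> Q \<Longrightarrow> 4 * m Q < m R"
    and B: "\<And>Q. Q \<in> \<D> \<Longrightarrow> (mass \<mu> Q / mass \<nu> Q) powr (1 / p) * (mass \<Lambda>' Q / mass \<nu> Q) powr (1 / q') \<le> B"
    and A\<^sub>1: "Ainf_char \<D> \<nu> \<mu> \<le> ennreal A\<^sub>1" "0 \<le> A\<^sub>1"
    and A\<^sub>2: "Ainf_char \<D> \<nu> \<Lambda>' \<le> ennreal A\<^sub>2" "0 \<le> A\<^sub>2"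
  shows "(\<Sum>Q\<in>S. m Q powr r * mass \<nu> Q) powr (1 / r)
    \<le> B * (2 * N * (p * (2 * A\<^sub>1) powr (1 / p')) * (q' * (2 * A\<^sub>2) powr (1 / q)))"
proof -
  define V where "V = (\<Sum>Q\<in>S. m Q powr r * mass \<nu> Q)"
  define a where "a Q = m Q powr (r / p) * (mass \<nu> Q / mass \<mu> Q) powr (1 / p)" for Q
  define c where "c Q = m Q powr (r / q') * (mass \<nu> Q / mass \<Lambda>' Q) powr (1 / q')" for Q
  let ?I = "\<Sum>R\<in>S. power_jump S a p R * mass \<mu> R" and ?J = "\<Sum>R\<in>S. power_jump S c q' R * mass \<Lambda>' R"
  let ?Y = "2 * N * (p * (2 * A\<^sub>1) powr (1 / p')) * (q' * (2 * A\<^sub>2) powr (1 / q))"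
  have SD: "Q \<in> \<D>" if "Q \<in> S" for Q using that S by auto
  have pos: "0 < mass \<mu> Q" "0 < mass \<Lambda>' Q" "0 < mass \<nu> Q" "0 < m Q" if "Q \<in> S" for Q
    using mass_pos weights \<nu> SD[OF that] S(3)[OF that] by (auto simp: m_def)
  have B0: "0 \<le> B"
  proof -
    obtain Q where "Q \<in> \<D>" using lattice_nonempty by auto
    from B[OF this] show ?thesis by (meson mult_nonneg_nonneg order_trans powr_ge_zero)
  qed
  have r0: "0 < r" by (rule difference_exponent_pos[OF r])
  have V0: "0 \<le> V" unfolding V_def using pos by (intro sum_nonneg) (auto simp: less_imp_le)
  \<comment> \<open>Two powers of \<open>m Q\<close> come from the coefficients and one from the
    oscillation; together they make \<open>m Q powr r\<close>.\<close>
  have rsum: "r / p + r / q' + 1 = r"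
  proof -
    have "r * (1 / p + 1 / q') = r * (1 - 1 / r)"
      using r(1) exponents(6) by (intro arg_cong2[where f = times]) auto
    then show ?thesis using r0 by (simp add: algebra_simps)
  qed
  have Y0: "0 \<le> ?Y" using N exponents by auto
  have nn: "0 \<le> a P" "0 \<le> c P" for P by (auto simp: a_def c_def)
  have lam: "laminar S" "{} \<notin> S" using laminar_subset[OF S(2)] nonempty S(2) by auto
  have sparse: "mass \<nu> Q \<le> 2 * mass \<nu> (Q - \<Union>{R\<in>S. R \<subset> Q})" if "Q \<in> S" for Q
    using sparse[OF b \<nu> S(1,2,3) _ that] growth by (simp add: m_def)
  have carl: "(\<Sum>Q\<in>{Q\<in>S. Q \<subseteq> R}. mass w Q) \<le> 2 * A * mass w R"
    if "weight w" "Ainf_char \<D> \<nu> w \<le> ennreal A" "0 \<le> A" "R \<in> S" for w A R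
    using Carleson_from_Ainf[OF that(1) \<nu> S(1,2) sparse that(2,3,4)] .
  have "?I powr (1 / p) \<le> p * (2 * A\<^sub>1) powr (1 / p') * (\<Sum>R\<in>S. a R powr p * mass \<mu> R) powr (1 / p)"
    using exponents nn mass_nonneg[OF weights(1)] carl[OF weights(1) A\<^sub>1] A\<^sub>1(2)
    by (intro Carleson_embedding S lam) auto
  also have "(\<Sum>R\<in>S. a R powr p * mass \<mu> R) = V"
    unfolding V_def
  proof (intro sum.cong refl)
    fix R assume "R \<in> S"
    from pos[OF this] show "a R powr p * mass \<mu> R = m R powr r * mass \<nu> R"
      using exponents by (simp add: a_def powr_mult powr_powr less_imp_le)
  qed
  finally have I: "?I powr (1 / p) \<le> p * (2 * A\<^sub>1) powr (1 / p') * V powr (1 / p)" .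
  have "?J powr (1 / q') \<le> q' * (2 * A\<^sub>2) powr (1 / q) * (\<Sum>R\<in>S. c R powr q' * mass \<Lambda>' R) powr (1 / q')"
    using exponents nn mass_nonneg[OF weights(3)] carl[OF weights(3) A\<^sub>2] A\<^sub>2(2)
    by (intro Carleson_embedding S lam) auto
  also have "(\<Sum>R\<in>S. c R powr q' * mass \<Lambda>' R) = V"
    unfolding V_def
  proof (intro sum.cong refl)
    fix R assume "R \<in> S"
    from pos[OF this] show "c R powr q' * mass \<Lambda>' R = m R powr r * mass \<nu> R"
      using exponents by (simp add: c_def powr_mult powr_powr less_imp_le)
  qed
  finally have J: "?J powr (1 / q') \<le> q' * (2 * A\<^sub>2) powr (1 / q) * V powr (1 / q')" .
  have "V \<le> (\<Sum>Q\<in>S. B * (a Q * c Q * osc b Q))"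
    unfolding V_def
  proof (rule sum_mono)
    fix Q assume Q: "Q \<in> S"
    let ?k = "(mass \<mu> Q / mass \<nu> Q) powr (1 / p) * (mass \<Lambda>' Q / mass \<nu> Q) powr (1 / q')"
    have "m Q powr r = m Q powr (r / p) * m Q powr (r / q') * m Q"
      using pos(4)[OF Q] by (subst rsum[symmetric]) (simp only: powr_add powr_one)
    moreover have "osc b Q = m Q * mass \<nu> Q"
      using pos(3)[OF Q] by (simp add: m_def)
    moreover have "(mass \<mu> Q / mass \<nu> Q) powr (1 / p) * (mass \<nu> Q / mass \<mu> Q) powr (1 / p) = 1"
      "(mass \<Lambda>' Q / mass \<nu> Q) powr (1 / q') * (mass \<nu> Q / mass \<Lambda>' Q) powr (1 / q') = 1"
      using pos[OF Q] by (simp_all flip: powr_mult)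
    ultimately have "m Q powr r * mass \<nu> Q = ?k * (a Q * c Q * osc b Q)"
      by (simp add: a_def c_def algebra_simps)
    also have "\<dots> \<le> B * (a Q * c Q * osc b Q)"
      using B[OF SD[OF Q]] by (intro mult_right_mono mult_nonneg_nonneg nn osc_nonneg)
    finally show "m Q powr r * mass \<nu> Q \<le> B * (a Q * c Q * osc b Q)" .
  qed
  also have "\<dots> = B * (\<Sum>Q\<in>S. a Q * c Q * osc b Q)" by (simp add: sum_distrib_left)
  also have "\<dots> \<le> B * (2 * N * ?I powr (1 / p) * ?J powr (1 / q'))"
    using osc_combination_bound[where a = a and c = c, OF S(1,2) nn] B0 by (intro mult_left_mono)
  also have "\<dots> \<le> B * (2 * N * (p * (2 * A\<^sub>1) powr (1 / p') * V powr (1 / p)) * (q' * (2 * A\<^sub>2) powr (1 / q) * V powr (1 / q')))"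
    using B0 N exponents by (intro mult_left_mono mult_mono I J) auto
  finally have main: "V \<le> (B * ?Y) * (V powr (1 / p) * V powr (1 / q'))"
    by (simp add: mult_ac)
  show ?thesis
  proof (cases "V = 0")
    case True
    then show ?thesis using B0 Y0 r0 by (simp add: V_def[symmetric])
  next
    case False
    then have "0 < V" using V0 by simp
    \<comment> \<open>As a finite sum \<open>V\<close> can be cancelled, which leaves exactly the
      exponent \<open>1 / r\<close>.\<close>
    have "1 / r + (1 / p + 1 / q') = 1"
      using r(1) exponents(6) by simp
    then have "V = V powr (1 / r) * (V powr (1 / p) * V powr (1 / q'))"
      using V0 by (simp flip: powr_add)
    with main have "V powr (1 / r) * (V powr (1 / p) * V powr (1 / q')) \<le> (B * ?Y) * (V powr (1 / p) * V powr (1 / q'))"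
      by simp
    then have "V powr (1 / r) \<le> B * ?Y"
      using \<open>0 < V\<close> by (subst (asm) mult_le_cancel_right) auto
    then show ?thesis by (simp add: V_def)
  qed
qed

text \<open>For a finite family the supremum at \<open>x\<close> is at most a sum over the stopping
  cubes containing \<open>x\<close>, with the factor 4 inside the power. The resulting bound does
  not depend on the family.\<close>

lemma sharp_maximal_bound:
  fixes \<nu> :: "'a \<Rightarrow> real" and r A\<^sub>1 A\<^sub>2 B :: real
  assumes \<nu>: "weight \<nu>" and r: "1 / r = 1 / q - 1 / p" "q < p"
    and B: "\<And>Q. Q \<in> \<D> \<Longrightarrow> (mass \<mu> Q / mass \<nu> Q) powr (1 / p) * (mass \<Lambda>' Q / mass \<nu> Q) powr (1 / q') \<le> B"
    and A\<^sub>1: "Ainf_char \<D> \<nu> \<mu> \<le> ennreal A\<^sub>1" "0 \<le> A\<^sub>1"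
    and A\<^sub>2: "Ainf_char \<D> \<nu> \<Lambda>' \<le> ennreal A\<^sub>2" "0 \<le> A\<^sub>2"
  shows "weighted_norm r \<nu> (sharp_maximal \<D> \<nu> b)
    \<le> ennreal (4 * (B * (2 * N * (p * (2 * A\<^sub>1) powr (1 / p')) * (q' * (2 * A\<^sub>2) powr (1 / q)))))"
proof -
  let ?X = "B * (2 * N * (p * (2 * A\<^sub>1) powr (1 / p')) * (q' * (2 * A\<^sub>2) powr (1 / q)))"
  define m where "m Q = osc b Q / mass \<nu> Q" for Q
  define u where "u Q x = ennreal ((indicator Q x * m Q) powr r * \<nu> x)" for Q x
  have [measurable]: "\<nu> \<in> borel_measurable lebesgue" by (rule weight_measurable[OF \<nu>])
  have r0: "0 < r" by (rule difference_exponent_pos[OF r])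
  have m0: "0 \<le> m Q" for Q unfolding m_def by (intro divide_nonneg_nonneg osc_nonneg mass_nonneg[OF \<nu>])
  have B0: "0 \<le> B"
  proof -
    obtain Q where "Q \<in> \<D>" using lattice_nonempty by auto
    from B[OF this] show ?thesis by (meson mult_nonneg_nonneg order_trans powr_ge_zero)
  qed
  have X0: "0 \<le> ?X" using B0 N exponents by auto
  have "sharp_maximal \<D> \<nu> b x = (SUP Q\<in>\<D>. ennreal (indicator Q x * m Q))" for x
    unfolding sharp_maximal_def
  proof (rule SUP_cong[OF refl])
    fix Q assume Q: "Q \<in> \<D>"
    have "indicator Q x / weight_of \<nu> Q * oscillation b Q = ennreal (indicator Q x / mass \<nu> Q) * ennreal (osc b Q)"
      using mass_pos[OF \<nu> Q]
      by (simp add: weight_of_cube[OF \<nu> Q] oscillation_osc[OF b Q] divide_ennreal flip: ennreal_indicator)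
    also have "\<dots> = ennreal (indicator Q x / mass \<nu> Q * osc b Q)"
      by (rule ennreal_mult''[OF osc_nonneg, symmetric])
    finally show "indicator Q x / weight_of \<nu> Q * oscillation b Q = ennreal (indicator Q x * m Q)"
      by (simp add: m_def)
  qed
  moreover have "ennreal (indicator Q x * m Q) epowr r * ennreal (\<nu> x) = u Q x" for Q x
    unfolding u_def using m0[of Q] by (subst epowr_ennreal) (auto simp: ennreal_mult')
  ultimately have "sharp_maximal \<D> \<nu> b x epowr r * ennreal (\<nu> x) = (SUP Q\<in>\<D>. u Q x)" for x
    by (simp only: SUP_epowr[OF r0] SUP_mult_right_ennreal)
  then have eq: "weighted_norm r \<nu> (sharp_maximal \<D> \<nu> b) = (\<integral>\<^sup>+x. (SUP Q\<in>\<D>. u Q x) \<partial>lebesgue) epowr (1 / r)"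
    by (simp add: weighted_norm_def)
  have "(\<integral>\<^sup>+x. (SUP Q\<in>\<D>. u Q x) \<partial>lebesgue) \<le> ennreal ((4 * ?X) powr r)"
  proof (rule nn_integral_SUP_le[OF countable_lattice])
    show "u Q \<in> borel_measurable lebesgue" if "Q \<in> \<D>" for Q
      unfolding u_def using sets_cube[OF that] by measurable
    fix F assume F: "finite F" "F \<subseteq> \<D>"
    \<comment> \<open>Cubes of zero oscillation are removed beforehand: sparseness needs positive
      oscillations, and these cubes contribute nothing to the supremum.\<close>
    obtain S where S: "S \<subseteq> {Q\<in>F. 0 < osc b Q}"
      and growth: "\<And>Q R. Q \<in> S \<Longrightarrow> R \<in> S \<Longrightarrow> R \<subset> Q \<Longrightarrow> 4 * m Q < m R"
      and cover: "\<And>Q. Q \<in> {Q\<in>F. 0 < osc b Q} \<Longrightarrow> \<exists>P\<in>S. Q \<subseteq> P \<and> m Q \<le> 4 * m P"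
      using stopping_family[of "{Q\<in>F. 0 < osc b Q}" 4 m] F m0 by auto
    have fin: "finite S" "S \<subseteq> \<D>" using S F by (auto intro: finite_subset)
    have [measurable]: "\<And>Q. Q \<in> S \<Longrightarrow> Q \<in> sets lebesgue" using fin sets_cube by auto
    let ?t = "\<lambda>Q x. ennreal ((4 * m Q) powr r) * (ennreal (\<nu> x) * indicator Q x)"
    have "(SUP Q\<in>F. u Q x) \<le> (\<Sum>Q\<in>S. ?t Q x)" for x
    proof (rule SUP_least)
      fix Q assume Q: "Q \<in> F"
      show "u Q x \<le> (\<Sum>Q\<in>S. ?t Q x)"
      proof (cases "x \<in> Q \<and> 0 < osc b Q")
        case True
        then obtain P where P: "P \<in> S" "Q \<subseteq> P" "m Q \<le> 4 * m P" using cover Q by auto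
        have "(indicator Q x * m Q) powr r * \<nu> x \<le> (4 * m P) powr r * \<nu> x"
          using True P(3) m0[of Q] r0 weight_nonneg[OF \<nu>, of x] by (intro mult_right_mono powr_mono2) auto
        then have "u Q x \<le> ?t P x"
          using True P(2) by (auto simp: u_def subset_eq ennreal_leI simp flip: ennreal_mult')
        also have "\<dots> \<le> (\<Sum>Q\<in>S. ?t Q x)"
          using P(1) fin(1) by (intro member_le_sum) auto
        finally show ?thesis .
      next
        case False
        then have "indicator Q x * m Q = 0"
          using osc_nonneg[of b Q] by (auto simp: m_def indicator_def)
        then have "u Q x = 0" unfolding u_def by (simp only:) simp
        then show ?thesis by simp
      qed
    qed
    then have "(\<integral>\<^sup>+x. (SUP Q\<in>F. u Q x) \<partial>lebesgue) \<le> (\<integral>\<^sup>+x. (\<Sum>Q\<in>S. ?t Q x) \<partial>lebesgue)"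
      by (intro nn_integral_mono)
    also have "\<dots> = (\<Sum>Q\<in>S. ennreal ((4 * m Q) powr r) * weight_of \<nu> Q)"
      by (subst nn_integral_sum) (auto simp: nn_integral_cmult weight_of_def)
    also have "\<dots> = (\<Sum>Q\<in>S. ennreal (4 powr r * (m Q powr r * mass \<nu> Q)))"
      using fin m0 by (intro sum.cong refl) (auto simp: weight_of_cube[OF \<nu>] powr_mult mult.assoc simp flip: ennreal_mult')
    also have "\<dots> = ennreal (4 powr r * (\<Sum>Q\<in>S. m Q powr r * mass \<nu> Q))"
      using mass_nonneg[OF \<nu>] by (subst sum_ennreal) (auto simp: sum_distrib_left)
    also have "\<dots> \<le> ennreal (4 powr r * ?X powr r)"
    proof (intro ennreal_leI mult_left_mono)
      let ?V = "\<Sum>Q\<in>S. m Q powr r * mass \<nu> Q"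
      have V0: "0 \<le> ?V" using mass_nonneg[OF \<nu>] by (intro sum_nonneg) auto
      have "?V powr (1 / r) \<le> ?X"
        unfolding m_def using S fin growth
        by (intro level_sum_bound \<nu> r B A\<^sub>1 A\<^sub>2) (auto simp: m_def)
      then have "(?V powr (1 / r)) powr r \<le> ?X powr r"
        using r0 by (intro powr_mono2) auto
      then show "?V \<le> ?X powr r"
        using r0 V0 by (simp add: powr_powr)
    qed simp
    also have "4 powr r * ?X powr r = (4 * ?X) powr r"
      by (rule powr_mult[symmetric])
    finally show "(\<integral>\<^sup>+x. (SUP Q\<in>F. u Q x) \<partial>lebesgue) \<le> ennreal ((4 * ?X) powr r)" .
  qed
  then have "weighted_norm r \<nu> (sharp_maximal \<D> \<nu> b) \<le> ennreal ((4 * ?X) powr r) epowr (1 / r)"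
    unfolding eq using r0 by (intro epowr_mono) auto
  also have "\<dots> = ennreal (4 * ?X)"
    using X0 r0 by (simp add: epowr_ennreal powr_powr)
  finally show ?thesis .
qed

text \<open>For \<open>N = 0\<close> the claimed right-hand side is zero even when a characteristic
  is infinite, so this case needs an argument of its own.\<close>

lemma sharp_maximal_zero:
  assumes "N = 0"
  shows "sharp_maximal \<D> \<nu> b x = 0"
proof -
  have "oscillation b Q = 0" if "Q \<in> \<D>" for Q
    using osc_bound[OF that] osc_nonneg[of b Q] assms by (simp add: oscillation_osc[OF b that])
  then show ?thesis
    by (simp add: sharp_maximal_def lattice_nonempty cong: SUP_cong)
qed

end

section \<open>From extended-valued characteristics to real constants\<close>

lemma (in dyadic_grid) B_char_le:
  assumes w: "weight \<mu>" "weight \<sigma>" "weight \<nu>" and B: "B_char \<D> p s \<nu> \<mu> \<sigma> = ennreal B" "0 \<le> B"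
    and Q: "Q \<in> \<D>"
  shows "(mass \<mu> Q / mass \<nu> Q) powr (1 / p) * (mass \<sigma> Q / mass \<nu> Q) powr (1 / s) \<le> B"
proof -
  have "(weight_of \<mu> Q / weight_of \<nu> Q) epowr (1 / p) * (weight_of \<sigma> Q / weight_of \<nu> Q) epowr (1 / s) \<le> ennreal B"
    unfolding B(1)[symmetric] B_char_def using Q by (intro SUP_upper)
  then show ?thesis
    using mass_pos[OF w(1) Q] mass_pos[OF w(2) Q] mass_pos[OF w(3) Q] B(2)
    by (simp add: weight_of_cube w Q divide_ennreal epowr_ennreal less_imp_le ennreal_le_iff flip: ennreal_mult')
qed

text \<open>If the norm of \<open>f\<close> is positive, dividing by it lets the infimum over
  constants be taken. If it is zero, one admissible constant already forces the left side to vanish,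
  and one exists because an empty infimum would be infinite.\<close>

lemma paraproduct_norm_bound:
  assumes "f \<in> Linf_c" "Lp_norm p \<mu> f < \<infinity>" "paraproduct_norm \<D> b p \<mu> q \<Lambda> < \<infinity>"
  shows "Lp_norm q \<Lambda> (paraproduct \<D> b f) \<le> paraproduct_norm \<D> b p \<mu> q \<Lambda> * Lp_norm p \<mu> f"
proof -
  let ?G = "Lp_norm q \<Lambda> (paraproduct \<D> b f)" and ?A = "{N. paraproduct_bound \<D> b p \<mu> q \<Lambda> N}"
  have bound: "?G \<le> N * Lp_norm p \<mu> f" if "N \<in> ?A" for N
    using that assms(1) by (auto simp: paraproduct_bound_def)
  obtain L where L: "Lp_norm p \<mu> f = ennreal L" "0 \<le> L"
    using assms(2) by (cases "Lp_norm p \<mu> f") auto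
  show ?thesis
  proof (cases "L = 0")
    case True
    have "?A \<noteq> {}"
    proof
      assume "?A = {}"
      then have "paraproduct_norm \<D> b p \<mu> q \<Lambda> = \<infinity>"
        by (simp only: paraproduct_norm_def Inf_empty infinity_ennreal_def)
      with assms(3) show False by simp
    qed
    then show ?thesis using bound L True by auto
  next
    case False
    then have "0 < L" using L by simp
    have "?G / ennreal L \<le> N" if "N \<in> ?A" for N
      using bound[OF that] \<open>0 < L\<close> by (intro divide_le_posI_ennreal) (auto simp: L mult.commute)
    then have "?G / ennreal L \<le> Inf ?A" by (intro Inf_greatest)
    then show ?thesis
      unfolding L(1) paraproduct_norm_def using \<open>0 < L\<close> by (rule ennreal_divide_le_imp)
  qed
qed

lemma conj_exponent:
  assumes "1 < p"
  shows "1 < conj_exponent p" "1 / p + 1 / conj_exponent p = 1"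
  using assms by (simp_all add: conj_exponent_def field_simps)

theorem theorem4p4:
  fixes p q p' q' r \<alpha> :: real
  assumes "1 < p" and "1 < q"
    and "p' = conj_exponent p" and "q' = conj_exponent q"
    and "1 / r = 1 / q - 1 / p"
    and "\<alpha> / real DIM('a::euclidean_space) = 1 / p - 1 / q"
  shows "\<exists>C>0. \<forall>(\<D> :: 'a set set) (\<mu> :: 'a \<Rightarrow> real) (\<Lambda> :: 'a \<Rightarrow> real) (\<Lambda>' :: 'a \<Rightarrow> real)
           (\<nu> :: 'a \<Rightarrow> real) (b :: 'a \<Rightarrow> 's::{real_normed_field,euclidean_space}).
       dyadic_lattice \<D> \<longrightarrow>
       weight \<mu> \<longrightarrow> weight \<Lambda> \<longrightarrow> weight \<Lambda>' \<longrightarrow> weight \<nu> \<longrightarrow>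
       (\<forall>x. \<Lambda>' x = \<Lambda> x powr (- q' / q)) \<longrightarrow>
       (\<forall>x. \<nu> x powr (1 / p + 1 / q') = \<mu> x powr (1 / p) * \<Lambda> x powr (- 1 / q)) \<longrightarrow>
       locally_integrable b \<longrightarrow>
       paraproduct_bounded \<D> b p \<mu> q \<Lambda> \<longrightarrow>
       B_char \<D> p q' \<nu> \<mu> \<Lambda>' < \<infinity> \<longrightarrow>
       (p \<le> q \<longrightarrow>
          BMO_norm \<D> \<alpha> \<nu> b
            \<le> ennreal C * B_char \<D> p q' \<nu> \<mu> \<Lambda>' * paraproduct_norm \<D> b p \<mu> q \<Lambda>) \<and>
       (q < p \<longrightarrow>
          weighted_norm r \<nu> (sharp_maximal \<D> \<nu> b)
            \<le> ennreal C * B_char \<D> p q' \<nu> \<mu> \<Lambda>' * Ainf_char \<D> \<nu> \<mu> epowr (1 / p')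
                * Ainf_char \<D> \<nu> \<Lambda>' epowr (1 / q) * paraproduct_norm \<D> b p \<mu> q \<Lambda>)"
proof -
  \<comment> \<open>The summand 2 serves the BMO bound. In the product, 8 is the stopping factor 4
    times the bound 2 of the test functions, \<open>p\<close> and \<open>q'\<close> come from the
    Carleson embeddings, and the powers of 2 from sparseness.\<close>
  define C where "C = 2 + 8 * p * q' * 2 powr (1 / p') * 2 powr (1 / q)"
  have conj: "1 < p'" "1 < q'" "1 / p + 1 / p' = 1" "1 / q + 1 / q' = 1"
    using conj_exponent[of p] conj_exponent[of q] assms(1-4) by simp_all
  have C: "2 \<le> C" "8 * p * q' * 2 powr (1 / p') * 2 powr (1 / q) \<le> C"
    using assms(1) conj by (auto simp: C_def)
  show ?thesis
  proof (intro exI[of _ C] conjI allI impI)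
    show "0 < C" using C by simp
  next
    fix \<D> :: "'a set set" and \<mu> \<Lambda> \<Lambda>' \<nu> :: "'a \<Rightarrow> real" and b :: "'a \<Rightarrow> 's"
    assume lattice: "dyadic_lattice \<D>" and w: "weight \<mu>" "weight \<Lambda>" "weight \<Lambda>'" "weight \<nu>"
      and dual: "\<forall>x. \<Lambda>' x = \<Lambda> x powr (- q' / q)" and b: "locally_integrable b"
      and bdd: "paraproduct_bounded \<D> b p \<mu> q \<Lambda>" and finB: "B_char \<D> p q' \<nu> \<mu> \<Lambda>' < \<infinity>"
    obtain \<D>\<^sub>g where "dyadic_grid \<D> \<D>\<^sub>g" using dyadic_latticeE[OF lattice] .
    then interpret dyadic_grid \<D> \<D>\<^sub>g .
    let ?N = "paraproduct_norm \<D> b p \<mu> q \<Lambda>"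
    obtain N' where N': "N' < \<infinity>" "paraproduct_bound \<D> b p \<mu> q \<Lambda> N'"
      using bdd by (auto simp: paraproduct_bounded_def)
    have "?N \<le> N'"
      unfolding paraproduct_norm_def by (rule Inf_lower) (simp add: N'(2))
    then have finN: "?N < \<infinity>"
      using N'(1) by (rule le_less_trans)
    then obtain N where norm_eq: "?N = ennreal N" and N_nonneg: "0 \<le> N" by (cases ?N) auto
    obtain B where B: "B_char \<D> p q' \<nu> \<mu> \<Lambda>' = ennreal B" "0 \<le> B"
      using finB by (cases "B_char \<D> p q' \<nu> \<mu> \<Lambda>'") auto
    interpret bounded_paraproduct \<D> \<D>\<^sub>g p q p' q' \<mu> \<Lambda> \<Lambda>' b N
    proof
      show "Lp_norm q \<Lambda> (paraproduct \<D> b f) \<le> ennreal N * Lp_norm p \<mu> f"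
        if "f \<in> Linf_c" "Lp_norm p \<mu> f < \<infinity>" for f
        using paraproduct_norm_bound[OF that finN] by (simp add: norm_eq)
    qed (use assms conj w dual b bdd N_nonneg in \<open>auto simp: paraproduct_bounded_def\<close>)
    note Ble = B_char_le[OF w(1,3,4) B]
    show "BMO_norm \<D> \<alpha> \<nu> b \<le> ennreal C * B_char \<D> p q' \<nu> \<mu> \<Lambda>' * ?N"
      unfolding BMO_norm_def
    proof (rule SUP_least)
      fix Q assume Q: "Q \<in> \<D>"
      have pos: "0 < mass \<mu> Q" "0 < mass \<Lambda>' Q" "0 < mass \<nu> Q"
        using mass_pos w Q by auto
      \<comment> \<open>This is the power of \<open>mass \<nu> Q\<close> that remains when the
        B-characteristic is factored out of the two masses.\<close>
      have e: "1 + \<alpha> / real DIM('a) = 1 / p + 1 / q'"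
        using assms(6) conj by simp
      have "mass \<mu> Q powr (1 / p) * mass \<Lambda>' Q powr (1 / q')
          = ((mass \<mu> Q / mass \<nu> Q) powr (1 / p) * (mass \<Lambda>' Q / mass \<nu> Q) powr (1 / q'))
            * mass \<nu> Q powr (1 / p + 1 / q')"
        using pos by (simp add: powr_divide powr_add)
      also have "\<dots> \<le> B * mass \<nu> Q powr (1 / p + 1 / q')"
        using Ble[OF Q] by (intro mult_right_mono) auto
      finally have "(2 * N) * (mass \<mu> Q powr (1 / p) * mass \<Lambda>' Q powr (1 / q'))
          \<le> (C * N) * (B * mass \<nu> Q powr (1 / p + 1 / q'))"
        using N_nonneg C(1) by (intro mult_mono[of "2 * N" "C * N"]) (auto intro: mult_right_mono)
      then have "osc b Q \<le> C * B * N * mass \<nu> Q powr (1 / p + 1 / q')"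
        using osc_bound[OF Q] by (simp add: mult_ac)
      then have "osc b Q / mass \<nu> Q powr (1 / p + 1 / q') \<le> C * B * N"
        using pos by (simp add: divide_le_eq)
      then show "oscillation b Q / weight_of \<nu> Q epowr (1 + \<alpha> / real DIM('a))
          \<le> ennreal C * B_char \<D> p q' \<nu> \<mu> \<Lambda>' * ?N"
        using pos osc_nonneg[of b Q] C(1) B(2) N_nonneg
        by (simp add: oscillation_osc[OF b Q] weight_of_cube[OF w(4) Q] e epowr_ennreal divide_ennreal
            B(1) norm_eq ennreal_leI flip: ennreal_mult')
    qed
    assume "q < p"
    let ?A\<^sub>1 = "Ainf_char \<D> \<nu> \<mu>" and ?A\<^sub>2 = "Ainf_char \<D> \<nu> \<Lambda>'"
    let ?R = "ennreal C * B_char \<D> p q' \<nu> \<mu> \<Lambda>' * ?A\<^sub>1 epowr (1 / p') * ?A\<^sub>2 epowr (1 / q) * ?N"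
    show "weighted_norm r \<nu> (sharp_maximal \<D> \<nu> b) \<le> ?R"
    proof (cases "N = 0")
      case True
      have "weighted_norm r \<nu> (sharp_maximal \<D> \<nu> b) = 0"
        using sharp_maximal_zero[OF True] by (simp add: weighted_norm_def epowr_def)
      then show ?thesis by simp
    next
      case False
      then have N0: "0 < N" using N_nonneg by simp
      have B0: "0 < B"
      proof -
        obtain Q where Q: "Q \<in> \<D>" using lattice_nonempty by auto
        have "0 < (mass \<mu> Q / mass \<nu> Q) powr (1 / p) * (mass \<Lambda>' Q / mass \<nu> Q) powr (1 / q')"
          using mass_pos[OF w(1) Q] mass_pos[OF w(3) Q] mass_pos[OF w(4) Q] by simp
        then show ?thesis using Ble[OF Q] by linarith
      qed
      have A: "1 \<le> ?A\<^sub>1" "1 \<le> ?A\<^sub>2"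
        using Ainf_char_ge_1 w by auto
      have A': "1 \<le> ?A\<^sub>1 epowr (1 / p')" "1 \<le> ?A\<^sub>2 epowr (1 / q)"
        using epowr_mono[OF A(1), of "1 / p'"] epowr_mono[OF A(2), of "1 / q"] conj assms(2)
        by (simp_all add: epowr_def)
      show ?thesis
      proof (cases "?A\<^sub>1 = \<infinity> \<or> ?A\<^sub>2 = \<infinity>")
        case True
        \<comment> \<open>No factor is zero: \<open>C\<close>, \<open>B\<close> and \<open>N\<close>
          are positive and both characteristics are at least one.\<close>
        have "?R = \<infinity>"
          using True A' C(1) B0 N0
          by (auto simp: B(1) norm_eq ennreal_mult_eq_top_iff ennreal_eq_0_iff)
        then show ?thesis by simp
      next
        case False
        then obtain A\<^sub>1 A\<^sub>2 where A12: "?A\<^sub>1 = ennreal A\<^sub>1" "0 \<le> A\<^sub>1" "?A\<^sub>2 = ennreal A\<^sub>2" "0 \<le> A\<^sub>2"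
          by (cases ?A\<^sub>1; cases ?A\<^sub>2) auto
        let ?Z = "B * A\<^sub>1 powr (1 / p') * A\<^sub>2 powr (1 / q) * N"
        have "weighted_norm r \<nu> (sharp_maximal \<D> \<nu> b)
            \<le> ennreal (4 * (B * (2 * N * (p * (2 * A\<^sub>1) powr (1 / p')) * (q' * (2 * A\<^sub>2) powr (1 / q)))))"
          by (rule sharp_maximal_bound[OF w(4) assms(5) \<open>q < p\<close> Ble]) (use A12 in auto)
        also have "4 * (B * (2 * N * (p * (2 * A\<^sub>1) powr (1 / p')) * (q' * (2 * A\<^sub>2) powr (1 / q))))
            = (8 * p * q' * 2 powr (1 / p') * 2 powr (1 / q)) * ?Z"
          using A12 by (simp add: powr_mult mult_ac)
        also have "ennreal \<dots> \<le> ennreal (C * ?Z)"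
          using C(2) B0 N0 by (intro ennreal_leI mult_right_mono) auto
        also have "\<dots> = ?R"
          using C(1) B0 N0 A12 by (simp add: B(1) norm_eq epowr_ennreal mult.assoc flip: ennreal_mult')
        finally show ?thesis .
      qed
    qed
  qed
qed

end
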